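(* Let $G$ be a group admitting two co-amenable subgroups that commute with each other (every element of the first commutes with every element of the second). Then every action of $G$ by homeomorphisms on a local dendrite $X$ preserves a Borel probability measure on $X$.
   Context: A subgroup $H$ of a (discrete) group $G$ is co-amenable if every affine $G$-action by homeomorphisms on a (non-empty) convex compact set in a Hausdorff locally convex topological vector space has a $G$-fixed point whenever it has an $H$-fixed point; equivalently, there is a $G$-invariant mean on the coset space $G/H$. A continuum is a non-empty connected compact metrisable space. A dendrite is a locally connected continuum containing no simple closed curve. A local dendrite is a continuum in which every point has a neighbourhood which is a dendrite. *)

theory Defs
  imports "HOL-Probability.Probability" "HOL-Algebra.Group_Action" "HOL-Algebra.Left_Coset"
begin

text \<open>
  A mean on a set \<open>S\<close> is a normalised positive linear functional on the bounded real
  functions on \<open>S\<close>.  Functions on \<open>S\<close> are represented by total functions; linearity and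
  positivity force \<open>m f\<close> to depend only on the values of \<open>f\<close> on \<open>S\<close>.
\<close>

definition bounded_fun_on :: "'s set \<Rightarrow> ('s \<Rightarrow> real) \<Rightarrow> bool" where
  "bounded_fun_on S f \<longleftrightarrow> bounded (f ` S)"

definition is_mean_on :: "'s set \<Rightarrow> (('s \<Rightarrow> real) \<Rightarrow> real) \<Rightarrow> bool" where
  "is_mean_on S m \<longleftrightarrow>
     (\<forall>f g. bounded_fun_on S f \<longrightarrow> bounded_fun_on S g \<longrightarrow> m (\<lambda>s. f s + g s) = m f + m g) \<and>
     (\<forall>c f. bounded_fun_on S f \<longrightarrow> m (\<lambda>s. c * f s) = c * m f) \<and>
     (\<forall>f. bounded_fun_on S f \<longrightarrow> (\<forall>s\<in>S. 0 \<le> f s) \<longrightarrow> 0 \<le> m f) \<and>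
     m (\<lambda>s. 1) = 1"

text \<open>
  The coset space \<open>G/H\<close> is the set of left cosets \<open>a H\<close>, on which \<open>G\<close> acts by left
  translation.  The definition of co-amenability by fixed points of affine actions ranges over
  all locally convex spaces, that is, over types; the definition by an invariant mean on
  \<open>G/H\<close> does not.
\<close>

definition coamenable :: "'g set \<Rightarrow> ('g, 'm) monoid_scheme \<Rightarrow> bool" where
  "coamenable H G \<longleftrightarrow>
     subgroup H G \<and>
     (\<exists>m. is_mean_on (lcosets\<^bsub>G\<^esub> H) m \<and>
        (\<forall>g\<in>carrier G. \<forall>f. bounded_fun_on (lcosets\<^bsub>G\<^esub> H) f \<longrightarrow>
           m (\<lambda>C. f (g <#\<^bsub>G\<^esub> C)) = m f))"

definition continuum :: "'a topology \<Rightarrow> bool" where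
  "continuum X \<longleftrightarrow>
     topspace X \<noteq> {} \<and> connected_space X \<and> compact_space X \<and> metrizable_space X"

definition simple_closed_curve_in :: "'a topology \<Rightarrow> 'a set \<Rightarrow> bool" where
  "simple_closed_curve_in X C \<longleftrightarrow>
     C \<subseteq> topspace X \<and>
     subtopology X C homeomorphic_space top_of_set (sphere (0::complex) 1)"

definition dendrite :: "'a topology \<Rightarrow> bool" where
  "dendrite X \<longleftrightarrow>
     continuum X \<and> locally_connected_space X \<and> (\<nexists>C. simple_closed_curve_in X C)"

definition local_dendrite :: "'a topology \<Rightarrow> bool" where
  "local_dendrite X \<longleftrightarrow>
     continuum X \<and>
     (\<forall>x\<in>topspace X. \<exists>U N. openin X U \<and> x \<in> U \<and> U \<subseteq> N \<and> N \<subseteq> topspace X \<and>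
        dendrite (subtopology X N))"

text \<open>
  In \<^const>\<open>group_action\<close> the bijections \<open>\<phi> g\<close> of \<^term>\<open>topspace X\<close> are extensional, that is,
  \<open>undefined\<close> off \<^term>\<open>topspace X\<close>.
\<close>

definition action_by_homeomorphisms ::
    "('g, 'm) monoid_scheme \<Rightarrow> 'a topology \<Rightarrow> ('g \<Rightarrow> 'a \<Rightarrow> 'a) \<Rightarrow> bool" where
  "action_by_homeomorphisms G X \<phi> \<longleftrightarrow>
     group_action G (topspace X) \<phi> \<and> (\<forall>g\<in>carrier G. homeomorphic_map X X (\<phi> g))"

definition borel_probability_on :: "'a topology \<Rightarrow> 'a measure \<Rightarrow> bool" where
  "borel_probability_on X M \<longleftrightarrow>
     prob_space M \<and> space M = topspace X \<and>
     sets M = sigma_sets (topspace X) {U. openin X U}"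

definition invariant_measure ::
    "('g, 'm) monoid_scheme \<Rightarrow> ('g \<Rightarrow> 'a \<Rightarrow> 'a) \<Rightarrow> 'a measure \<Rightarrow> bool" where
  "invariant_measure G \<phi> M \<longleftrightarrow>
     (\<forall>g\<in>carrier G. \<phi> g \<in> measurable M M \<and> distr M M (\<phi> g) = M)"

end

theory Submission
  imports Defs
begin

text \<open>
  An invariant measure for a co-amenable subgroup can be averaged over the coset space, so it is
  enough that of two commuting groups \<open>\<Gamma>\<close>, \<open>\<Delta>\<close> of homeomorphisms of \<open>X\<close> one preserves a finitely
  additive probability on the Borel sets. If \<open>X\<close> is a dendrite, either two disjoint closed
  \<open>\<Gamma>\<close>-invariant sets exist, and then the places where one is first seen from the hull of the other
  form a finite invariant set, or the intersection of all closed \<open>\<Gamma>\<close>-invariant sets is nonempty and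
  is fixed pointwise by \<open>\<Delta>\<close>, because each single homeomorphism of a dendrite has a fixed point. If
  \<open>X\<close> contains two different simple closed curves, the branch points of the graph that they span form
  a finite invariant set. If it contains exactly one, both groups act on that circle; lifting to
  the line, either there is a finite orbit modulo 1, or \<open>\<Delta>\<close> contains fixed-point-free lifts with
  arbitrarily small steps, and counting these steps yields a measure invariant under \<open>\<Gamma>\<close>.
\<close>

section \<open>Locally connected compacta are locally path connected\<close>

text \<open>A mean on a coset space is only finitely additive, so averaging over it turns even a
  measure into a charge. All earlier constructions may therefore end in charges as well, and
  countable additivity is restored once, at the end, by a regularisation that involves no choices
  and so keeps the invariance. Which of the two subgroups obtains the charge depends on the case;
  its own co-amenability then spreads the charge to the whole group. A local dendrite enters through
  its local connectedness, which supplies paths, and through a radius \<open>\<epsilon>\<close> such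
  that no simple closed curve fits into a ball of that radius. This radius makes the branch points
  finite in number: each carries three disjoint legs of a fixed length, and two crowded systems of
  such legs would close up to a small loop. Arcs are treated through cutting: a point lies between
  two others if every path joining them runs through it, a relation that is closed and invariant
  under homeomorphisms. On a circle, elements that reverse the orientation have no increasing lift;
  lifts see only a subgroup of index at most two, and an average of two charges removes this
  restriction.\<close>

lemma connected_neighbour_modulus:
  fixes S :: "'a::metric_space set"
  assumes "compact S" "locally connected S" "0 < e"
  obtains d where "0 < d" "d \<le> e"
    "\<And>x y. x \<in> S \<Longrightarrow> y \<in> S \<Longrightarrow> dist x y < d \<Longrightarrow>
       \<exists>C. connected C \<and> C \<subseteq> S \<and> x \<in> C \<and> y \<in> C \<and> C \<subseteq> ball x e"
proof -
  have "\<exists>T C. open T \<and> z \<in> T \<and> connected C \<and> S \<inter> T \<subseteq> C \<and> C \<subseteq> S \<and> C \<subseteq> ball z (e/2)"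
    if "z \<in> S" for z
  proof -
    have "openin (top_of_set S) (S \<inter> ball z (e/2))" "z \<in> S \<inter> ball z (e/2)"
      using that \<open>0 < e\<close> by auto
    then obtain U where "openin (top_of_set S) U" "connected U" "z \<in> U" "U \<subseteq> S \<inter> ball z (e/2)"
      using assms(2) unfolding locally_connected by meson
    then show ?thesis
      by (metis Int_lower1 IntE inf.boundedE openin_open order_refl)
  qed
  then obtain T C where TC: "\<And>z. z \<in> S \<Longrightarrow> open (T z) \<and> z \<in> T z \<and> connected (C z) \<and>
      S \<inter> T z \<subseteq> C z \<and> C z \<subseteq> S \<and> C z \<subseteq> ball z (e/2)"
    by metis
  \<comment> \<open>A Lebesgue number of the cover by the sets \<open>T z\<close> makes the local
    choice uniform.\<close>
  obtain d where "0 < d" and d: "\<And>x. x \<in> S \<Longrightarrow> \<exists>G \<in> T ` S. ball x d \<subseteq> G"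
    using Heine_Borel_lemma[of S "T ` S"] assms(1) TC by (metis (no_types, lifting) UN_I imageE subsetI)
  show thesis
  proof (rule that[of "min d e"])
    fix x y assume xy: "x \<in> S" "y \<in> S" "dist x y < min d e"
    then obtain z where z: "z \<in> S" "ball x d \<subseteq> T z"
      using d by blast
    have "x \<in> C z" "y \<in> C z"
      using z xy TC[of z] \<open>0 < d\<close> by (auto simp: subset_iff)
    moreover have "C z \<subseteq> ball x e"
    proof
      fix w assume "w \<in> C z"
      then have "dist z w < e/2" "dist z x < e/2"
        using TC[OF z(1)] \<open>x \<in> C z\<close> by (auto simp: subset_iff)
      then show "w \<in> ball x e"
        using dist_triangle_less_add[of x z "e/2" w "e/2"] by (simp add: dist_commute)
    qed
    ultimately show "\<exists>C. connected C \<and> C \<subseteq> S \<and> x \<in> C \<and> y \<in> C \<and> C \<subseteq> ball x e"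
      using TC[OF z(1)] by blast
  qed (use \<open>0 < d\<close> \<open>0 < e\<close> in auto)
qed

text \<open>
  Since \<^const>\<open>joinpaths\<close> does not increase uniform distances, polygonal paths with short links
  can be refined by rule induction, without any bookkeeping of partitions.
\<close>

inductive chain_path :: "'a::real_normed_vector set \<Rightarrow> real \<Rightarrow> (real \<Rightarrow> 'a) \<Rightarrow> bool"
  for S d where
  link: "p \<in> S \<Longrightarrow> q \<in> S \<Longrightarrow> dist p q < d \<Longrightarrow> chain_path S d (linepath p q)"
| join: "chain_path S d g \<Longrightarrow> chain_path S d h \<Longrightarrow> pathfinish g = pathstart h \<Longrightarrow> chain_path S d (g +++ h)"

lemma chain_path_path:
  "chain_path S d g \<Longrightarrow> path g \<and> pathstart g \<in> S \<and> pathfinish g \<in> S"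
  by (induction rule: chain_path.induct) auto

lemma chain_path_near:
  "chain_path S d g \<Longrightarrow> y \<in> path_image g \<Longrightarrow> \<exists>x\<in>S. dist x y < d"
proof (induction arbitrary: y rule: chain_path.induct)
  case (link p q)
  then have "dist p y \<le> dist p q"
    using segment_bound(1)[of y p q] by (simp add: dist_norm norm_minus_commute)
  then show ?case
    using link by force
next
  case (join g h)
  then show ?case
    by (auto simp: path_image_join)
qed

text \<open>Being reachable from \<open>p\<close> by links shorter than \<open>d\<close> is a
  locally constant property on \<open>C\<close>, so it spreads over the whole connected set. The
  links themselves may leave \<open>S\<close>; they stay in the ball because it is convex.\<close>

lemma chain_path_in_connected:
  fixes C :: "'a::real_normed_vector set"
  assumes "connected C" "p \<in> C" "q \<in> C" "C \<subseteq> S" "C \<subseteq> ball a e" "0 < d"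
  obtains g where "chain_path S d g" "pathstart g = p" "pathfinish g = q" "path_image g \<subseteq> ball a e"
proof -
  define R where "R x \<longleftrightarrow> (\<exists>g. chain_path S d g \<and> pathstart g = p \<and> pathfinish g = x \<and> path_image g \<subseteq> ball a e)" for x
  have step: "chain_path S d (linepath x y) \<and> path_image (linepath x y) \<subseteq> ball a e"
    if "x \<in> C" "y \<in> C" "dist x y < d" for x y
  proof
    show "chain_path S d (linepath x y)"
      using that assms by (intro link) auto
    show "path_image (linepath x y) \<subseteq> ball a e"
      using closed_segment_subset[OF subsetD[OF assms(5) that(1)] subsetD[OF assms(5) that(2)] convex_ball] by simp
  qed
  have "R q"
  proof (rule connected_induction_simple[OF assms(1-3)])
    show "R p"
      unfolding R_def using step[of p p] assms by (intro exI[of _ "linepath p p"]) auto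
    fix x assume "x \<in> C"
    show "\<exists>T. openin (top_of_set C) T \<and> x \<in> T \<and> (\<forall>y\<in>T. \<forall>z\<in>T. R y \<longrightarrow> R z)"
    proof (intro exI conjI ballI impI)
      show "openin (top_of_set C) (C \<inter> ball x (d/2))" "x \<in> C \<inter> ball x (d/2)"
        using \<open>x \<in> C\<close> \<open>0 < d\<close> by auto
      fix y z assume yz: "y \<in> C \<inter> ball x (d/2)" "z \<in> C \<inter> ball x (d/2)" "R y"
      then have "dist y z < d"
        using dist_triangle_half_r[of x y d z] by auto
      obtain g where "chain_path S d g" "pathstart g = p" "pathfinish g = y" "path_image g \<subseteq> ball a e"
        using yz(3) R_def by auto
      then show "R z"
        unfolding R_def using step[of y z] yz \<open>dist y z < d\<close>
        by (intro exI[of _ "g +++ linepath y z"]) (auto simp: path_image_join intro: join)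
    qed
  qed
  then show thesis
    using that R_def by auto
qed

lemma dist_joinpaths_le:
  assumes "\<And>t. t \<in> {0..1} \<Longrightarrow> dist (g t) (g' t) \<le> e" "\<And>t. t \<in> {0..1} \<Longrightarrow> dist (h t) (h' t) \<le> e" "t \<in> {0..1}"
  shows "dist ((g +++ h) t) ((g' +++ h') t) \<le> e"
  using assms by (auto simp: joinpaths_def)

text \<open>Each link is replaced by a finer chain along a connected subset of \<open>S\<close> that
  lies in a ball of radius \<open>e\<close>. Link and chain both stay within \<open>e\<close> of the
  first end point of the link, hence the bound \<open>2 * e\<close>, which joining
  preserves.\<close>

lemma chain_path_refine:
  fixes S :: "'a::real_normed_vector set"
  assumes "chain_path S d g" "0 < d'" "d \<le> e"
    and "\<And>x y. x \<in> S \<Longrightarrow> y \<in> S \<Longrightarrow> dist x y < d \<Longrightarrow>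
       \<exists>C. connected C \<and> C \<subseteq> S \<and> x \<in> C \<and> y \<in> C \<and> C \<subseteq> ball x e"
  shows "\<exists>g'. chain_path S d' g' \<and> pathstart g' = pathstart g \<and> pathfinish g' = pathfinish g \<and>
           (\<forall>t\<in>{0..1}. dist (g t) (g' t) \<le> 2 * e)"
  using assms(1)
proof (induction rule: chain_path.induct)
  case (link p q)
  then obtain C where C: "connected C" "C \<subseteq> S" "p \<in> C" "q \<in> C" "C \<subseteq> ball p e"
    using assms(4) by meson
  obtain g' where g': "chain_path S d' g'" "pathstart g' = p" "pathfinish g' = q" "path_image g' \<subseteq> ball p e"
    using chain_path_in_connected[OF C(1,3,4,2,5) assms(2)] by metis
  have "dist (linepath p q t) (g' t) \<le> 2 * e" if t: "t \<in> {0..1}" for t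
  proof -
    have "linepath p q t \<in> closed_segment p q"
      using t by (metis linepath_image_01 imageI)
    then have "dist p (linepath p q t) \<le> dist p q"
      using segment_bound(1)[of "linepath p q t" p q] by (simp add: dist_norm norm_minus_commute)
    moreover have "dist p (g' t) < e"
      using g'(4) t by (auto simp: path_image_def image_subset_iff)
    ultimately show ?thesis
      using link(3) assms(3) dist_triangle3[of "linepath p q t" "g' t" p] by auto
  qed
  then show ?case
    using g' by (intro exI[of _ g']) auto
next
  case (join g h)
  then obtain g' h' where
    "chain_path S d' g'" "pathstart g' = pathstart g" "pathfinish g' = pathfinish g" "\<forall>t\<in>{0..1}. dist (g t) (g' t) \<le> 2 * e"
    "chain_path S d' h'" "pathstart h' = pathstart h" "pathfinish h' = pathfinish h" "\<forall>t\<in>{0..1}. dist (h t) (h' t) \<le> 2 * e"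
    by blast
  then show ?case
    using join(3) by (intro exI[of _ "g' +++ h'"]) (auto intro!: chain_path.join dist_joinpaths_le)
qed

text \<open>Refining the straight segment again and again yields paths that converge uniformly. The
  path of index \<open>n\<close> stays within \<open>d n\<close> of \<open>S\<close>, so the limit
  runs in the closed set \<open>S\<close>.\<close>

lemma short_path_exists:
  fixes S :: "'a::{complete_space,real_normed_vector} set"
  assumes "compact S" "locally connected S" "0 < e"
  obtains d where "0 < d" "\<And>x y. x \<in> S \<Longrightarrow> y \<in> S \<Longrightarrow> dist x y < d \<Longrightarrow>
       \<exists>g. path g \<and> path_image g \<subseteq> S \<inter> cball x e \<and> pathstart g = x \<and> pathfinish g = y"
proof -
  \<comment> \<open>The refinements move a point by at most the sum of all \<open>2 * r n\<close>,
    which is \<open>e / 2\<close>, and the initial segment is shorter than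
    \<open>r 0 = e / 8\<close>; together this stays below \<open>e\<close>.\<close>
  define r where "r n = e / 8 / 2 ^ n" for n :: nat
  have r: "0 < r n" for n
    using \<open>0 < e\<close> by (simp add: r_def)
  have "\<exists>d. 0 < d \<and> d \<le> r n \<and> (\<forall>x y. x \<in> S \<longrightarrow> y \<in> S \<longrightarrow> dist x y < d \<longrightarrow>
       (\<exists>C. connected C \<and> C \<subseteq> S \<and> x \<in> C \<and> y \<in> C \<and> C \<subseteq> ball x (r n)))" for n
    using connected_neighbour_modulus[OF assms(1,2) r] by metis
  then obtain d where d: "\<And>n. 0 < d n" "\<And>n. d n \<le> r n" and
    dC: "\<And>n x y. x \<in> S \<Longrightarrow> y \<in> S \<Longrightarrow> dist x y < d n \<Longrightarrow>
       (\<exists>C. connected C \<and> C \<subseteq> S \<and> x \<in> C \<and> y \<in> C \<and> C \<subseteq> ball x (r n))"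
    by metis
  have "\<exists>g. path g \<and> path_image g \<subseteq> S \<inter> cball x e \<and> pathstart g = x \<and> pathfinish g = y"
    if x: "x \<in> S" and y: "y \<in> S" and xy: "dist x y < d 0" for x y
  proof -
    \<comment> \<open>Fixing the path of index 0 to be the segment is what keeps the limit near
      \<open>x\<close>; an arbitrary chain from \<open>x\<close> to \<open>y\<close> could wander
      off.\<close>
    define P where "P n g \<longleftrightarrow> chain_path S (d n) g \<and> pathstart g = x \<and> pathfinish g = y \<and> (n = 0 \<longrightarrow> g = linepath x y)" for n g
    define Q where "Q n g g' \<longleftrightarrow> (\<forall>t\<in>{0..1}. dist (g t) (g' t) \<le> 2 * r n)" for n and g g' :: "real \<Rightarrow> 'a"
    have "\<exists>G. \<forall>n. P n (G n) \<and> Q n (G n) (G (Suc n))"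
    proof (rule dependent_nat_choice)
      show "\<exists>g. P 0 g"
        using x y xy by (auto simp: P_def intro: link)
      show "\<exists>g'. P (Suc n) g' \<and> Q n g g'" if "P n g" for g n
        using chain_path_refine[of S "d n" g "d (Suc n)" "r n"] that d dC[of _ _ n]
        unfolding P_def Q_def by fastforce
    qed
    then obtain G where G: "\<And>n. P n (G n)" "\<And>n. Q n (G n) (G (Suc n))"
      by blast
    \<comment> \<open>The right side is the sum of the geometric series with terms
      \<open>2 * r n\<close> for \<open>n\<close> from \<open>m\<close> to
      \<open>m + k - 1\<close>.\<close>
    have tail: "dist (G m t) (G (m + k) t) \<le> 4 * r m - 4 * r (m + k)" if "t \<in> {0..1}" for m k t
    proof (induction k)
      case (Suc k)
      have "dist (G m t) (G (m + Suc k) t) \<le> dist (G m t) (G (m + k) t) + dist (G (m + k) t) (G (Suc (m + k)) t)"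
        by (simp add: dist_triangle)
      also have "\<dots> \<le> 4 * r m - 4 * r (m + k) + 2 * r (m + k)"
        using Suc G(2)[of "m + k", unfolded Q_def, rule_format, OF that] by linarith
      also have "\<dots> = 4 * r m - 4 * r (m + Suc k)"
        by (simp add: r_def)
      finally show ?case .
    qed auto
    have rlim: "r \<longlonglongrightarrow> 0"
      unfolding r_def using LIMSEQ_divide_realpow_zero[of 2 "e/8"] by simp
    have "uniformly_Cauchy_on {0..1} G"
    proof (rule uniformly_Cauchy_onI')
      fix u :: real assume "0 < u"
      then obtain M where M: "\<And>m. m \<ge> M \<Longrightarrow> r m < u / 4"
        using order_tendstoD(2)[OF rlim, of "u/4"] by (auto simp: eventually_sequentially)
      have "dist (G m t) (G n t) < u" if "t \<in> {0..1}" "M \<le> m" "m < n" for m n t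
        using tail[OF that(1), of m "n - m"] that M[of m] r[of n] by auto
      then show "\<exists>M. \<forall>x\<in>{0..1}. \<forall>m\<ge>M. \<forall>n>m. dist (G m x) (G n x) < u"
        by blast
    qed
    then obtain l where l: "uniform_limit {0..1} G l sequentially"
      using uniformly_convergent_eq_Cauchy[of "{0..1}" G] by (auto simp: uniformly_convergent_on_def)
    have lim: "(\<lambda>n. G n t) \<longlonglongrightarrow> l t" if "t \<in> {0..1}" for t
      using tendsto_uniform_limitI[OF l that] .
    have "path l"
      unfolding path_def
      by (rule uniform_limit_theorem[OF _ l])
        (use G(1) chain_path_path in \<open>auto simp: P_def path_def intro!: always_eventually\<close>)
    moreover have "pathstart l = x"
      using lim[of 0] G(1) by (auto simp: P_def pathstart_def LIMSEQ_const_iff)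
    moreover have "pathfinish l = y"
      using lim[of 1] G(1) by (auto simp: P_def pathfinish_def LIMSEQ_const_iff)
    moreover have "l t \<in> S" if t: "t \<in> {0..1}" for t
    proof -
      have "\<exists>z\<in>S. dist z (G n t) < d n" for n
        using chain_path_near[of S "d n" "G n"] G(1)[of n] t by (auto simp: P_def path_image_def)
      then obtain z where z: "\<And>n. z n \<in> S" "\<And>n. dist (z n) (G n t) < d n"
        by metis
      have "(\<lambda>n. dist (z n) (G n t)) \<longlonglongrightarrow> 0"
        by (rule tendsto_sandwich[OF _ _ tendsto_const rlim])
          (use z(2) d(2) in \<open>auto intro!: always_eventually intro: less_imp_le less_le_trans\<close>)
      then have "(\<lambda>n. norm (G n t - z n)) \<longlonglongrightarrow> 0"
        by (simp add: dist_norm norm_minus_commute)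
      then have "(\<lambda>n. G n t - z n) \<longlonglongrightarrow> 0"
        by (rule tendsto_norm_zero_cancel)
      then have "z \<longlonglongrightarrow> l t"
        by (rule Lim_transform2[OF lim[OF t]])
      then show ?thesis
        using z(1) compact_imp_closed[OF assms(1)] closed_sequentially by blast
    qed
    moreover have "dist x (l t) \<le> e" if t: "t \<in> {0..1}" for t
    proof -
      have "dist (G 0 t) (l t) \<le> 4 * r 0"
      proof (rule LIMSEQ_le_const2)
        show "(\<lambda>n. dist (G 0 t) (G n t)) \<longlonglongrightarrow> dist (G 0 t) (l t)"
          by (intro tendsto_intros lim t)
        show "\<exists>N. \<forall>n\<ge>N. dist (G 0 t) (G n t) \<le> 4 * r 0"
        proof (intro exI allI impI)
          fix n show "dist (G 0 t) (G n t) \<le> 4 * r 0"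
            using tail[OF t, of 0 n] r[of n] by simp
        qed
      qed
      moreover have "linepath x y t \<in> closed_segment x y"
        using t by (metis linepath_image_01 imageI)
      then have "dist x (G 0 t) \<le> dist x y"
        using segment_bound(1)[of "linepath x y t" x y] G(1)[of 0] by (simp add: P_def dist_norm norm_minus_commute)
      ultimately show ?thesis
        using dist_triangle[of x "l t" "G 0 t"] xy d(2)[of 0] \<open>0 < e\<close> by (simp add: r_def)
    qed
    ultimately show ?thesis
      by (intro exI[of _ l]) (auto simp: path_image_def)
  qed
  then show thesis
    using that d(1) by blast
qed

proposition locally_connected_imp_locally_path_connected:
  fixes S :: "'a::{complete_space,real_normed_vector} set"
  assumes "compact S" "locally connected S"
  shows "locally path_connected S"
  unfolding locally_path_connected_im_kleinen
proof (intro allI impI)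
  fix V x assume V: "openin (top_of_set S) V \<and> x \<in> V"
  then obtain e where e: "0 < e" "cball x e \<inter> S \<subseteq> V"
    using openin_contains_cball by metis
  obtain d where d: "0 < d" "\<And>x y. x \<in> S \<Longrightarrow> y \<in> S \<Longrightarrow> dist x y < d \<Longrightarrow>
       \<exists>g. path g \<and> path_image g \<subseteq> S \<inter> cball x e \<and> pathstart g = x \<and> pathfinish g = y"
    using short_path_exists[OF assms e(1)] by metis
  have "V \<subseteq> S" using V openin_imp_subset by blast
  have "\<exists>p. path p \<and> path_image p \<subseteq> V \<and> pathstart p = x \<and> pathfinish p = y" if "y \<in> S \<inter> ball x (min d e)" for y
    using d(2)[of x y] that V \<open>V \<subseteq> S\<close> e(2) by (auto simp: subset_iff)
  moreover have "S \<inter> ball x (min d e) \<subseteq> V"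
    using e(2) by auto
  moreover have "openin (top_of_set S) (S \<inter> ball x (min d e))" "x \<in> S \<inter> ball x (min d e)"
    using V \<open>V \<subseteq> S\<close> d(1) e(1) by auto
  ultimately show "\<exists>U. openin (top_of_set S) U \<and> x \<in> U \<and> U \<subseteq> V \<and>
      (\<forall>y. y \<in> U \<longrightarrow> (\<exists>p. path p \<and> path_image p \<subseteq> V \<and> pathstart p = x \<and> pathfinish p = y))"
    by blast
qed

section \<open>Simple closed curves\<close>

definition loop_in :: "'a::topological_space set \<Rightarrow> (real \<Rightarrow> 'a) \<Rightarrow> bool" where
  "loop_in U l \<longleftrightarrow> simple_path l \<and> pathfinish l = pathstart l \<and> path_image l \<subseteq> U"

text \<open>The path \<open>q\<close> bypasses an inner point of the arc \<open>r\<close>. Take the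
  first time \<open>s2\<close> at which \<open>q\<close> meets the part of \<open>r\<close> from
  that point on, and the last time \<open>s1\<close> before \<open>s2\<close> at which it meets the
  part up to that point. In between, \<open>q\<close> is off \<open>r\<close>, so this piece of
  \<open>q\<close> and the piece of \<open>r\<close> between its ends close up.\<close>

lemma loop_of_arc_and_path:
  fixes r :: "real \<Rightarrow> 'a::{complete_space,real_normed_vector}"
  assumes r: "arc r" and q: "path q" "pathstart q = pathstart r" "pathfinish q = pathfinish r"
    and t0: "t0 \<in> {0..1}" and p: "r t0 \<notin> path_image q"
  shows "\<exists>l. loop_in (path_image r \<union> path_image q) l"
proof -
  have rc: "continuous_on {0..1} r" and rinj: "inj_on r {0..1}"
    using r by (auto simp: arc_def path_def)
  have qc: "continuous_on {0..1} q" using q by (simp add: path_def)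
  define R1 where "R1 = r ` {0..t0}"
  define R2 where "R2 = r ` {t0..1}"
  have cl: "closed R1" "closed R2"
    unfolding R1_def R2_def using t0
    by (auto intro!: compact_imp_closed compact_continuous_image continuous_on_subset[OF rc])
  have R12: "R1 \<union> R2 = path_image r"
  proof -
    have "{0..t0} \<union> {t0..1} = {0..1}" using t0 by auto
    then show ?thesis by (simp add: R1_def R2_def path_image_def flip: image_Un)
  qed
  have ends: "q 0 \<in> R1" "q 1 \<in> R2"
    using q t0 by (auto simp: R1_def R2_def pathstart_def pathfinish_def)
  define A2 where "A2 = {s \<in> {0..1}. q s \<in> R2}"
  have clA2: "closed A2"
    unfolding A2_def using continuous_closed_preimage[OF qc _ cl(2)] by (simp add: vimage_def Int_def)
  define s2 where "s2 = Inf A2"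
  have s2: "s2 \<in> A2"
    unfolding s2_def using ends clA2 by (intro closed_contains_Inf) (auto simp: A2_def intro!: bdd_belowI[of _ 0])
  have s2min: "s2 \<le> s" if "s \<in> A2" for s
    unfolding s2_def using that by (intro cInf_lower) (auto simp: A2_def intro!: bdd_belowI[of _ 0])
  define A1 where "A1 = {s \<in> {0..s2}. q s \<in> R1}"
  have "continuous_on {0..s2} q" using s2 by (intro continuous_on_subset[OF qc]) (auto simp: A2_def)
  then have clA1: "closed A1"
    unfolding A1_def using continuous_closed_preimage[of "{0..s2}" q R1] cl(1) by (simp add: vimage_def Int_def)
  define s1 where "s1 = Sup A1"
  have s1: "s1 \<in> A1"
    unfolding s1_def using ends clA1 s2 by (intro closed_contains_Sup) (auto simp: A1_def A2_def intro!: bdd_aboveI[of _ s2])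
  have s1max: "s \<le> s1" if "s \<in> A1" for s
    unfolding s1_def using that by (intro cSup_upper) (auto simp: A1_def intro!: bdd_aboveI[of _ s2])
  obtain u where u: "u \<in> {0..t0}" "q s1 = r u" using s1 by (auto simp: A1_def R1_def)
  obtain v where v: "v \<in> {t0..1}" "q s2 = r v" using s2 by (auto simp: A2_def R2_def)
  have s12: "0 \<le> s1" "s1 \<le> s2" "s2 \<le> 1" using s1 s2 by (auto simp: A1_def A2_def)
  have "u \<noteq> t0" "v \<noteq> t0"
    using p u v s12 by (auto simp: path_image_def image_iff dest: bspec[where x = s1] bspec[where x = s2])
  then have uv: "u < t0" "t0 < v" using u v by auto
  then have "q s1 \<noteq> q s2"
    using u v t0 inj_onD[OF rinj, of u v] by auto
  then have s12': "s1 < s2" using s12 by (cases "s1 = s2") auto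
  have q12: "q s \<notin> path_image r" if "s1 < s" "s < s2" for s
  proof
    assume "q s \<in> path_image r"
    then consider "q s \<in> R1" | "q s \<in> R2" using R12 by blast
    then show False
    proof cases
      case 1 then show False using s1max[of s] that s12 by (auto simp: A1_def)
    next
      case 2 then show False using s2min[of s] that s12 by (auto simp: A2_def)
    qed
  qed
  define q' where "q' = subpath s1 s2 q"
  have q': "path q'" "pathstart q' = r u" "pathfinish q' = r v"
    using q s12 u v by (auto simp: q'_def)
  have q'im: "path_image q' \<subseteq> path_image q"
    unfolding q'_def using s12 by (intro path_image_subpath_subset) auto
  have q'r: "path_image q' \<inter> path_image r \<subseteq> {r u, r v}"
  proof
    fix x assume x: "x \<in> path_image q' \<inter> path_image r"
    then obtain s where "s \<in> {s1..s2}" "x = q s"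
      using s12' by (auto simp: q'_def path_image_subpath_gen closed_segment_eq_real_ivl)
    then show "x \<in> {r u, r v}"
      using q12[of s] x u v by (cases "s = s1 \<or> s = s2") auto
  qed
  have "r u \<noteq> r v" using u v uv t0 inj_onD[OF rinj, of u v] by auto
  \<comment> \<open>The piece of \<open>q\<close> may cross itself; it is thinned to an arc before
    it is closed up with \<open>r\<close>.\<close>
  then obtain a where a: "arc a" "path_image a \<subseteq> path_image q'" "pathstart a = r u" "pathfinish a = r v"
    using path_contains_arc[OF q'] by metis
  define b where "b = subpath v u r"
  have uv01: "u \<in> {0..1}" "v \<in> {0..1}" "v \<noteq> u"
    using u v uv t0 by auto
  have b: "arc b" "pathstart b = r v" "pathfinish b = r u" "path_image b \<subseteq> path_image r"
    unfolding b_def using arc_subpath_arc[OF r uv01(2,1,3)] path_image_subpath_subset[OF uv01(2,1)] by auto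
  have "simple_path (a +++ b)"
    using a b q'r by (intro simple_path_join_loop) auto
  then show ?thesis
    unfolding loop_in_def using a b q'im by (intro exI[of _ "a +++ b"]) (auto simp: path_image_join)
qed

lemma arc_exists:
  fixes S :: "'a::{complete_space,real_normed_vector} set"
  assumes "path_component S x y" "x \<noteq> y"
  obtains r where "arc r" "path_image r \<subseteq> S" "pathstart r = x" "pathfinish r = y"
proof -
  obtain g where g: "path g" "path_image g \<subseteq> S" "pathstart g = x" "pathfinish g = y"
    using assms(1) unfolding path_component_def by blast
  show thesis
    using path_contains_arc[OF g(1,3,4) assms(2)] g(2) that by (metis subset_trans)
qed

text \<open>The form in which absence of loops is used: two legs issuing from \<open>p\<close> cannot be joined away
  from \<open>p\<close>.\<close>

lemma loop_of_legs:
  fixes p :: "'a::{complete_space,real_normed_vector}"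
  assumes "path_component (insert p L1) p a1" "path_component (insert p L2) p a2"
    and "L1 \<inter> L2 = {}" "p \<notin> L1" "p \<notin> L2" "path_component Q a1 a2" "p \<notin> Q"
  shows "\<exists>l. loop_in (insert p (L1 \<union> L2 \<union> Q)) l"
proof -
  have aQ: "a1 \<noteq> p" "a2 \<noteq> p"
    using assms(6,7) path_component_mem by metis+
  obtain g1 where g1: "arc g1" "path_image g1 \<subseteq> insert p L1" "pathstart g1 = a1" "pathfinish g1 = p"
    by (rule arc_exists[OF path_component_sym[OF assms(1)] aQ(1)])
  obtain g2 where g2: "arc g2" "path_image g2 \<subseteq> insert p L2" "pathstart g2 = p" "pathfinish g2 = a2"
    by (rule arc_exists[OF assms(2) aQ(2)[symmetric]])
  obtain q where q: "path q" "path_image q \<subseteq> Q" "pathstart q = a1" "pathfinish q = a2"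
    using assms(6) unfolding path_component_def by blast
  have arc: "arc (g1 +++ g2)"
    using g1 g2 assms(3) by (intro arc_join) auto
  have "(g1 +++ g2) (1/2) = p"
    using g1(4) by (simp add: joinpaths_def pathfinish_def)
  then obtain l where "loop_in (path_image (g1 +++ g2) \<union> path_image q) l"
    using loop_of_arc_and_path[OF arc q(1), of "1/2"] q g1 g2 assms(7) by auto
  then show ?thesis
    using g1 g2 q by (intro exI[of _ l]) (auto simp: loop_in_def path_image_join)
qed

section \<open>Betweenness expressed by paths\<close>

text \<open>
  \<open>btw S x y z\<close> says that every path in \<open>S\<close> from \<open>x\<close> to \<open>z\<close> passes through \<open>y\<close>; in a loop-free
  continuum this means that \<open>y\<close> lies on the arc \<open>[x, z]\<close>.
\<close>

definition btw :: "'a::topological_space set \<Rightarrow> 'a \<Rightarrow> 'a \<Rightarrow> 'a \<Rightarrow> bool" where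
  "btw S x y z \<longleftrightarrow> y \<in> S \<and> \<not> path_component (S - {y}) x z"

lemma btw_left [simp]: "x \<in> S \<Longrightarrow> btw S x x z"
  unfolding btw_def using path_component_mem(1) by fastforce

lemma btw_right [simp]: "z \<in> S \<Longrightarrow> btw S x z z"
  unfolding btw_def using path_component_mem(2) by fastforce

lemma btw_path: "btw S x y z \<Longrightarrow> path_component U x z \<Longrightarrow> U \<subseteq> S \<Longrightarrow> y \<in> U"
  unfolding btw_def by (metis path_component_of_subset Diff_empty subset_Diff_insert)

lemma btw_split: "btw S x y z \<Longrightarrow> path_component (S - {y}) z w \<Longrightarrow> btw S x y w"
  unfolding btw_def using path_component_sym path_component_trans by metis

lemma open_path_component_Diff:
  fixes S :: "'a::real_normed_vector set"
  assumes "locally path_connected S" "closed A"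
  shows "openin (top_of_set S) (path_component_set (S - A) x)"
proof (cases "x \<in> S - A")
  case True
  have "openin (top_of_set S) (S - A)"
    using assms(2) by (simp add: Diff_eq openin_open_Int open_Compl)
  then show ?thesis
    using assms(1) True locally_path_connected_open_path_component by blast
next
  case False
  then have "path_component_set (S - A) x = {}"
    using path_component_eq_empty by blast
  then show ?thesis by (simp only: openin_empty)
qed

text \<open>A path from \<open>x\<close> to \<open>z\<close> that misses \<open>y\<close> also
  misses a ball around \<open>y\<close>. Path components outside that ball are relatively open, so
  points near \<open>x\<close> and near \<open>z\<close> can be joined there too, and the
  approximating triples would violate the assumption.\<close>

lemma closed_btw:
  fixes S :: "'a::{complete_space,real_normed_vector} set"
  assumes S: "compact S" "locally path_connected S"
    and lim: "X \<longlonglongrightarrow> x" "Y \<longlonglongrightarrow> y" "Z \<longlonglongrightarrow> z" and b: "\<And>n. btw S (X n) (Y n) (Z n)"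
    and SS: "x \<in> S" "\<And>n. X n \<in> S" "z \<in> S" "\<And>n. Z n \<in> S"
  shows "btw S x y z"
proof (rule ccontr)
  assume n: "\<not> btw S x y z"
  have "closed S" using S compact_imp_closed by blast
  then have "y \<in> S" using closed_sequentially[OF _ _ lim(2)] b by (auto simp: btw_def)
  then have "path_component (S - {y}) x z" using n by (simp add: btw_def)
  then obtain q where q: "path q" "path_image q \<subseteq> S - {y}" "pathstart q = x" "pathfinish q = z"
    unfolding path_component_def by blast
  then obtain e where e: "0 < e" "cball y e \<inter> path_image q = {}"
    using compact_path_image[OF q(1)] compact_imp_closed open_contains_cball[of "- path_image q"]
    by (metis ComplI Compl_disjoint2 DiffD2 disjoint_eq_subset_Compl insertI1 inf_commute open_Compl subsetD)
  have xz: "x \<in> S - cball y e" "z \<in> S - cball y e"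
    using q(3,4) e(2) SS pathstart_in_path_image[of q] pathfinish_in_path_image[of q] by blast+
  have pc: "path_component (S - cball y e) x z"
    unfolding path_component_def using q e by (intro exI[of _ q]) auto
  have op: "openin (top_of_set S) (path_component_set (S - cball y e) w)" for w
    using open_path_component_Diff[OF S(2) closed_cball] .
  have ev: "eventually (\<lambda>n. W n \<in> path_component_set (S - cball y e) w) sequentially"
    if "W \<longlonglongrightarrow> w" "\<And>n. W n \<in> S" "w \<in> S - cball y e" for W w
  proof -
    obtain T where T: "open T" "path_component_set (S - cball y e) w = S \<inter> T"
      using op[of w] by (auto simp: openin_open)
    have "w \<in> T" using T(2) that(3) path_component_refl_eq by blast
    then have "eventually (\<lambda>n. W n \<in> T) sequentially"
      using topological_tendstoD[OF that(1) T(1)] by blast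
    then show ?thesis using T(2) that(2) by (auto elim: eventually_mono)
  qed
  have "eventually (\<lambda>n. dist (Y n) y < e) sequentially"
    using lim(2) e(1) tendstoD by blast
  then have "eventually (\<lambda>n. False) sequentially"
    using ev[OF lim(1) SS(2) xz(1)] ev[OF lim(3) SS(4) xz(2)]
  proof eventually_elim
    case (elim n)
    have "path_component (S - cball y e) (X n) (Z n)"
      using elim pc by (metis mem_Collect_eq path_component_sym path_component_trans)
    then have "path_component (S - {Y n}) (X n) (Z n)"
      by (rule path_component_of_subset[rotated]) (use elim in \<open>auto simp: dist_commute\<close>)
    then show False using b[of n] by (simp add: btw_def)
  qed
  then show False by simp
qed

section \<open>Loop-free continua\<close>

lemma path_component_homeomorphism:
  assumes h: "homeomorphism S S' h k" and "U \<subseteq> S" "path_component U x y"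
  shows "path_component (h ` U) (h x) (h y)"
proof -
  obtain g where g: "path g" "path_image g \<subseteq> U" "pathstart g = x" "pathfinish g = y"
    using assms(3) unfolding path_component_def by blast
  have "continuous_on (path_image g) h"
    using h g(2) assms(2) by (auto simp: homeomorphism_def intro: continuous_on_subset)
  then show ?thesis
    unfolding path_component_def using g
    by (intro exI[of _ "h \<circ> g"]) (auto simp: path_continuous_image path_image_compose pathstart_compose pathfinish_compose)
qed

lemma btw_homeomorphism:
  assumes h: "homeomorphism S S h k" and b: "btw S x y z" and xz: "x \<in> S" "z \<in> S"
  shows "btw S (h x) (h y) (h z)"
proof -
  have y: "y \<in> S" using b by (simp add: btw_def)
  have "\<not> path_component (S - {h y}) (h x) (h z)"
  proof
    assume "path_component (S - {h y}) (h x) (h z)"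
    then have "path_component (k ` (S - {h y})) (k (h x)) (k (h z))"
      by (intro path_component_homeomorphism[OF homeomorphism_symD[OF h]]) auto
    moreover have "k ` (S - {h y}) \<subseteq> S - {y}"
    proof -
      have "k w \<in> S \<and> h (k w) = w" if "w \<in> S" for w
        using h that by (auto simp: homeomorphism_def)
      then show ?thesis by force
    qed
    ultimately have "path_component (S - {y}) (k (h x)) (k (h z))"
      by (rule path_component_of_subset[rotated])
    then have "path_component (S - {y}) x z"
      using h xz by (simp add: homeomorphism_def)
    then show False using b by (simp add: btw_def)
  qed
  moreover have "h y \<in> S" using h y by (auto simp: homeomorphism_def)
  ultimately show ?thesis by (simp add: btw_def)
qed

lemma btw_imp_path_component: "btw S x y z \<Longrightarrow> path_component U x z \<Longrightarrow> U \<subseteq> S \<Longrightarrow> path_component U x y"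
proof -
  assume b: "btw S x y z" and U: "path_component U x z" "U \<subseteq> S"
  obtain q where q: "path q" "path_image q \<subseteq> U" "pathstart q = x" "pathfinish q = z"
    using U(1) unfolding path_component_def by blast
  have pc: "path_component (path_image q) x w" if "w \<in> path_image q" for w
    using path_connected_path_image[OF q(1)] q(3) that
    by (metis path_connected_component pathstart_in_path_image)
  have "z \<in> path_image q" using q(4) pathfinish_in_path_image by metis
  from pc[OF this] have "y \<in> path_image q"
    using btw_path[OF b] q(2) U(2) by blast
  then show ?thesis using path_component_of_subset[OF q(2) pc] by blast
qed

text \<open>Cutting the path at the first parameter with value in \<open>D\<close> leaves a piece
  that touches \<open>D\<close> at its end only. This is how the place where a closed set is first
  seen is found.\<close>

lemma path_first_hit:
  fixes g :: "real \<Rightarrow> 'a::metric_space"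
  assumes g: "path g" and D: "closed D" and fin: "pathfinish g \<in> D"
  shows "\<exists>p\<in>D. p \<in> path_image g \<and> path_component (insert p (path_image g - D)) (pathstart g) p"
proof -
  have gc: "continuous_on {0..1} g" using g by (simp add: path_def)
  define A where "A = {s \<in> {0..1}. g s \<in> D}"
  have "closed A"
    unfolding A_def using continuous_closed_preimage[OF gc _ D] by (simp add: vimage_def Int_def)
  moreover have "1 \<in> A" using fin by (simp add: A_def pathfinish_def)
  ultimately have s: "Inf A \<in> A"
    by (intro closed_contains_Inf) (auto simp: A_def intro!: bdd_belowI[of _ 0])
  define s where "s = Inf A"
  have smin: "g t \<notin> D" if "t \<in> {0..1}" "t < s" for t
    using that cInf_lower[of t A] by (force simp: s_def A_def intro!: bdd_belowI[of _ 0])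
  have s: "s \<in> {0..1}" "g s \<in> D" using s by (auto simp: A_def s_def)
  have im: "g ` {0..s} \<subseteq> insert (g s) (path_image g - D)"
  proof
    fix x assume "x \<in> g ` {0..s}"
    then obtain t where "t \<in> {0..s}" "x = g t" by auto
    then show "x \<in> insert (g s) (path_image g - D)"
      using smin[of t] s by (cases "t = s") (auto simp: path_image_def)
  qed
  have "continuous_on {0..s} g" using s by (intro continuous_on_subset[OF gc]) auto
  then have "path_connected (g ` {0..s})"
    by (rule path_connected_continuous_image) (simp add: convex_imp_path_connected)
  then have "path_component (g ` {0..s}) (g 0) (g s)"
    using s unfolding path_connected_component by auto
  then have "path_component (insert (g s) (path_image g - D)) (g 0) (g s)"
    using path_component_of_subset[OF im] by blast
  then show ?thesis
    using s by (intro bexI[of _ "g s"]) (auto simp: pathstart_def path_image_def)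
qed

text \<open>The path components of \<open>S - A\<close> are relatively open and disjoint, so a
  compact set meets only finitely many of them.\<close>

lemma finite_path_components_meeting:
  fixes S :: "'a::real_normed_vector set"
  assumes "locally path_connected S" "closed A" "compact K" "K \<subseteq> S - A"
  shows "finite (path_component_set (S - A) ` K)"
proof -
  have "\<exists>T. open T \<and> path_component_set (S - A) x = S \<inter> T" for x
    using open_path_component_Diff[OF assms(1,2), of x] by (auto simp: openin_open)
  then obtain T where T: "\<And>x. open (T x)" "\<And>x. path_component_set (S - A) x = S \<inter> T x"
    by metis
  have in_T: "x \<in> T x" if "x \<in> K" for x
    using T(2)[of x] that assms(4) path_component_refl[of x "S - A"] by blast
  then have "K \<subseteq> (\<Union>x\<in>K. T x)" by blast
  then obtain K' where K': "K' \<subseteq> K" "finite K'" "K \<subseteq> (\<Union>x\<in>K'. T x)"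
    using compactE_image[OF assms(3), of K T] T(1) by metis
  have "path_component_set (S - A) ` K \<subseteq> path_component_set (S - A) ` K'"
  proof
    fix c assume "c \<in> path_component_set (S - A) ` K"
    then obtain x where x: "x \<in> K" "c = path_component_set (S - A) x" by blast
    then obtain y where y: "y \<in> K'" "x \<in> T y" using K' by blast
    then have "x \<in> path_component_set (S - A) y"
      using T(2)[of y] x(1) assms(4) by blast
    then show "c \<in> path_component_set (S - A) ` K'"
      using path_component_eq x(2) y(1) by (metis imageI)
  qed
  then show ?thesis using K'(2) finite_subset by blast
qed

text \<open>A path around a point of the arc would produce a loop by
  \<open>loop_of_arc_and_path\<close>. So in the absence of loops the points of an arc are between
  its ends, and arcs can be described by \<open>btw\<close>.\<close>

lemma arc_btw:
  fixes S :: "'a::{complete_space,real_normed_vector} set"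
  assumes noloop: "\<nexists>l. loop_in S l" and r: "arc r" "path_image r \<subseteq> S" and y: "y \<in> path_image r"
  shows "btw S (pathstart r) y (pathfinish r)"
proof -
  obtain t where t: "t \<in> {0..1}" "y = r t" using y by (auto simp: path_image_def)
  have "\<not> path_component (S - {y}) (pathstart r) (pathfinish r)"
  proof
    assume "path_component (S - {y}) (pathstart r) (pathfinish r)"
    then obtain q where q: "path q" "path_image q \<subseteq> S - {y}" "pathstart q = pathstart r" "pathfinish q = pathfinish r"
      unfolding path_component_def by blast
    then obtain l where "loop_in (path_image r \<union> path_image q) l"
      using loop_of_arc_and_path[OF r(1) q(1,3,4) t(1)] t(2) by blast
    then have "loop_in S l" using r q by (auto simp: loop_in_def)
    then show False using noloop by blast
  qed
  then show ?thesis using y r by (auto simp: btw_def)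
qed

lemma path_component_arc_piece:
  assumes "arc r" "u \<in> {0..1}" "v \<in> {0..1}" "u \<le> v" "w \<in> {0..1}" "w \<notin> {u..v}" "path_image r \<subseteq> S"
  shows "path_component (S - {r w}) (r u) (r v)"
proof -
  have inj: "inj_on r {0..1}" and cont: "continuous_on {0..1} r"
    using assms(1) by (auto simp: arc_def path_def)
  have sub: "{u..v} \<subseteq> {0..1}" using assms by auto
  have "path_connected (r ` {u..v})"
    using continuous_on_subset[OF cont sub]
    by (rule path_connected_continuous_image) (simp add: convex_imp_path_connected)
  then have "path_component (r ` {u..v}) (r u) (r v)"
    using assms(4) unfolding path_connected_component by auto
  moreover have "r ` {u..v} \<subseteq> S - {r w}"
  proof
    fix x assume "x \<in> r ` {u..v}"
    then obtain t where t: "t \<in> {u..v}" "x = r t" by blast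
    then have "r t \<noteq> r w" using inj_onD[OF inj, of t w] sub assms(5,6) by auto
    then show "x \<in> S - {r w}" using t sub assms(7) by (auto simp: path_image_def)
  qed
  ultimately show ?thesis using path_component_of_subset by blast
qed

text \<open>Apart from the empty set, these are the dendrites in a Banach space, with local
  connectedness already turned into paths.\<close>

locale loop_free_continuum =
  fixes S :: "'a::{complete_space,real_normed_vector} set"
  assumes compact: "compact S" and lpc: "locally path_connected S" and pc: "path_connected S"
    and noloop: "\<nexists>l. loop_in S l"
begin

lemma connecting: "x \<in> S \<Longrightarrow> y \<in> S \<Longrightarrow> path_component S x y"
  using pc by (simp add: path_connected_component)

lemma btw_trans:
  assumes "btw S x y z" "btw S x z w"
  shows "btw S x y w"
proof -
  have "\<not> path_component (S - {y}) x w"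
  proof
    assume "path_component (S - {y}) x w"
    then have "path_component (S - {y}) x z"
      using btw_imp_path_component[OF assms(2)] by blast
    then show False using assms(1) by (simp add: btw_def)
  qed
  then show ?thesis using assms(1) by (simp add: btw_def)
qed

text \<open>If \<open>z\<close> differs from \<open>y\<close>, it comes strictly earlier on the arc
  from \<open>x\<close> to \<open>y\<close>, and the part of the arc up to \<open>z\<close> avoids
  \<open>y\<close>. Together with \<open>btw_trans\<close> this makes \<open>btw S x\<close> the
  order of a tree with root \<open>x\<close>.\<close>

lemma btw_antisym:
  assumes "btw S x y z" "btw S x z y" "x \<in> S"
  shows "y = z"
proof (rule ccontr)
  assume "y \<noteq> z"
  have yz: "y \<in> S" "z \<in> S" using assms by (auto simp: btw_def)
  have "x \<noteq> y"
    using btw_path[OF assms(2), of "{x}"] \<open>y \<noteq> z\<close> assms(3) path_component_refl[of x "{x}"] by auto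
  then obtain r where r: "arc r" "path_image r \<subseteq> S" "pathstart r = x" "pathfinish r = y"
    using arc_exists connecting assms(3) yz by metis
  have "path_component (path_image r) x y"
    using path_connected_path_image[OF arc_imp_path[OF r(1)]] r
    unfolding path_connected_component by (metis pathfinish_in_path_image pathstart_in_path_image)
  then have "z \<in> path_image r" using btw_path[OF assms(2)] r(2) by blast
  then obtain t where t: "t \<in> {0..1}" "z = r t" by (auto simp: path_image_def)
  then have "t < 1" using r(4) \<open>y \<noteq> z\<close> by (cases "t = 1") (auto simp: pathfinish_def)
  then have "path_component (S - {r 1}) (r 0) (r t)"
    using t by (intro path_component_arc_piece r) auto
  then show False using assms(1) t r by (simp add: btw_def pathstart_def pathfinish_def)
qed

text \<open>
  Root the continuum at \<open>x0\<close>. A maximal point \<open>m\<close> with \<open>m\<close> between \<open>x0\<close> and \<open>k m\<close> must be fixed: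
  otherwise the points just beyond \<open>m\<close> on the arc \<open>[m, k m]\<close> have the same property.
\<close>

theorem fixed_point:
  assumes k: "continuous_on S k" "k ` S \<subseteq> S" and "S \<noteq> {}"
  shows "\<exists>x\<in>S. k x = x"
proof -
  obtain x0 where x0: "x0 \<in> S" using assms by blast
  have clS: "closed S" using compact compact_imp_closed by blast
  define A where "A = {y \<in> S. btw S x0 y (k y)}"
  have "\<exists>m\<in>A. \<forall>a\<in>A. btw S x0 m a \<longrightarrow> a = m"
  proof (rule predicate_Zorn)
    show "partial_order_on A (relation_of (btw S x0) A)"
    proof (rule partial_order_on_relation_ofI)
      show "btw S x0 a a" if "a \<in> A" for a using that by (simp add: A_def)
      show "btw S x0 a c" if "btw S x0 a b" "btw S x0 b c" for a b c using btw_trans[OF that] .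
      show "a = b" if "btw S x0 a b" "btw S x0 b a" for a b using btw_antisym[OF that x0] .
    qed
    fix C assume "C \<in> Chains (relation_of (btw S x0) A)"
    then have CA: "C \<subseteq> A" and tot: "\<And>a b. a \<in> C \<Longrightarrow> b \<in> C \<Longrightarrow> btw S x0 a b \<or> btw S x0 b a"
      by (auto simp: Chains_def relation_of_def)
    have x0A: "x0 \<in> A" using x0 by (simp add: A_def)
    \<comment> \<open>Upper bounds of chains come from compactness: these sets of points above
      \<open>a\<close> are closed, and finitely many of them meet because a finite part of a chain
      has a greatest element.\<close>
    define D where "D a = {z \<in> A. btw S x0 a z}" for a
    have clD: "closed (D a)" for a
      unfolding closed_sequential_limits
    proof (intro allI impI)
      fix Z z assume Z: "(\<forall>n. Z n \<in> D a) \<and> Z \<longlonglongrightarrow> z"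
      then have ZS: "\<And>n. Z n \<in> S" by (auto simp: D_def A_def)
      then have zS: "z \<in> S" using closed_sequentially[OF clS] Z by blast
      then have kZ: "(\<lambda>n. k (Z n)) \<longlonglongrightarrow> k z"
        using k(1) ZS Z unfolding continuous_on_sequentially by (auto simp: comp_def)
      have "btw S x0 a z"
        by (rule closed_btw[OF compact lpc tendsto_const tendsto_const, of Z])
          (use Z ZS zS x0 in \<open>auto simp: D_def\<close>)
      moreover have "btw S x0 z (k z)"
        by (rule closed_btw[OF compact lpc tendsto_const _ kZ, of Z])
          (use Z ZS zS x0 k(2) in \<open>auto simp: D_def A_def\<close>)
      ultimately show "z \<in> D a" using zS by (simp add: D_def A_def)
    qed
    have max: "\<exists>m\<in>C. \<forall>a\<in>I. btw S x0 a m" if "finite I" "I \<noteq> {}" "I \<subseteq> C" for I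
      using that
    proof (induction I rule: finite_ne_induct)
      case (singleton a)
      then show ?case using CA by (intro bexI[of _ a]) (auto simp: A_def)
    next
      case (insert a I)
      then obtain m where m: "m \<in> C" "\<forall>b\<in>I. btw S x0 b m" by auto
      have a: "a \<in> C" "btw S x0 a a" using insert.prems CA by (auto simp: A_def)
      show ?case
      proof (cases "btw S x0 a m")
        case True then show ?thesis using m by blast
      next
        case False
        then have "btw S x0 m a" using tot[OF a(1) m(1)] by blast
        then have "\<forall>b\<in>I. btw S x0 b a" using m(2) btw_trans by blast
        then show ?thesis using a by blast
      qed
    qed
    have "S \<inter> (\<Inter>a\<in>C. D a) \<noteq> {}"
    proof (rule compact_imp_fip_image[OF compact clD])
      fix I assume I: "finite I" "I \<subseteq> C"
      show "S \<inter> (\<Inter>a\<in>I. D a) \<noteq> {}"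
      proof (cases "I = {}")
        case False
        then obtain m where "m \<in> C" "\<forall>a\<in>I. btw S x0 a m" using max I by blast
        then have "m \<in> S \<inter> (\<Inter>a\<in>I. D a)" using CA by (auto simp: D_def A_def)
        then show ?thesis by blast
      qed (use x0 in auto)
    qed
    then obtain u where "u \<in> S" "\<forall>a\<in>C. u \<in> D a" by blast
    then show "\<exists>u\<in>A. \<forall>a\<in>C. btw S x0 a u"
      using x0A by (cases "C = {}") (auto simp: D_def)
  qed
  then obtain m where m: "m \<in> S" "btw S x0 m (k m)" and
    max: "\<And>a. a \<in> S \<Longrightarrow> btw S x0 a (k a) \<Longrightarrow> btw S x0 m a \<Longrightarrow> a = m"
    by (auto simp: A_def)
  have "k m = m"
  proof (rule ccontr)
    assume ne: "k m \<noteq> m"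
    have kmS: "k m \<in> S" using k m by blast
    obtain r where r: "arc r" "path_image r \<subseteq> S" "pathstart r = m" "pathfinish r = k m"
      using arc_exists[OF connecting[OF m(1) kmS]] ne by metis
    have rinj: "inj_on r {0..1}" and rc: "continuous_on {0..1} r"
      using r(1) by (auto simp: arc_def path_def)
    have r01: "r 0 = m" "r 1 = k m" using r by (auto simp: pathstart_def pathfinish_def)
    \<comment> \<open>Half the distance separates \<open>k m\<close> from a ball around
      \<open>m\<close>. Points \<open>z\<close> close to \<open>m\<close> lie in this ball, so a
      path from \<open>k m\<close> to \<open>k z\<close> that stays outside of it avoids
      \<open>z\<close>.\<close>
    define e where "e = dist m (k m) / 2"
    have e: "0 < e" "k m \<in> S - cball m e" using ne kmS by (auto simp: e_def)
    obtain T where T: "open T" "path_component_set (S - cball m e) (k m) = S \<inter> T"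
      using open_path_component_Diff[OF lpc closed_cball, of m e "k m"] by (auto simp: openin_open)
    have "k m \<in> T" using T(2) e(2) path_component_refl[of "k m" "S - cball m e"] by blast
    then obtain d where d: "0 < d" "\<And>z. z \<in> S \<Longrightarrow> dist z m < d \<Longrightarrow> k z \<in> T"
    proof -
      obtain \<epsilon> where \<epsilon>: "0 < \<epsilon>" "ball (k m) \<epsilon> \<subseteq> T"
        using T(1) \<open>k m \<in> T\<close> open_contains_ball by blast
      obtain d where d: "0 < d" "\<forall>z\<in>S. dist z m < d \<longrightarrow> dist (k z) (k m) < \<epsilon>"
        using k(1) m(1) \<epsilon>(1) unfolding continuous_on_iff by blast
      have "k z \<in> T" if "z \<in> S" "dist z m < d" for z
      proof -
        have "dist (k z) (k m) < \<epsilon>" using d(2) that by blast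
        then show ?thesis using \<epsilon>(2) by (auto simp: dist_commute)
      qed
      then show thesis using that d(1) by blast
    qed
    have "0 < min d e" using d e by simp
    then obtain t0 where t0: "0 < t0" "\<And>t. t \<in> {0..1} \<Longrightarrow> dist t 0 < t0 \<Longrightarrow> dist (r t) (r 0) < min d e"
      using rc unfolding continuous_on_iff by (metis atLeastAtMost_iff order_refl zero_le_one)
    define t where "t = min (t0/2) (1/2)"
    have t: "0 < t" "t < 1" "t \<in> {0..1}" "dist t 0 < t0" using t0(1) by (auto simp: t_def dist_real_def)
    define z where "z = r t"
    have zd: "dist z m < d" "dist z m < e" using t0(2)[OF t(3,4)] r01 by (auto simp: z_def)
    have zS: "z \<in> S" using r(2) t by (auto simp: z_def path_image_def)
    have zm: "z \<noteq> m" using inj_onD[OF rinj, of t 0] t r01 by (auto simp: z_def)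
    have "path_component (S - {r 0}) (r t) (r 1)"
      using t by (intro path_component_arc_piece r) auto
    then have "path_component (S - {m}) (k m) z"
      using path_component_sym r01 by (simp add: z_def) 
    then have bmz: "btw S x0 m z" by (rule btw_split[OF m(2)])
    \<comment> \<open>If a path from \<open>x0\<close> to \<open>k z\<close> missed
      \<open>z\<close>, it would extend to \<open>k m\<close> and thus pass through
      \<open>m\<close>, which would give a path from \<open>m\<close> to \<open>k m\<close> around
      the point \<open>z\<close> of the arc between them.\<close>
    have "btw S x0 z (k z)"
    proof (rule ccontr)
      assume "\<not> btw S x0 z (k z)"
      then have 1: "path_component (S - {z}) x0 (k z)" using zS by (simp add: btw_def)
      have "k z \<in> S \<inter> T" using d(2)[OF zS zd(1)] k(2) zS by blast
      then have "path_component (S - cball m e) (k m) (k z)" using T(2) by blast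
      then have "path_component (S - {z}) (k m) (k z)"
        by (rule path_component_of_subset[rotated]) (use zd in \<open>auto simp: dist_commute\<close>)
      then have 2: "path_component (S - {z}) x0 (k m)"
        using 1 path_component_sym path_component_trans by metis
      then have "path_component (S - {z}) x0 m"
        using btw_imp_path_component[OF m(2)] by blast
      then have "path_component (S - {z}) m (k m)"
        using 2 path_component_sym path_component_trans by metis
      moreover have "btw S m z (k m)"
        using arc_btw[OF noloop r(1,2), of z] r(3,4) t by (auto simp: z_def path_image_def)
      ultimately show False by (simp add: btw_def)
    qed
    then show False using max zS bmz zm by blast
  qed
  then show ?thesis using m(1) by blast
qed

text \<open>
  \<open>D\<close> is the union of the arcs between points of \<open>B\<close> that avoid \<open>A\<close>. The finite set consists of the
  points at which \<open>A\<close> is first seen from \<open>D\<close>; by the absence of loops there is at most one for each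
  pair of a component of \<open>S - D\<close> meeting \<open>A\<close> and a component of \<open>S - A\<close> meeting \<open>B\<close>.
\<close>

theorem finite_invariant_set:
  assumes A: "closed A" "A \<subseteq> S" "A \<noteq> {}" and B: "closed B" "B \<subseteq> S" "B \<noteq> {}" and AB: "A \<inter> B = {}"
  shows "\<exists>F. finite F \<and> F \<noteq> {} \<and> F \<subseteq> S \<and>
    (\<forall>h k. homeomorphism S S h k \<longrightarrow> h ` A = A \<longrightarrow> h ` B = B \<longrightarrow> h ` F \<subseteq> F)"
proof -
  have cA: "compact A" and cB: "compact B"
    using A B compact by (metis compact_Int_closed inf.absorb2)+
  have clS: "closed S" using compact compact_imp_closed by blast
  define D where "D = {p. \<exists>b\<in>B. \<exists>b'\<in>B. path_component (S - A) b b' \<and> btw S b p b'}"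
  have DA: "D \<subseteq> S - A" using btw_path by (fastforce simp: D_def)
  have BD: "B \<subseteq> D"
  proof
    fix b assume b: "b \<in> B"
    then have "path_component (S - A) b b" using B AB by (intro path_component_refl) auto
    moreover have "btw S b b b" using b B by auto
    ultimately show "b \<in> D" using b unfolding D_def by blast
  qed
  \<comment> \<open>Components of \<open>S - A\<close> are open, so convergent points of
    \<open>B\<close> finally lie in the component of their limit. This lets the defining condition
    of \<open>D\<close> pass to limits.\<close>
  have same: "\<exists>N. \<forall>n\<ge>N. path_component (S - A) (W n) w" if W: "W \<longlonglongrightarrow> w" "\<And>n. W n \<in> B" "w \<in> B" for W w
  proof -
    obtain T where T: "open T" "path_component_set (S - A) w = S \<inter> T"
      using open_path_component_Diff[OF lpc A(1)] by (auto simp: openin_open)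
    have "w \<in> T" using T(2) path_component_refl[of w "S - A"] W(3) B AB by blast
    then obtain N where "\<forall>n\<ge>N. W n \<in> T"
      using topological_tendstoD[OF W(1) T(1)] by (auto simp: eventually_sequentially)
    then have "\<forall>n\<ge>N. W n \<in> path_component_set (S - A) w" using T(2) W(2) B by blast
    then show ?thesis using path_component_sym by blast
  qed
  have clD: "closed D"
    unfolding closed_sequential_limits
  proof (intro allI impI)
    fix P p assume P: "(\<forall>n. P n \<in> D) \<and> P \<longlonglongrightarrow> p"
    then have "\<forall>n. \<exists>b b'. b \<in> B \<and> b' \<in> B \<and> path_component (S - A) b b' \<and> btw S b (P n) b'"
      unfolding D_def by blast
    then obtain b b' where b: "\<And>n. b n \<in> B" "\<And>n. b' n \<in> B" "\<And>n. path_component (S - A) (b n) (b' n)"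
      "\<And>n. btw S (b n) (P n) (b' n)" by metis
    obtain l r where l: "l \<in> B" "strict_mono r" "(b \<circ> r) \<longlonglongrightarrow> l"
      using cB b(1) unfolding compact_def by metis
    obtain l' r' where l': "l' \<in> B" "strict_mono (r'::nat\<Rightarrow>nat)" "((b' \<circ> r) \<circ> r') \<longlonglongrightarrow> l'"
      using cB b(2) unfolding compact_def by (metis comp_apply)
    have lim: "(b \<circ> r \<circ> r') \<longlonglongrightarrow> l" "(b' \<circ> r \<circ> r') \<longlonglongrightarrow> l'" "(P \<circ> r \<circ> r') \<longlonglongrightarrow> p"
      using l l' P LIMSEQ_subseq_LIMSEQ by blast+
    have "btw S l p l'"
      by (rule closed_btw[OF compact lpc lim(1) lim(3) lim(2)]) (use b B(2) l(1) l'(1) in \<open>auto simp: subset_iff\<close>)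
    moreover obtain N where "\<forall>n\<ge>N. path_component (S - A) ((b \<circ> r \<circ> r') n) l"
      using same[OF lim(1)] b l by auto
    moreover obtain N' where "\<forall>n\<ge>N'. path_component (S - A) ((b' \<circ> r \<circ> r') n) l'"
      using same[OF lim(2)] b l' by auto
    ultimately have c: "btw S l p l'" "path_component (S - A) ((b \<circ> r \<circ> r') (max N N')) l"
      "path_component (S - A) ((b' \<circ> r \<circ> r') (max N N')) l'"
      by auto
    moreover have "path_component (S - A) ((b \<circ> r \<circ> r') (max N N')) ((b' \<circ> r \<circ> r') (max N N'))"
      using b(3) by simp
    ultimately have "path_component (S - A) l l'"
      using path_component_trans path_component_sym by metis
    then show "p \<in> D"
      using c(1) l(1) l'(1) unfolding D_def by blast
  qed
  \<comment> \<open>The whole arc from \<open>b\<close> to \<open>b'\<close> lies in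
    \<open>D\<close>, since \<open>b\<close> and \<open>b'\<close> serve as witnesses for all of its
    points.\<close>
  have arcD: "path_component D b p \<and> path_component D b b'"
    if b: "b \<in> B" "b' \<in> B" "path_component (S - A) b b'" "btw S b p b'" for b b' p
  proof (cases "b = b'")
    case True
    then have "p = b" using btw_path[OF b(4), of "{b}"] b B by (auto intro: path_component_refl)
    then show ?thesis using True b BD by (auto intro: path_component_refl)
  next
    case False
    then obtain r where r: "arc r" "path_image r \<subseteq> S" "pathstart r = b" "pathfinish r = b'"
      using arc_exists[OF connecting] b B by (metis subsetD)
    have "path_image r \<subseteq> D"
      using arc_btw[OF noloop r(1,2)] r(3,4) b by (auto simp: D_def)
    moreover have c: "path_component (path_image r) b w" if "w \<in> path_image r" for w
      using path_connected_path_image[OF arc_imp_path[OF r(1)]] r(3) that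
      unfolding path_connected_component by (metis pathstart_in_path_image)
    moreover have "b' \<in> path_image r" using r(4) pathfinish_in_path_image by metis
    moreover have "p \<in> path_image r" using btw_path[OF b(4) c r(2)] calculation by blast
    ultimately show ?thesis using path_component_of_subset by metis
  qed
  \<comment> \<open>So \<open>D\<close> has at most one path component in each component of
    \<open>S - A\<close>: every point of \<open>D\<close> is tied to \<open>B\<close> inside
    \<open>D\<close>, and two points of \<open>B\<close> in one component are joined within
    \<open>D\<close> by its definition.\<close>
  have joinD: "path_component D p p'" if p: "p \<in> D" "p' \<in> D" "path_component (S - A) p p'" for p p'
  proof -
    obtain b1 b1' where b1: "b1 \<in> B" "b1' \<in> B" "path_component (S - A) b1 b1'" "btw S b1 p b1'"
      using p(1) by (auto simp: D_def)
    obtain b2 b2' where b2: "b2 \<in> B" "b2' \<in> B" "path_component (S - A) b2 b2'" "btw S b2 p' b2'"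
      using p(2) by (auto simp: D_def)
    have 1: "path_component D b1 p" "path_component D b2 p'"
      using arcD b1 b2 by blast+
    then have "path_component (S - A) b1 p" "path_component (S - A) b2 p'"
      using path_component_of_subset[OF DA] by blast+
    then have "path_component (S - A) b1 b2"
      using p(3) path_component_sym path_component_trans by metis
    then have "path_component D b1 b2"
      using arcD[OF b1(1) b2(1), of b1] b1(1) B by auto
    then show ?thesis using 1 path_component_sym path_component_trans by metis
  qed
  define F where "F = {p \<in> D. \<exists>a\<in>A. path_component (insert p (S - D)) a p}"
  have "F \<noteq> {}"
  proof -
    obtain a b where ab: "a \<in> A" "b \<in> B" using A B by blast
    then obtain g where g: "path g" "path_image g \<subseteq> S" "pathstart g = a" "pathfinish g = b"
      using connecting[of a b] A B unfolding path_component_def by blast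
    have "pathfinish g \<in> D" using g ab BD by auto
    then obtain p where p: "p \<in> D" "path_component (insert p (path_image g - D)) a p"
      using path_first_hit[OF g(1) clD] g(3) by auto
    then have "path_component (insert p (S - D)) a p"
      using path_component_of_subset[of "insert p (path_image g - D)" "insert p (S - D)"] g(2) by blast
    then show ?thesis using p ab by (auto simp: F_def)
  qed
  moreover have "finite F"
  proof -
    have "\<forall>p\<in>F. \<exists>a. a \<in> A \<and> path_component (insert p (S - D)) a p"
      unfolding F_def by blast
    then obtain \<alpha> where "\<forall>p\<in>F. \<alpha> p \<in> A \<and> path_component (insert p (S - D)) (\<alpha> p) p"
      by (rule bchoice[THEN exE])
    then have \<alpha>: "\<And>p. p \<in> F \<Longrightarrow> \<alpha> p \<in> A \<and> path_component (insert p (S - D)) (\<alpha> p) p"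
      by blast
    define \<Theta> where "\<Theta> p = (path_component_set (S - D) (\<alpha> p), path_component_set (S - A) p)" for p
    have "\<Theta> ` F \<subseteq> (path_component_set (S - D) ` A) \<times> (path_component_set (S - A) ` B)"
    proof
      fix c assume "c \<in> \<Theta> ` F"
      then obtain p where p: "p \<in> F" "c = \<Theta> p" by blast
      then obtain b b' where b: "b \<in> B" "b' \<in> B" "path_component (S - A) b b'" "btw S b p b'"
        by (auto simp: F_def D_def)
      have "path_component (S - A) b p"
        using arcD[OF b] path_component_of_subset[OF DA] by blast
      then have "path_component_set (S - A) p = path_component_set (S - A) b"
        using path_component_eq by (metis mem_Collect_eq)
      then show "c \<in> (path_component_set (S - D) ` A) \<times> (path_component_set (S - A) ` B)"
        using p \<alpha> b by (auto simp: \<Theta>_def)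
    qed
    moreover have "finite (path_component_set (S - D) ` A)"
      using DA A by (intro finite_path_components_meeting lpc clD cA) auto
    moreover have "finite (path_component_set (S - A) ` B)"
      using AB B by (intro finite_path_components_meeting lpc A cB) auto
    ultimately have fin: "finite (\<Theta> ` F)" by (meson finite_SigmaI finite_subset)
    have "inj_on \<Theta> F"
    proof (rule inj_onI, rule ccontr)
      fix p p' assume p: "p \<in> F" "p' \<in> F" "\<Theta> p = \<Theta> p'" "p \<noteq> p'"
      have pD: "p \<in> D" "p' \<in> D" using p by (auto simp: F_def)
      have "\<alpha> p' \<in> S - D" "p' \<in> S - A"
        using \<alpha>[OF p(2)] A DA pD by auto
      then have "\<alpha> p' \<in> path_component_set (S - D) (\<alpha> p')" "p' \<in> path_component_set (S - A) p'"
        by (simp_all add: path_component_refl)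
      moreover have "path_component_set (S - D) (\<alpha> p) = path_component_set (S - D) (\<alpha> p')"
        "path_component_set (S - A) p = path_component_set (S - A) p'"
        using p(3) unfolding \<Theta>_def by blast+
      ultimately have "path_component (S - D) (\<alpha> p) (\<alpha> p')" "path_component (S - A) p p'"
        by blast+
      then have "path_component D p p'" using joinD pD by blast
      then obtain r where r: "arc r" "path_image r \<subseteq> D" "pathstart r = p" "pathfinish r = p'"
        using arc_exists p(4) by metis
      \<comment> \<open>The detour through \<open>\<alpha> p\<close> and \<open>\<alpha> p'\<close>
        meets \<open>D\<close> at \<open>p\<close> and \<open>p'\<close> only, so it misses the
        inner point \<open>s\<close> of an arc in \<open>D\<close>, although \<open>s\<close> is
        between \<open>p\<close> and \<open>p'\<close>.\<close>
      define s where "s = r (1/2)"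
      have "s \<noteq> p" "s \<noteq> p'" "s \<in> D" "s \<in> path_image r"
        using r inj_onD[of r "{0..1}" "1/2" 0] inj_onD[of r "{0..1}" "1/2" 1]
        by (auto simp: s_def arc_def pathstart_def pathfinish_def path_image_def)
      then have sub: "insert p (S - D) \<subseteq> S - {s}" "insert p' (S - D) \<subseteq> S - {s}" "S - D \<subseteq> S - {s}"
        using DA pD by auto
      have 1: "path_component (S - {s}) (\<alpha> p) p"
        using \<alpha>[OF p(1)] path_component_of_subset[OF sub(1)] by blast
      have 2: "path_component (S - {s}) (\<alpha> p') p'"
        using \<alpha>[OF p(2)] path_component_of_subset[OF sub(2)] by blast
      have 3: "path_component (S - {s}) (\<alpha> p) (\<alpha> p')"
        using path_component_of_subset[OF sub(3)] \<open>path_component (S - D) (\<alpha> p) (\<alpha> p')\<close> by blast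
      have "path_component (S - {s}) p p'"
        using path_component_trans[OF path_component_sym[OF 1] path_component_trans[OF 3 2]] .
      moreover have "btw S p s p'"
        using arc_btw[OF noloop r(1) _ \<open>s \<in> path_image r\<close>] r DA by auto
      ultimately show False by (simp add: btw_def)
    qed
    then show ?thesis using fin finite_imageD by blast
  qed
  moreover have "h ` F \<subseteq> F" if h: "homeomorphism S S h k" and hA: "h ` A = A" and hB: "h ` B = B" for h k
  proof -
    have k: "homeomorphism S S k h" by (rule homeomorphism_symD[OF h])
    have inj: "inj_on h S" using h inj_on_inverseI[of S k h] by (auto simp: homeomorphism_def)
    have surj: "h ` S = S" and kh: "\<And>x. x \<in> S \<Longrightarrow> k (h x) = x" using h by (auto simp: homeomorphism_def)
    have kA: "k ` A = A" "k ` B = B"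
    proof -
      have "k ` (h ` A) = A" "k ` (h ` B) = B" using A(2) B(2) kh by (force simp: image_image)+
      then show "k ` A = A" "k ` B = B" using hA hB by simp_all
    qed
    have imD: "g p \<in> D" if g: "homeomorphism S S g g'" "g ` A = A" "g ` B = B" and p: "p \<in> D" for g g' p
    proof -
      obtain b b' where b: "b \<in> B" "b' \<in> B" "path_component (S - A) b b'" "btw S b p b'"
        using p by (auto simp: D_def)
      have "inj_on g S" "g ` S = S" using g(1) inj_on_inverseI[of S g' g] by (auto simp: homeomorphism_def)
      then have "g ` (S - A) = S - A" using g(2) A(2) by (simp add: inj_on_image_set_diff[of g S])
      then have "path_component (S - A) (g b) (g b')"
        using path_component_homeomorphism[OF g(1) _ b(3)] by auto
      moreover have "btw S (g b) (g p) (g b')"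
        using btw_homeomorphism[OF g(1) b(4)] b B by auto
      ultimately show ?thesis using b g(3) unfolding D_def by blast
    qed
    have hD: "h ` D = D"
    proof
      show "h ` D \<subseteq> D" using imD[OF h hA hB] by blast
      have "x \<in> h ` D" if "x \<in> D" for x
      proof -
        have "k x \<in> D" "h (k x) = x" using imD[OF k kA that] h DA that by (auto simp: homeomorphism_def)
        then show ?thesis by force
      qed
      then show "D \<subseteq> h ` D" by blast
    qed
    show ?thesis
    proof
      fix q assume "q \<in> h ` F"
      then obtain p a where p: "q = h p" "p \<in> D" "a \<in> A" "path_component (insert p (S - D)) a p"
        by (auto simp: F_def)
      have "h ` (S - D) = S - D" using inj_on_image_set_diff[OF inj, of S D] surj hD DA by auto
      then have "path_component (insert q (S - D)) (h a) q"
        using path_component_homeomorphism[OF h _ p(4)] p(1,2) DA by auto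
      then show "q \<in> F" using p hA hD by (auto simp: F_def)
    qed
  qed
  ultimately show ?thesis
    using DA by (intro exI[of _ F]) (auto simp: F_def)
qed

end

section \<open>Commuting groups acting on a loop-free continuum\<close>

text \<open>Members are total functions with arbitrary values off \<open>S\<close>, so inverses and
  composites are demanded only up to equality on \<open>S\<close>. The identity on \<open>S\<close>
  is obtained as the composite of a member and its inverse.\<close>

definition homeo_group :: "'a::topological_space set \<Rightarrow> ('a \<Rightarrow> 'a) set \<Rightarrow> bool" where
  "homeo_group S \<Gamma> \<longleftrightarrow> (\<forall>f\<in>\<Gamma>. \<exists>g\<in>\<Gamma>. homeomorphism S S f g) \<and> \<Gamma> \<noteq> {} \<and>
     (\<forall>f\<in>\<Gamma>. \<forall>g\<in>\<Gamma>. \<exists>k\<in>\<Gamma>. \<forall>x\<in>S. k x = f (g x))"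

lemma homeo_groupD: "homeo_group S \<Gamma> \<Longrightarrow> f \<in> \<Gamma> \<Longrightarrow> \<exists>g\<in>\<Gamma>. homeomorphism S S f g"
  unfolding homeo_group_def by blast

lemma homeo_group_image_eq:
  assumes "homeo_group S \<Gamma>" "A \<subseteq> S" "\<And>f x. f \<in> \<Gamma> \<Longrightarrow> x \<in> A \<Longrightarrow> f x \<in> A" "f \<in> \<Gamma>"
  shows "f ` A = A"
proof -
  obtain g where g: "g \<in> \<Gamma>" "homeomorphism S S f g"
    using homeo_groupD[OF assms(1,4)] by blast
  have "x \<in> f ` A" if "x \<in> A" for x
    using assms(3)[OF g(1) that] g(2) assms(2) that unfolding homeomorphism_def by (metis imageI subsetD)
  then show ?thesis using assms(3,4) by blast
qed

text \<open>
  If all closed \<open>\<Gamma>\<close>-invariant sets meet, they have a common point, and it lies in the fixed point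
  set of each \<open>g \<in> \<Delta>\<close>, which is closed, nonempty and \<open>\<Gamma>\<close>-invariant.
\<close>

theorem (in loop_free_continuum) commuting_finite_invariant_set:
  assumes \<Gamma>: "homeo_group S \<Gamma>" and \<Delta>: "homeo_group S \<Delta>" and "S \<noteq> {}"
    and comm: "\<And>f g x. f \<in> \<Gamma> \<Longrightarrow> g \<in> \<Delta> \<Longrightarrow> x \<in> S \<Longrightarrow> f (g x) = g (f x)"
  shows "\<exists>F. finite F \<and> F \<noteq> {} \<and> F \<subseteq> S \<and> ((\<forall>f\<in>\<Gamma>. f ` F \<subseteq> F) \<or> (\<forall>g\<in>\<Delta>. g ` F \<subseteq> F))"
proof -
  define invariant where "invariant A \<longleftrightarrow> closed A \<and> A \<subseteq> S \<and> A \<noteq> {} \<and> (\<forall>f\<in>\<Gamma>. \<forall>x\<in>A. f x \<in> A)" for A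
  have eq: "f ` A = A" if "invariant A" "f \<in> \<Gamma>" for A f
    using homeo_group_image_eq[OF \<Gamma>] that by (auto simp: invariant_def)
  show ?thesis
  proof (cases "\<exists>A B. invariant A \<and> invariant B \<and> A \<inter> B = {}")
    case True
    then obtain A B where AB: "invariant A" "invariant B" "A \<inter> B = {}" by blast
    then obtain F where F: "finite F" "F \<noteq> {}" "F \<subseteq> S"
      "\<forall>h k. homeomorphism S S h k \<longrightarrow> h ` A = A \<longrightarrow> h ` B = B \<longrightarrow> h ` F \<subseteq> F"
      using finite_invariant_set[of A B] by (auto simp: invariant_def)
    have "\<forall>f\<in>\<Gamma>. f ` F \<subseteq> F"
    proof
      fix f assume f: "f \<in> \<Gamma>"
      then obtain g where "homeomorphism S S f g" using homeo_groupD[OF \<Gamma>] by blast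
      then show "f ` F \<subseteq> F" using F(4) eq[OF AB(1) f] eq[OF AB(2) f] by blast
    qed
    then show ?thesis using F by blast
  next
    case False
    have fin: "invariant (\<Inter>\<A>)" if "finite \<A>" "\<A> \<noteq> {}" "\<A> \<subseteq> {A. invariant A}" for \<A>
      using that
    proof (induction \<A> rule: finite_ne_induct)
      case (insert A \<A>)
      then have "invariant A" "invariant (\<Inter>\<A>)" by auto
      moreover from this have "A \<inter> \<Inter>\<A> \<noteq> {}" using False by blast
      ultimately show ?case unfolding invariant_def by auto
    qed auto
    have "S \<inter> \<Inter>{A. invariant A} \<noteq> {}"
    proof (rule compact_imp_fip[OF compact])
      fix \<A> assume "finite \<A>" "\<A> \<subseteq> {A. invariant A}"
      then show "S \<inter> \<Inter>\<A> \<noteq> {}"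
        using fin[of \<A>] \<open>S \<noteq> {}\<close> by (cases "\<A> = {}") (auto simp: invariant_def)
    qed (auto simp: invariant_def)
    then obtain x where x: "x \<in> S" "\<And>A. invariant A \<Longrightarrow> x \<in> A" by blast
    have "g x = x" if g: "g \<in> \<Delta>" for g
    proof -
      have gc: "continuous_on S g" "g ` S \<subseteq> S"
        using homeo_groupD[OF \<Delta> g] by (auto simp: homeomorphism_def)
      have clS: "closed S" using compact compact_imp_closed by blast
      have "closed {y \<in> S. g y = y}"
        using continuous_closed_preimage_constant[of S "\<lambda>y. g y - y" 0] gc clS
        by (auto simp: continuous_on_diff)
      moreover obtain y where "y \<in> S" "g y = y" using fixed_point[OF gc \<open>S \<noteq> {}\<close>] by blast
      moreover have "f y \<in> {y \<in> S. g y = y}" if f: "f \<in> \<Gamma>" "y \<in> {y \<in> S. g y = y}" for f y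
      proof -
        have "f ` S = S" using homeo_groupD[OF \<Gamma> f(1)] by (auto simp: homeomorphism_def)
        then show ?thesis using comm[OF f(1) g, of y] f(2) by auto
      qed
      ultimately have "invariant {y \<in> S. g y = y}" by (auto simp: invariant_def)
      then show ?thesis using x(2) by blast
    qed
    then show ?thesis using x(1) by (intro exI[of _ "{x}"]) auto
  qed
qed

section \<open>Continua with several loops\<close>

lemma loop_in_homeomorphism:
  assumes h: "homeomorphism S S h k" and l: "loop_in S l"
  shows "loop_in S (h \<circ> l)"
proof -
  have inj: "inj_on h S" using h inj_on_inverseI[of S k h] by (auto simp: homeomorphism_def)
  have im: "path_image l \<subseteq> S" and sp: "simple_path l" and fin: "pathfinish l = pathstart l"
    using l by (auto simp: loop_in_def)
  have "continuous_on (path_image l) h"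
    using h im by (auto simp: homeomorphism_def intro: continuous_on_subset)
  then have "path (h \<circ> l)" using sp by (simp add: path_continuous_image simple_path_imp_path)
  moreover have "loop_free (h \<circ> l)"
    unfolding loop_free_def
  proof (intro ballI impI)
    fix x y :: real assume xy: "x \<in> {0..1}" "y \<in> {0..1}" "(h \<circ> l) x = (h \<circ> l) y"
    then have "l x \<in> S" "l y \<in> S" using im by (auto simp: path_image_def)
    then have "l x = l y" using inj_onD[OF inj] xy by auto
    then show "x = y \<or> x = 0 \<and> y = 1 \<or> x = 1 \<and> y = 0"
      using sp xy unfolding simple_path_def loop_free_def by blast
  qed
  moreover have "path_image (h \<circ> l) \<subseteq> S"
    using im h by (auto simp: path_image_compose homeomorphism_def)
  ultimately show ?thesis
    using fin by (auto simp: loop_in_def simple_path_def pathstart_def pathfinish_def)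
qed

lemma loop_in_shift:
  fixes l :: "real \<Rightarrow> 'a::real_normed_vector"
  assumes "loop_in U l" "p \<in> path_image l"
  obtains m where "loop_in U m" "path_image m = path_image l" "pathstart m = p"
proof -
  obtain a where a: "a \<in> {0..1}" "p = l a" using assms(2) by (auto simp: path_image_def)
  have l: "simple_path l" "pathfinish l = pathstart l" "path_image l \<subseteq> U" using assms(1) by (auto simp: loop_in_def)
  show thesis
  proof (rule that[of "shiftpath a l"])
    show im: "path_image (shiftpath a l) = path_image l"
      using a l by (intro path_image_shiftpath) auto
    show "loop_in U (shiftpath a l)"
      unfolding loop_in_def using a l im by (simp add: simple_path_shiftpath pathstart_shiftpath pathfinish_shiftpath)
    show "pathstart (shiftpath a l) = p"
      using a by (simp add: pathstart_shiftpath)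
  qed
qed

lemma loop_inj:
  assumes "loop_in U l" "x \<in> {0..1}" "y \<in> {0..1}" "l x = l y" "x \<noteq> y"
  shows "x = 0 \<and> y = 1 \<or> x = 1 \<and> y = 0"
  using assms unfolding loop_in_def simple_path_def loop_free_def by blast

text \<open>The leg ends where the arc first reaches distance \<open>e\<close>. Its starting point
  \<open>p\<close> is left out so that several legs at \<open>p\<close> can be disjoint, and the
  exact length keeps the end of the leg away from \<open>p\<close>.\<close>

lemma leg_exists:
  fixes r :: "real \<Rightarrow> 'a::metric_space"
  assumes "continuous_on {0..t} r" "inj_on r {0..t}" "0 \<le> t" "r 0 = p" "e \<le> dist p (r t)" "0 < e"
  obtains s where "s \<in> {0<..t}" "dist p (r s) = e" "p \<notin> r ` {0<..s}" "r ` {0<..s} \<subseteq> cball p e"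
    "path_component (insert p (r ` {0<..s})) p (r s)"
proof -
  define A where "A = {u \<in> {0..t}. e \<le> dist p (r u)}"
  have c: "continuous_on {0..t} (\<lambda>u. dist p (r u))"
    using assms(1) by (intro continuous_intros)
  have "closed A"
    unfolding A_def using continuous_closed_preimage[OF c, of "{e..}"] by (simp add: vimage_def Int_def)
  moreover have "t \<in> A" using assms by (simp add: A_def)
  ultimately have sA: "Inf A \<in> A"
    by (intro closed_contains_Inf) (auto simp: A_def intro!: bdd_belowI[of _ 0])
  define s where "s = Inf A"
  have s: "s \<in> {0..t}" "e \<le> dist p (r s)" using sA by (auto simp: A_def s_def)
  have small: "dist p (r u) < e" if "u \<in> {0..t}" "u < s" for u
    using that cInf_lower[of u A] by (force simp: s_def A_def intro!: bdd_belowI[of _ 0])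
  have s0: "0 < s" using s assms(4,6) by (cases "s = 0") auto
  have "dist p (r s) = e"
  proof (rule antisym[OF _ s(2)])
    obtain u where u: "0 \<le> u" "u \<le> s" "dist p (r u) = e"
      using IVT'[of "\<lambda>u. dist p (r u)" 0 e s] s assms(4,6) continuous_on_subset[OF c, of "{0..s}"] by auto
    then show "dist p (r s) \<le> e" using small[of u] s by (cases "u = s") auto
  qed
  moreover have "r ` {0<..s} \<subseteq> cball p e"
  proof
    fix x assume "x \<in> r ` {0<..s}"
    then obtain u where "0 < u" "u \<le> s" "x = r u" by auto
    then show "x \<in> cball p e" using small[of u] s calculation by (cases "u = s") auto
  qed
  moreover have "p \<notin> r ` {0<..s}"
  proof
    assume "p \<in> r ` {0<..s}"
    then obtain u where u: "0 < u" "u \<le> s" "r u = p" by auto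
    then have "u = 0" using inj_onD[OF assms(2), of u 0] assms(4) s by auto
    then show False using u by simp
  qed
  moreover have "path_component (insert p (r ` {0<..s})) p (r s)"
  proof -
    have "{0..s} = insert 0 {0<..s}" using s0 by auto
    then have eq: "r ` {0..s} = insert p (r ` {0<..s})" using assms(4) by auto
    have "path_connected (r ` {0..s})"
      using continuous_on_subset[OF assms(1), of "{0..s}"] s
      by (intro path_connected_continuous_image) (auto simp: convex_imp_path_connected)
    then show ?thesis using eq s0 unfolding path_connected_component by auto
  qed
  ultimately show thesis using that[of s] s s0 by auto
qed

text \<open>
  Branch points, unlike tripods, are invariant under homeomorphisms. Loops cannot be small, so the
  three branches at a branch point are long, and there are only finitely many centres of long tripods.
\<close>

definition tripod :: "'a::metric_space set \<Rightarrow> real \<Rightarrow> 'a \<Rightarrow> bool" where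
  "tripod S e p \<longleftrightarrow> (\<exists>L a. (\<forall>i<3::nat. p \<notin> L i \<and> L i \<subseteq> S \<inter> cball p e \<and> path_component (insert p (L i)) p (a i) \<and>
     dist p (a i) = e) \<and> L 0 \<inter> L 1 = {} \<and> L 0 \<inter> L 2 = {} \<and> L 1 \<inter> L 2 = {})"

text \<open>The third branch has to lead to a second loop. Trees may be attached to a loop at
  infinitely many points, and without this condition all of these would count.\<close>

definition branch_point :: "'a::topological_space set \<Rightarrow> 'a \<Rightarrow> bool" where
  "branch_point S p \<longleftrightarrow> (\<exists>l m. loop_in S l \<and> loop_in S m \<and> p \<in> path_image l \<and>
     (\<exists>y\<in>path_image m - path_image l. path_component (insert p (S - path_image l)) p y))"

lemma branch_point_homeomorphism:
  assumes h: "homeomorphism S S h k" and p: "branch_point S p"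
  shows "branch_point S (h p)"
proof -
  obtain l m y where lm: "loop_in S l" "loop_in S m" "p \<in> path_image l" "y \<in> path_image m - path_image l"
    "path_component (insert p (S - path_image l)) p y"
    using p unfolding branch_point_def by blast
  have inj: "inj_on h S" and surj: "h ` S = S" using h inj_on_inverseI[of S k h] by (auto simp: homeomorphism_def)
  have sub: "path_image l \<subseteq> S" "path_image m \<subseteq> S" using lm by (auto simp: loop_in_def)
  have "h ` (S - path_image l) = S - path_image (h \<circ> l)"
    using inj_on_image_set_diff[OF inj, of S "path_image l"] sub surj by (simp add: path_image_compose Diff_subset)
  then have "path_component (insert (h p) (S - path_image (h \<circ> l))) (h p) (h y)"
    using path_component_homeomorphism[OF h _ lm(5)] lm(3) sub by auto
  moreover have "h y \<in> path_image (h \<circ> m) - path_image (h \<circ> l)"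
    using lm(4) sub inj_onD[OF inj] by (auto simp: path_image_compose; blast)
  moreover have "h p \<in> path_image (h \<circ> l)" using lm(3) by (auto simp: path_image_compose)
  ultimately show ?thesis
    unfolding branch_point_def using loop_in_homeomorphism[OF h] lm(1,2) by blast
qed

locale continuum_without_small_loops =
  fixes S :: "'a::{complete_space,real_normed_vector} set" and \<epsilon> :: real
  assumes compact: "compact S" and lpc: "locally path_connected S" and pc: "path_connected S"
    and \<epsilon>: "0 < \<epsilon>" and no_small: "\<not> loop_in (S \<inter> ball x \<epsilon>) l"
begin

lemma no_small_subset: "loop_in U l \<Longrightarrow> U \<subseteq> S \<inter> ball x \<epsilon> \<Longrightarrow> False"
  using no_small[of x l] by (auto simp: loop_in_def)

text \<open>Infinitely many tripods would include two with nearby centres \<open>p\<close>,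
  \<open>p'\<close> and pairwise nearby ends. If \<open>p\<close> were off two of the legs at
  \<open>p'\<close>, the corresponding legs at \<open>p\<close> could be joined through these, away
  from \<open>p\<close>, which gives a small loop. So \<open>p\<close> lies on one of any two legs
  at \<open>p'\<close>, hence on two of them, although they are disjoint.\<close>

lemma finite_tripods: "finite {p \<in> S. tripod S (\<epsilon>/8) p}"
proof (rule ccontr)
  assume inf: "infinite {p \<in> S. tripod S (\<epsilon>/8) p}"
  define e where "e = \<epsilon> / 8"
  have e: "0 < e" using \<epsilon> by (simp add: e_def)
  define Tr where "Tr = {p \<in> S. tripod S e p}"
  obtain d0 where d0: "0 < d0" and short0: "\<And>x y. x \<in> S \<Longrightarrow> y \<in> S \<Longrightarrow> dist x y < d0 \<Longrightarrow>
       \<exists>g. path g \<and> path_image g \<subseteq> S \<inter> cball x (e/4) \<and> pathstart g = x \<and> pathfinish g = y"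
    using short_path_exists[OF compact locally_path_connected_imp_locally_connected[OF lpc], of "e/4"] e by auto
  define d where "d = min d0 (e/4)"
  have d: "0 < d" "d \<le> e/4" using d0 e by (auto simp: d_def)
  have short: "path_component (S \<inter> cball x (e/4)) x y" if "x \<in> S" "y \<in> S" "dist x y < d" for x y
    using short0[of x y] that unfolding path_component_def d_def by auto
  have "S \<subseteq> (\<Union>x\<in>S. ball x (d/2))" using d by force
  then obtain K where K: "K \<subseteq> S" "finite K" "S \<subseteq> (\<Union>x\<in>K. ball x (d/2))"
    using compactE_image[OF compact, of S "\<lambda>x. ball x (d/2)"] by auto
  then have "\<forall>x\<in>S. \<exists>i. i \<in> K \<and> dist i x < d/2" by (auto simp: subset_iff)
  then obtain idx where idx: "\<And>x. x \<in> S \<Longrightarrow> idx x \<in> K \<and> dist (idx x) x < d/2"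
    using bchoice[of S "\<lambda>x i. i \<in> K \<and> dist i x < d/2"] by blast
  have idx_close: "dist x y < d" if "x \<in> S" "y \<in> S" "idx x = idx y" for x y
    using idx[OF that(1)] idx[OF that(2)] that(3) dist_triangle_half_r[of "idx x" x d y] by auto
  have "\<forall>p\<in>Tr. \<exists>La. (\<forall>i<3::nat. p \<notin> fst La i \<and> fst La i \<subseteq> S \<inter> cball p e \<and>
      path_component (insert p (fst La i)) p (snd La i) \<and> dist p (snd La i) = e) \<and>
      fst La 0 \<inter> fst La 1 = {} \<and> fst La 0 \<inter> fst La 2 = {} \<and> fst La 1 \<inter> fst La 2 = {}"
    by (auto simp: Tr_def tripod_def)
  then obtain La where La: "\<forall>p\<in>Tr. (\<forall>i<3::nat. p \<notin> fst (La p) i \<and> fst (La p) i \<subseteq> S \<inter> cball p e \<and>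
      path_component (insert p (fst (La p) i)) p (snd (La p) i) \<and> dist p (snd (La p) i) = e) \<and>
      fst (La p) 0 \<inter> fst (La p) 1 = {} \<and> fst (La p) 0 \<inter> fst (La p) 2 = {} \<and> fst (La p) 1 \<inter> fst (La p) 2 = {}"
    by (rule bchoice[THEN exE])
  define L where "L p = fst (La p)" for p
  define a where "a p = snd (La p)" for p
  have L: "p \<notin> L p i" "L p i \<subseteq> S \<inter> cball p e" "path_component (insert p (L p i)) p (a p i)" "dist p (a p i) = e"
    if "p \<in> Tr" "i < 3" for p i
    using La that by (auto simp: L_def a_def)
  have disj: "L p 0 \<inter> L p 1 = {}" "L p 0 \<inter> L p 2 = {}" "L p 1 \<inter> L p 2 = {}" if "p \<in> Tr" for p
    using La that by (auto simp: L_def)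
  have TrS: "p \<in> S" if "p \<in> Tr" for p using that by (simp add: Tr_def)
  have aS: "a p i \<in> S" if "p \<in> Tr" "i < 3" for p i
    using L[OF that] path_component_mem(2)[OF L(3)[OF that]] TrS[OF that(1)] by auto
  \<comment> \<open>Pigeonhole: the centre and the three ends are recorded by points of the finite
    net \<open>K\<close>, and equal records mean distances below \<open>d\<close>.\<close>
  define \<Theta> where "\<Theta> p = (idx p, idx (a p 0), idx (a p 1), idx (a p 2))" for p
  have "\<Theta> ` Tr \<subseteq> K \<times> K \<times> K \<times> K"
    using idx TrS aS by (auto simp: \<Theta>_def)
  then have "finite (\<Theta> ` Tr)" using K(2) by (meson finite_SigmaI finite_subset)
  then have "\<not> inj_on \<Theta> Tr" using inf finite_imageD unfolding Tr_def e_def by blast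
  then obtain p p' where p: "p \<in> Tr" "p' \<in> Tr" "\<Theta> p = \<Theta> p'" "p \<noteq> p'" by (auto simp: inj_on_def)
  have pp': "dist p p' < d" using idx_close TrS p by (auto simp: \<Theta>_def)
  have aa': "dist (a p i) (a p' i) < d" if "i < 3" for i
  proof -
    have "i = 0 \<or> i = 1 \<or> i = 2" using that by auto
    then show ?thesis using idx_close aS p by (auto simp: \<Theta>_def)
  qed
  have key: "p \<in> L p' i \<union> L p' j" if ij: "i < 3" "j < 3" "L p i \<inter> L p j = {}" for i j
  proof (rule ccontr)
    assume n: "p \<notin> L p' i \<union> L p' j"
    define C where "C i = S \<inter> cball (a p i) (e/4)" for i
    \<comment> \<open>\<open>Q\<close> leads from one end at \<open>p\<close> over a short path to
      an end at \<open>p'\<close>, through \<open>p'\<close>, and back in the same way. The short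
      paths avoid \<open>p\<close> because they stay within \<open>e / 4\<close> of points at
      distance \<open>e\<close> from it.\<close>
    define Q where "Q = C i \<union> insert p' (L p' i \<union> L p' j) \<union> C j"
    have pC: "p \<notin> C k" if "k < 3" for k
      using L(4)[OF p(1) that] e by (auto simp: C_def dist_commute)
    have "p \<notin> Q" using n pC ij p(4) by (auto simp: Q_def)
    have 1: "path_component Q (a p k) (a p' k)" if "k = i \<or> k = j" for k
    proof -
      have k: "k < 3" using that ij by auto
      have "path_component (C k) (a p k) (a p' k)"
        unfolding C_def using short aS p aa' k by blast
      then show ?thesis by (rule path_component_of_subset[rotated]) (use that in \<open>auto simp: Q_def\<close>)
    qed
    have 2: "path_component Q p' (a p' k)" if "k = i \<or> k = j" for k
      using that ij by (intro path_component_of_subset[OF _ L(3)[OF p(2)]]) (auto simp: Q_def)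
    have "path_component Q (a p i) (a p j)"
      using path_component_trans[OF 1[of i] path_component_trans[OF path_component_sym[OF 2[of i]]
          path_component_trans[OF 2[of j] path_component_sym[OF 1[of j]]]]] by blast
    then obtain l where l: "loop_in (insert p (L p i \<union> L p j \<union> Q)) l"
      using loop_of_legs[OF L(3)[OF p(1) ij(1)] L(3)[OF p(1) ij(2)] ij(3) L(1)[OF p(1) ij(1)] L(1)[OF p(1) ij(2)] _ \<open>p \<notin> Q\<close>]
      by blast
    \<comment> \<open>Every piece lies within \<open>5 / 4 * e\<close> of \<open>p\<close>, well
      below \<open>\<epsilon> = 8 * e\<close>.\<close>
    have "insert p (L p i \<union> L p j \<union> Q) \<subseteq> S \<inter> ball p \<epsilon>"
    proof -
      have c: "C k \<subseteq> S \<inter> ball p \<epsilon>" if "k < 3" for k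
      proof
        fix x assume "x \<in> C k"
        then have "dist (a p k) x \<le> e/4" "x \<in> S" by (auto simp: C_def)
        then show "x \<in> S \<inter> ball p \<epsilon>"
          using L(4)[OF p(1) that] dist_triangle[of p x "a p k"] e by (auto simp: e_def)
      qed
      have l': "L p' k \<subseteq> S \<inter> ball p \<epsilon>" if "k < 3" for k
      proof
        fix x assume "x \<in> L p' k"
        then have "dist p' x \<le> e" "x \<in> S" using L(2)[OF p(2) that] by auto
        then show "x \<in> S \<inter> ball p \<epsilon>"
          using pp' d dist_triangle[of p x p'] e by (auto simp: e_def)
      qed
      have l: "L p k \<subseteq> S \<inter> ball p \<epsilon>" if "k < 3" for k
        using L(2)[OF p(1) that] e by (auto simp: e_def)
      have "p' \<in> S \<inter> ball p \<epsilon>" using pp' d e TrS p by (auto simp: e_def)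
      moreover have "p \<in> S \<inter> ball p \<epsilon>" using TrS p \<epsilon> by auto
      ultimately show ?thesis using c l l' ij unfolding Q_def by blast
    qed
    then show False using no_small_subset[OF l] by blast
  qed
  show False
    using key[of 0 1] key[of 0 2] key[of 1 2] disj[OF p(1)] disj[OF p(2)] by auto
qed

text \<open>Since \<open>e\<close> is smaller than \<open>\<epsilon>\<close>, both legs end before
  the far points are reached; the stretch of the loop between \<open>t1\<close> and
  \<open>t2\<close> stays free for a third leg.\<close>

lemma loop_legs:
  assumes l: "loop_in S l" "pathstart l = p" and t: "0 < t1" "t1 \<le> t2" "t2 < 1"
    and far: "\<epsilon> \<le> dist p (l t1)" "\<epsilon> \<le> dist p (l t2)" and e: "0 < e" "e < \<epsilon>"
  obtains L1 L2 a1 a2 where "L1 \<subseteq> l ` {0<..<t1}" "L2 \<subseteq> l ` {t2<..<1}" "p \<notin> L1" "p \<notin> L2"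
    "L1 \<subseteq> cball p e" "L2 \<subseteq> cball p e" "path_component (insert p L1) p a1" "path_component (insert p L2) p a2"
    "dist p a1 = e" "dist p a2 = e"
proof -
  have lc: "continuous_on {0..1} l" using l by (auto simp: loop_in_def simple_path_def path_def)
  have l01: "l 0 = p" "l 1 = p" using l by (auto simp: loop_in_def pathstart_def pathfinish_def)
  have inj1: "inj_on l {0..t1}" using loop_inj[OF l(1)] t by (fastforce intro!: inj_onI)
  obtain s1 where s1: "s1 \<in> {0<..t1}" "dist p (l s1) = e" "p \<notin> l ` {0<..s1}" "l ` {0<..s1} \<subseteq> cball p e"
    "path_component (insert p (l ` {0<..s1})) p (l s1)"
    using leg_exists[of t1 l p e] continuous_on_subset[OF lc, of "{0..t1}"] inj1 l01 far e t by auto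
  define r where "r u = l (1 - u)" for u
  have rc: "continuous_on {0..1 - t2} r"
    unfolding r_def using t by (intro continuous_on_compose2[OF lc]) (auto intro!: continuous_intros)
  have inj2: "inj_on r {0..1 - t2}"
  proof (rule inj_onI)
    fix x y assume xy: "x \<in> {0..1 - t2}" "y \<in> {0..1 - t2}" "r x = r y"
    then show "x = y" using loop_inj[OF l(1), of "1 - x" "1 - y"] t by (auto simp: r_def)
  qed
  obtain s2 where s2: "s2 \<in> {0<..1 - t2}" "dist p (r s2) = e" "p \<notin> r ` {0<..s2}" "r ` {0<..s2} \<subseteq> cball p e"
    "path_component (insert p (r ` {0<..s2})) p (r s2)"
    using leg_exists[OF rc inj2, of p e] l01 far e t by (auto simp: r_def)
  have "s1 \<noteq> t1" "s2 \<noteq> 1 - t2" using s1(2) s2(2) far e by (auto simp: r_def)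
  then have "l ` {0<..s1} \<subseteq> l ` {0<..<t1}" "r ` {0<..s2} \<subseteq> l ` {t2<..<1}"
    using s1(1) s2(1) by (auto simp: r_def intro!: imageI)
  then show thesis using that s1 s2 by blast
qed

lemma loop_disjoint_pieces:
  assumes l: "loop_in S l" and A: "A \<subseteq> {0<..<1}" "B \<subseteq> {0<..<1}" "A \<inter> B = {}"
  shows "l ` A \<inter> l ` B = {}"
proof (rule ccontr)
  assume "l ` A \<inter> l ` B \<noteq> {}"
  then obtain a b where ab: "a \<in> A" "b \<in> B" "l a = l b" by blast
  then have "a \<in> {0<..<1}" "b \<in> {0<..<1}" "a \<noteq> b" using A by auto
  then show False using loop_inj[OF l, of a b] ab(3) by auto
qed

lemma loop_far_point:
  assumes "loop_in S l" obtains t where "t \<in> {0..1}" "\<epsilon> \<le> dist x (l t)"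
proof -
  have "\<not> path_image l \<subseteq> ball x \<epsilon>"
    using assms no_small[of x l] by (auto simp: loop_in_def)
  then obtain z where z: "z \<in> path_image l" "z \<notin> ball x \<epsilon>" by blast
  then obtain t where "t \<in> {0..1}" "z = l t" by (auto simp: path_image_def)
  then show thesis using that z(2) by simp
qed

lemma tripodI:
  assumes "p \<notin> L0" "p \<notin> L1" "p \<notin> L2" "L0 \<subseteq> S \<inter> cball p e" "L1 \<subseteq> S \<inter> cball p e" "L2 \<subseteq> S \<inter> cball p e"
    "path_component (insert p L0) p a0" "path_component (insert p L1) p a1" "path_component (insert p L2) p a2"
    "dist p a0 = e" "dist p a1 = e" "dist p a2 = e" "L0 \<inter> L1 = {}" "L0 \<inter> L2 = {}" "L1 \<inter> L2 = {}"
  shows "tripod S e p"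
  unfolding tripod_def
  by (rule exI[of _ "\<lambda>i. if i = 0 then L0 else if i = 1 then L1 else L2"],
      rule exI[of _ "\<lambda>i. if i = 0 then a0 else if i = 1 then a1 else a2"])
    (use assms in auto)

text \<open>Two legs follow the loop from \<open>p\<close> in both directions. \<open>W\<close>
  collects what can be reached from \<open>p\<close> off the loop. If \<open>W\<close> is large, it
  contains the third leg. If \<open>W\<close> is small, the second loop, which is not small, has to
  leave \<open>W\<close>, and so \<open>D\<close> can be reached through \<open>W\<close> at another
  point \<open>q\<close>; the third leg runs through \<open>W\<close> to \<open>q\<close> and
  continues along \<open>D\<close>.\<close>

lemma branch_point_tripod:
  assumes "branch_point S p"
  shows "tripod S (\<epsilon>/8) p"
proof -
  define e where "e = \<epsilon> / 8"
  have e: "0 < e" "e < \<epsilon>" using \<epsilon> by (auto simp: e_def)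
  obtain l0 m0 y where lm0: "loop_in S l0" "loop_in S m0" "p \<in> path_image l0" "y \<in> path_image m0 - path_image l0"
    "path_component (insert p (S - path_image l0)) p y"
    using assms unfolding branch_point_def by blast
  obtain l where l: "loop_in S l" "path_image l = path_image l0" "pathstart l = p"
    using loop_in_shift[OF lm0(1,3)] by metis
  obtain m where m: "loop_in S m" "path_image m = path_image m0" "pathstart m = y"
    using loop_in_shift[OF lm0(2), of y] lm0(4) by auto
  define D where "D = path_image l"
  have DS: "D \<subseteq> S" and clD: "closed D" and lc: "continuous_on {0..1} l"
    using l(1) closed_simple_path_image by (auto simp: D_def loop_in_def simple_path_def path_def)
  have l01: "l 0 = p" "l 1 = p" using l by (auto simp: loop_in_def pathstart_def pathfinish_def)
  have pD: "p \<in> D" and yD: "y \<notin> D" and py: "path_component (insert p (S - D)) p y"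
    using lm0 l by (auto simp: D_def)
  have pS: "p \<in> S" using pD DS by blast
  have lD: "l ` A \<subseteq> D" if "A \<subseteq> {0..1}" for A using that by (auto simp: D_def path_image_def)
  define W where "W = path_component_set (insert p (S - D)) p"
  have Wsub: "W \<subseteq> insert p (S - D)" unfolding W_def by (rule path_component_subset)
  show ?thesis
  proof (cases "\<exists>z\<in>W. e \<le> dist p z")
    case True
    then obtain z where z: "z \<in> W" "e \<le> dist p z" by blast
    then have "p \<noteq> z" using e by auto
    then obtain r where r: "arc r" "path_image r \<subseteq> insert p (S - D)" "pathstart r = p" "pathfinish r = z"
      using arc_exists[of "insert p (S - D)" p z] z(1) by (auto simp: W_def)
    have rr: "continuous_on {0..1} r" "inj_on r {0..1}" "r 0 = p" "r 1 = z"
      using r by (auto simp: arc_def path_def pathstart_def pathfinish_def)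
    obtain s where s: "s \<in> {0<..1}" "dist p (r s) = e" "p \<notin> r ` {0<..s}" "r ` {0<..s} \<subseteq> cball p e"
      "path_component (insert p (r ` {0<..s})) p (r s)"
      using leg_exists[OF rr(1,2)] rr z e by auto
    have "r ` {0<..s} \<subseteq> path_image r" using s(1) by (auto simp: path_image_def)
    then have rS: "r ` {0<..s} \<subseteq> S - D" using r(2) s(3) by blast
    obtain t where t: "t \<in> {0..1}" "\<epsilon> \<le> dist p (l t)" using loop_far_point[OF l(1)] by blast
    then have t01: "0 < t" "t < 1" using l01 \<epsilon> by (cases "t = 0"; cases "t = 1"; auto)+
    obtain L1 L2 a1 a2 where L: "L1 \<subseteq> l ` {0<..<t}" "L2 \<subseteq> l ` {t<..<1}" "p \<notin> L1" "p \<notin> L2"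
      "L1 \<subseteq> cball p e" "L2 \<subseteq> cball p e" "path_component (insert p L1) p a1" "path_component (insert p L2) p a2"
      "dist p a1 = e" "dist p a2 = e"
      using loop_legs[OF l(1,3) t01(1) order_refl t01(2) t(2) t(2) e] by metis
    have "l ` {0<..<t} \<inter> l ` {t<..<1} = {}"
      using t01 by (intro loop_disjoint_pieces[OF l(1)]) auto
    then have "L1 \<inter> L2 = {}" using L(1,2) by blast
    moreover have "L1 \<subseteq> D" "L2 \<subseteq> D"
      using lD[of "{0<..<t}"] lD[of "{t<..<1}"] t01 L(1,2) by (auto simp: subset_iff)
    moreover from this have "r ` {0<..s} \<inter> L1 = {}" "r ` {0<..s} \<inter> L2 = {}" using rS by blast+
    moreover have "L1 \<subseteq> S \<inter> cball p e" "L2 \<subseteq> S \<inter> cball p e" "r ` {0<..s} \<subseteq> S \<inter> cball p e"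
      using calculation(2,3) L(5,6) DS rS s(4) by blast+
    ultimately have "tripod S e p"
      using tripodI[of p "r ` {0<..s}" L1 L2 e "r s" a1 a2] s(2,3,5) L(3,4,7-10) by blast
    then show ?thesis by (simp add: e_def)
  next
    case False
    then have Wsmall: "W \<subseteq> ball p e" by auto
    have m01: "m 0 = y" "m 1 = y" and mc: "continuous_on {0..1} m"
      using m by (auto simp: loop_in_def pathstart_def pathfinish_def simple_path_def path_def)
    have mS: "m ` {0..1} \<subseteq> S" using m(1) by (auto simp: loop_in_def path_image_def)
    have yW: "y \<in> W" using py by (simp add: W_def)
    have piece: "m ` I \<subseteq> W" if I: "I \<subseteq> {0..1}" "is_interval I" "u0 \<in> I" "m u0 = y" "m ` I \<inter> D = {}" for I u0
    proof
      fix x assume x: "x \<in> m ` I"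
      have "path_connected (m ` I)"
        using continuous_on_subset[OF mc I(1)] I(2)
        by (intro path_connected_continuous_image) (auto simp: is_interval_path_connected)
      then have "path_component (m ` I) y x" using x I(3,4) unfolding path_connected_component by blast
      moreover have "m ` I \<subseteq> insert p (S - D)"
        using image_mono[OF I(1), of m] mS I(5) by blast
      ultimately have "path_component (insert p (S - D)) y x"
        by (rule path_component_of_subset[rotated])
      then show "x \<in> W" using py path_component_trans by (auto simp: W_def)
    qed
    define A where "A = {u \<in> {0..1}. m u \<in> D}"
    have clA: "closed A"
      unfolding A_def using continuous_closed_preimage[OF mc _ clD] by (simp add: vimage_def Int_def)
    have Ane: "A \<noteq> {}"
    proof
      assume "A = {}"
      then have "m ` {0..1} \<subseteq> W" using m01 by (intro piece[of _ 0]) (auto simp: A_def)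
      then have "path_image m \<subseteq> S \<inter> ball p \<epsilon>" using Wsmall e mS by (fastforce simp: path_image_def)
      then show False using m(1) no_small[of p m] by (auto simp: loop_in_def)
    qed
    have bdd: "bdd_below A" "bdd_above A"
      by (auto simp: A_def intro!: bdd_belowI[of _ 0] bdd_aboveI[of _ 1])
    have IA: "Inf A \<in> A" "Sup A \<in> A"
      using closed_contains_Inf[OF Ane bdd(1) clA] closed_contains_Sup[OF Ane bdd(2) clA] by auto
    \<comment> \<open>These are the first and the last time at which \<open>m\<close> is on
      \<open>D\<close>. Before \<open>u1\<close> and after \<open>u2\<close> the loop
      \<open>m\<close> runs in \<open>W\<close>, so if the two times agreed, all of \<open>m\<close>
      would be small. Hence the two points of \<open>D\<close> differ, and one of them is a point
      \<open>q\<close> other than \<open>p\<close>.\<close>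
    define u1 where "u1 = Inf A"
    define u2 where "u2 = Sup A"
    have u: "m u1 \<in> D" "m u2 \<in> D" "u1 \<in> {0..1}" "u2 \<in> {0..1}" using IA by (auto simp: u1_def u2_def A_def)
    have low: "m t \<notin> D" if "t \<in> {0..1}" "t < u1" for t
      using that cInf_lower[of t A] by (force simp: u1_def A_def intro!: bdd_belowI[of _ 0])
    have high: "m t \<notin> D" if "t \<in> {0..1}" "u2 < t" for t
      using that cSup_upper[of t A] by (force simp: u2_def A_def intro!: bdd_aboveI[of _ 1])
    have pos: "0 < u1" "u2 < 1" "0 < u2" "u1 < 1"
      using u m01 yD by (cases "u1 = 0"; cases "u2 = 1"; cases "u2 = 0"; cases "u1 = 1"; auto)+
    have W1: "m ` {0..<u1} \<subseteq> W" using pos u low m01 by (intro piece[of _ 0]) (auto simp: is_interval_co)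
    have W2: "m ` {u2<..1} \<subseteq> W" using pos u high m01 by (intro piece[of _ 1]) (auto simp: is_interval_oc)
    have reach: "path_component (insert (m v) W) y (m v) \<and> dist p (m v) \<le> e" if v: "v = u1 \<or> v = u2" for v
    proof -
      obtain I w where I: "I \<subseteq> {0..1}" "is_interval I" "w \<in> I" "m w = y" "v \<in> I" "m ` (I - {v}) \<subseteq> W" "v \<in> closure (I - {v})"
      proof (cases "v = u1")
        case True
        have "{0..u1} - {u1} = {0..<u1}" by auto
        then show thesis using that[of "{0..u1}" 0] True W1 pos u m01 by (auto simp: is_interval_cc)
      next
        case False
        then have "v = u2" using v by simp
        moreover have "{u2..1} - {u2} = {u2<..1}" by auto
        ultimately show thesis using that[of "{u2..1}" 1] W2 pos u m01 by (auto simp: is_interval_cc)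
      qed
      have sub: "m ` I \<subseteq> insert (m v) W" using I(6) by blast
      have "path_connected (m ` I)"
        using continuous_on_subset[OF mc I(1)] I(2)
        by (intro path_connected_continuous_image) (auto simp: is_interval_path_connected)
      then have "path_component (m ` I) y (m v)" using I(3,4,5) unfolding path_connected_component by blast
      then have 1: "path_component (insert (m v) W) y (m v)" using path_component_of_subset[OF sub] by blast
      have "continuous_on (closure (I - {v})) m"
        using I(1) by (intro continuous_on_subset[OF mc] closure_minimal) auto
      moreover have "m ` (I - {v}) \<subseteq> cball p e"
        using I(6) Wsmall ball_subset_cball by blast
      ultimately have "m ` closure (I - {v}) \<subseteq> cball p e"
        using image_closure_subset closed_cball by blast
      then show ?thesis using 1 I(7) by auto
    qed
    have "u1 \<noteq> u2"
    proof
      assume eq: "u1 = u2"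
      have "m t \<in> S \<inter> ball p \<epsilon>" if "t \<in> {0..1}" for t
      proof -
        consider "t < u1" | "t = u1" | "u2 < t" using eq by linarith
        then show ?thesis
          using W1 W2 reach[of u1] that mS Wsmall e by cases (fastforce)+
      qed
      then show False using m(1) no_small[of p m] by (auto simp: loop_in_def path_image_def)
    qed
    then have "m u1 \<noteq> m u2" using loop_inj[OF m(1), of u1 u2] u pos by auto
    then obtain q where q: "q \<in> D" "q \<noteq> p" "path_component (insert q W) y q" "dist p q \<le> e"
      using reach u by metis
    have "path_component W p y"
      unfolding W_def using py path_component_refl[of p "insert p (S - D)"]
      by (metis (no_types, lifting) insertI1 mem_Collect_eq path_component_path_component path_component_maximal path_connected_path_component path_connected_component)
    then have "path_component (insert q W) p q"
      using q(3) path_component_trans path_component_of_subset[of W "insert q W"] by blast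
    then obtain \<delta> where \<delta>: "arc \<delta>" "path_image \<delta> \<subseteq> insert q W" "pathstart \<delta> = p" "pathfinish \<delta> = q"
      using arc_exists q(2) by metis
    have \<delta>D: "path_image \<delta> \<inter> D \<subseteq> {p, q}" using \<delta>(2) Wsub by auto
    have \<delta>S: "path_image \<delta> \<subseteq> S \<inter> ball p \<epsilon>"
      using \<delta>(2) Wsub Wsmall q DS pS e by force
    obtain v where v: "v \<in> {0..1}" "q = l v" using q(1) by (auto simp: D_def path_image_def)
    then have v01: "0 < v" "v < 1" using q(2) l01 by (cases "v = 0"; cases "v = 1"; auto)+
    \<comment> \<open>Otherwise this part of \<open>l\<close> together with the arc
      \<open>\<delta>\<close>, which meets \<open>l\<close> in \<open>p\<close> and \<open>q\<close>
      only, would contain a small loop.\<close>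
    have far: "\<exists>t\<in>{a<..<b}. \<epsilon> \<le> dist p (l t)"
      if ab: "0 \<le> a" "a < b" "b \<le> 1" "b - a < 1" "{l a, l b} = {p, q}" for a b
    proof (rule ccontr)
      assume n: "\<not> ?thesis"
      define c where "c = subpath a b l"
      have c: "arc c"
        unfolding c_def using l(1) ab by (intro arc_simple_path_subpath_interior) (auto simp: loop_in_def)
      have cim: "path_image c = l ` {a..b}"
        using ab by (simp add: c_def path_image_subpath_gen closed_segment_eq_real_ivl)
      have cs: "path_image c \<subseteq> S \<inter> ball p \<epsilon>"
      proof
        fix x assume "x \<in> path_image c"
        then obtain t where t: "t \<in> {a..b}" "x = l t" using cim by auto
        have "x \<in> S" using t ab DS by (auto simp: D_def path_image_def)
        moreover have "dist p x < \<epsilon>"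
        proof (cases "t = a \<or> t = b")
          case True
          then have "x = p \<or> x = q" using t ab(5) by blast
          then show ?thesis using q(4) e by auto
        next
          case False
          then have "t \<in> {a<..<b}" using t by auto
          then show ?thesis using n t by (auto simp: not_le)
        qed
        ultimately show "x \<in> S \<inter> ball p \<epsilon>" by simp
      qed
      obtain g where g: "path g" "pathstart g = pathstart c" "pathfinish g = pathfinish c" "path_image g = path_image \<delta>"
      proof (cases "l a = p")
        case True
        then have "l b = q" using ab(5) by (auto simp: doubleton_eq_iff)
        then show thesis using that[of \<delta>] \<delta> True arc_imp_path by (auto simp: c_def)
      next
        case False
        then have "l a = q" "l b = p" using ab(5) by (auto simp: doubleton_eq_iff)
        then show thesis using that[of "reversepath \<delta>"] \<delta> arc_imp_path by (auto simp: c_def path_image_reversepath)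
      qed
      have "(b - a) * (1/2) + a = (a + b) / 2" by (simp add: field_simps)
      then have mid: "c (1/2) = l ((a + b) / 2)" by (simp only: c_def subpath_def)
      have "c (1/2) \<notin> path_image g"
      proof
        assume "c (1/2) \<in> path_image g"
        then have "l ((a + b) / 2) \<in> path_image \<delta>" using mid g(4) by simp
        moreover have "(a + b) / 2 \<in> {0..1}" using ab by auto
        then have "l ((a + b) / 2) \<in> D" unfolding D_def path_image_def by (rule imageI)
        ultimately have "l ((a + b) / 2) \<in> {p, q}" by (intro subsetD[OF \<delta>D] IntI)
        then have "l ((a + b) / 2) = l a \<or> l ((a + b) / 2) = l b" using ab(5) by blast
        then show False
          using loop_inj[OF l(1), of "(a+b)/2" a] loop_inj[OF l(1), of "(a+b)/2" b] ab by auto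
      qed
      then obtain x where "loop_in (path_image c \<union> path_image g) x"
        using loop_of_arc_and_path[OF c g(1,2,3), of "1/2"] by auto
      then show False by (rule no_small_subset[of _ _ p]) (use cs \<delta>S g(4) in auto)
    qed
    have ends: "{l 0, l v} = {p, q}" "{l v, l 1} = {p, q}" using v(2) l01 by auto
    obtain t1 where t1: "0 < t1" "t1 < v" "\<epsilon> \<le> dist p (l t1)" using far[OF _ _ _ _ ends(1)] v01 by auto
    obtain t2 where t2: "v < t2" "t2 < 1" "\<epsilon> \<le> dist p (l t2)" using far[OF _ _ _ _ ends(2)] v01 by auto
    have t12: "t1 \<le> t2" using t1 t2 by simp
    obtain L1 L2 a1 a2 where L: "L1 \<subseteq> l ` {0<..<t1}" "L2 \<subseteq> l ` {t2<..<1}" "p \<notin> L1" "p \<notin> L2"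
      "L1 \<subseteq> cball p e" "L2 \<subseteq> cball p e" "path_component (insert p L1) p a1" "path_component (insert p L2) p a2"
      "dist p a1 = e" "dist p a2 = e"
      by (rule loop_legs[OF l(1,3) t1(1) t12 t2(2) t1(3) t2(3) e])
    \<comment> \<open>From \<open>q\<close> the third leg goes back along \<open>l\<close> towards
      the far point at \<open>t1\<close>. The first leg ends before \<open>t1\<close> and the second
      stays beyond \<open>t2\<close>, so the three are disjoint.\<close>
    define c where "c = subpath v t1 l"
    have c: "arc c"
      unfolding c_def using l(1) t1 v01 by (intro arc_simple_path_subpath_interior) (auto simp: loop_in_def)
    have cim: "path_image c = l ` {t1..v}"
      using t1 by (simp add: c_def path_image_subpath_gen closed_segment_eq_real_ivl)
    have pc: "p \<notin> l ` {t1..v}"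
    proof
      assume "p \<in> l ` {t1..v}"
      then obtain t where t: "t \<in> {t1..v}" "l t = l 0" using l01 by auto
      then show False using loop_inj[OF l(1), of t 0] t1 v01 by auto
    qed
    have cD: "path_image c \<subseteq> D" using cim lD[of "{t1..v}"] t1 v01 by auto
    define r where "r = \<delta> +++ c"
    have "arc r"
      unfolding r_def
    proof (rule arc_join[OF \<delta>(1) c])
      have cq: "pathstart c = q" using v(2) by (simp add: c_def)
      show "pathfinish \<delta> = pathstart c" using \<delta>(4) cq by simp
      have "p \<notin> path_image c" using pc cim by simp
      then show "path_image \<delta> \<inter> path_image c \<subseteq> {pathstart c}" using \<delta>D cD cq by blast
    qed
    then have rr: "continuous_on {0..1} r" "inj_on r {0..1}" "r 0 = p" "r 1 = l t1"
      using \<delta> by (auto simp: arc_def path_def r_def joinpaths_def pathstart_def c_def subpath_def)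
    have "e \<le> dist p (r 1)" using rr(4) t1(3) e by simp
    then obtain s where s: "s \<in> {0<..1}" "dist p (r s) = e" "p \<notin> r ` {0<..s}" "r ` {0<..s} \<subseteq> cball p e"
      "path_component (insert p (r ` {0<..s})) p (r s)"
      by (rule leg_exists[OF rr(1,2) zero_le_one rr(3) _ e(1)])
    have "r ` {0<..s} \<subseteq> path_image r" using s(1) by (auto simp: path_image_def)
    also have "\<dots> \<subseteq> path_image \<delta> \<union> path_image c" unfolding r_def by (rule path_image_join_subset)
    finally have rim: "r ` {0<..s} \<subseteq> path_image \<delta> \<union> path_image c" .
    have rD: "r ` {0<..s} \<subseteq> (S - D) \<union> l ` {t1..v}"
    proof
      fix x assume x: "x \<in> r ` {0<..s}"
      then have "x \<noteq> p" using s(3) by blast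
      have "l v \<in> l ` {t1..v}" using t1 by auto
      then show "x \<in> (S - D) \<union> l ` {t1..v}"
        using subsetD[OF rim x] \<open>x \<noteq> p\<close> \<delta>D \<delta>S v(2) cim by blast
    qed
    have pieces: "l ` {0<..<t1} \<inter> l ` {t2<..<1} = {}" "l ` {0<..<t1} \<inter> l ` {t1..v} = {}" "l ` {t2<..<1} \<inter> l ` {t1..v} = {}"
      using t1 t2 v01 by (intro loop_disjoint_pieces[OF l(1)]; auto)+
    have subI: "{0<..<t1} \<subseteq> {0..1}" "{t2<..<1} \<subseteq> {0..1}" "{t1..v} \<subseteq> {0..1}"
      using t1 t2 v01 by auto
    have subD: "l ` {0<..<t1} \<subseteq> D" "l ` {t2<..<1} \<subseteq> D" "l ` {t1..v} \<subseteq> D"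
      by (rule lD[OF subI(1)], rule lD[OF subI(2)], rule lD[OF subI(3)])
    have apart: "R \<inter> L = {}" if "R \<subseteq> (S - D) \<union> A" "L \<subseteq> D" "L \<subseteq> B" "B \<inter> A = {}" for R L A B
      using that by blast
    have LD: "L1 \<subseteq> D" "L2 \<subseteq> D" by (rule subset_trans[OF L(1) subD(1)], rule subset_trans[OF L(2) subD(2)])
    have "r ` {0<..s} \<inter> L1 = {}" "r ` {0<..s} \<inter> L2 = {}"
      by (rule apart[OF rD LD(1) L(1) pieces(2)], rule apart[OF rD LD(2) L(2) pieces(3)])
    moreover have "L1 \<inter> L2 = {}"
      using Int_mono[OF L(1,2)] pieces(1) by simp
    moreover have "L1 \<subseteq> S \<inter> cball p e" "L2 \<subseteq> S \<inter> cball p e"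
      using LD DS L(5,6) by auto
    moreover have "r ` {0<..s} \<subseteq> S"
      by (rule subset_trans[OF rD]) (use subD(3) DS in auto)
    then have "r ` {0<..s} \<subseteq> S \<inter> cball p e" using s(4) by (rule Int_greatest)
    ultimately have "tripod S e p"
      using tripodI[of p "r ` {0<..s}" L1 L2 e "r s" a1 a2, OF s(3) L(3,4) _ _ _ s(5) L(7,8) s(2) L(9,10)] by simp
    then show ?thesis by (simp add: e_def)
  qed
qed

text \<open>A path from a point of one loop to another loop that does not contain this point first
  meets the latter in a branch point.\<close>

lemma branch_point_exists:
  assumes "loop_in S l" "loop_in S m" "path_image l \<noteq> path_image m"
  shows "\<exists>p\<in>S. branch_point S p"
proof -
  have "\<exists>p\<in>S. branch_point S p" if lm: "loop_in S l" "loop_in S m" "y \<in> path_image m" "y \<notin> path_image l" for l m y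
  proof -
    have sub: "path_image l \<subseteq> S" "path_image m \<subseteq> S" using lm by (auto simp: loop_in_def)
    have "pathstart l \<in> path_image l" by (rule pathstart_in_path_image)
    then have "path_component S y (pathstart l)"
      using pc sub lm unfolding path_connected_component by blast
    then obtain g where g: "path g" "path_image g \<subseteq> S" "pathstart g = y" "pathfinish g = pathstart l"
      unfolding path_component_def by blast
    have "closed (path_image l)" using lm(1) by (simp add: loop_in_def closed_simple_path_image)
    then obtain p where p: "p \<in> path_image l" "path_component (insert p (path_image g - path_image l)) y p"
      using path_first_hit[OF g(1), of "path_image l"] g(3,4) by auto
    have "insert p (path_image g - path_image l) \<subseteq> insert p (S - path_image l)" using g(2) by blast
    then have "path_component (insert p (S - path_image l)) p y"
      using path_component_of_subset[OF _ path_component_sym[OF p(2)]] by blast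
    then show ?thesis using p(1) lm sub unfolding branch_point_def by blast
  qed
  then show ?thesis using assms by blast
qed

theorem loops_trichotomy:
  obtains "\<nexists>l. loop_in S l"
  | l where "loop_in S l" "\<And>m. loop_in S m \<Longrightarrow> path_image m = path_image l"
  | F where "finite F" "F \<noteq> {}" "F \<subseteq> S" "\<And>h k. homeomorphism S S h k \<Longrightarrow> h ` F \<subseteq> F"
proof (cases "\<exists>l m. loop_in S l \<and> loop_in S m \<and> path_image l \<noteq> path_image m")
  case True
  let ?F = "{p \<in> S. branch_point S p}"
  have "?F \<subseteq> {p \<in> S. tripod S (\<epsilon>/8) p}" using branch_point_tripod by blast
  then have "finite ?F" using finite_tripods finite_subset by blast
  moreover have "?F \<noteq> {}" using branch_point_exists True by blast
  moreover have "h ` ?F \<subseteq> ?F" if "homeomorphism S S h k" for h k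
    using branch_point_homeomorphism[OF that] that by (auto simp: homeomorphism_def)
  ultimately show thesis using that(3)[of ?F] by blast
next
  case False
  then show thesis using that(1,2) by metis
qed

end

section \<open>Commuting groups of lifts to the real line\<close>

lemma shift_of_int:
  fixes f :: "real \<Rightarrow> real"
  assumes "\<And>x. f (x + 1) = f x + a"
  shows "f (x + of_int n) = f x + of_int n * a"
proof (induction n rule: int_induct[where k = 0])
  case (step1 i)
  then show ?case using assms[of "x + of_int i"] by (simp add: algebra_simps)
next
  case (step2 i)
  then show ?case using assms[of "x + of_int i - 1"] by (simp add: algebra_simps)
qed simp

text \<open>These are the lifts of the orientation preserving homeomorphisms of the circle;
  surjectivity follows from the shift rule and continuity.\<close>

definition circle_lift :: "(real \<Rightarrow> real) \<Rightarrow> bool" where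
  "circle_lift f \<longleftrightarrow> continuous_on UNIV f \<and> strict_mono f \<and> (\<forall>x. f (x + 1) = f x + 1)"

lemma circle_lift_shift: "circle_lift f \<Longrightarrow> f (x + of_int n) = f x + of_int n"
  using shift_of_int[of f 1 x n] by (simp add: circle_lift_def)

text \<open>Including the unit translation makes every invariant set periodic, so that it is
  determined by its part in \<open>{0..1}\<close>.\<close>

definition lift_group :: "(real \<Rightarrow> real) set \<Rightarrow> bool" where
  "lift_group \<Phi> \<longleftrightarrow> (\<forall>f\<in>\<Phi>. circle_lift f) \<and> (\<lambda>x. x + 1) \<in> \<Phi> \<and>
     (\<forall>f\<in>\<Phi>. \<forall>g\<in>\<Phi>. f \<circ> g \<in> \<Phi>) \<and> (\<forall>f\<in>\<Phi>. \<exists>g\<in>\<Phi>. (\<forall>x. g (f x) = x) \<and> (\<forall>x. f (g x) = x))"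

definition inv_closed :: "(real \<Rightarrow> real) set \<Rightarrow> real set \<Rightarrow> bool" where
  "inv_closed \<Phi> A \<longleftrightarrow> closed A \<and> A \<noteq> {} \<and> (\<forall>f\<in>\<Phi>. \<forall>x\<in>A. f x \<in> A)"

lemma inv_closed_shift:
  assumes \<Phi>: "lift_group \<Phi>" and A: "\<And>f x. f \<in> \<Phi> \<Longrightarrow> x \<in> A \<Longrightarrow> f x \<in> A" and x: "x \<in> A"
  shows "x + of_int n \<in> A"
proof -
  have T: "(\<lambda>x. x + 1) \<in> \<Phi>"
    using \<Phi> by (simp add: lift_group_def)
  obtain g where g: "g \<in> \<Phi>" "\<And>x. g (x + 1) = x"
    using \<Phi> T unfolding lift_group_def by meson
  have "g x = x - 1" for x
    using g(2)[of "x - 1"] by simp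
  then have down: "x \<in> A \<Longrightarrow> x - 1 \<in> A" for x
    using A[OF g(1)] by metis
  have up: "x \<in> A \<Longrightarrow> x + 1 \<in> A" for x
    using A[OF T] by metis
  show ?thesis
  proof (induction n rule: int_induct[where k = 0])
    case (step1 i) then show ?case using up[of "x + of_int i"] by (simp add: algebra_simps)
  next
    case (step2 i) then show ?case using down[of "x + of_int i"] by (simp add: algebra_simps)
  qed (use x in simp)
qed

lemma inv_closed_meets_unit:
  assumes "lift_group \<Phi>" "inv_closed \<Phi> A"
  shows "A \<inter> {0..1} \<noteq> {}"
proof -
  obtain x where "x \<in> A" using assms(2) by (auto simp: inv_closed_def)
  moreover have "\<And>f x. f \<in> \<Phi> \<Longrightarrow> x \<in> A \<Longrightarrow> f x \<in> A"
    using assms(2) by (auto simp: inv_closed_def)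
  ultimately have "x + of_int (- \<lfloor>x\<rfloor>) \<in> A"
    using inv_closed_shift[OF assms(1), of A] by blast
  moreover have "x + of_int (- \<lfloor>x\<rfloor>) \<in> {0..1}"
    by (auto; linarith)
  ultimately show ?thesis by blast
qed

lemma finite_separated_reals:
  fixes E :: "real set"
  assumes "0 < d" "E \<subseteq> {0..1}" "\<And>a b. a \<in> E \<Longrightarrow> b \<in> E \<Longrightarrow> a < b \<Longrightarrow> d \<le> b - a"
  shows "finite E"
proof -
  have "inj_on (\<lambda>a. \<lfloor>a / d\<rfloor>) E"
  proof (rule inj_onI, rule ccontr)
    fix a b assume ab: "a \<in> E" "b \<in> E" "\<lfloor>a / d\<rfloor> = \<lfloor>b / d\<rfloor>" "a \<noteq> b"
    have "\<lfloor>a' / d\<rfloor> < \<lfloor>b' / d\<rfloor>" if "a' \<in> E" "b' \<in> E" "a' < b'" for a' b'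
    proof -
      have "(a' + d) / d \<le> b' / d"
        using assms(3)[OF that] assms(1) by (intro divide_right_mono) auto
      then have "a' / d + 1 \<le> b' / d"
        using assms(1) by (simp add: add_divide_distrib)
      then show ?thesis by linarith
    qed
    then show False
      using ab by (metis less_irrefl linorder_neqE_linordered_idom)
  qed
  moreover have "(\<lambda>a. \<lfloor>a / d\<rfloor>) ` E \<subseteq> {0..\<lfloor>1 / d\<rfloor>}"
  proof (intro image_subsetI)
    fix a assume "a \<in> E"
    then have "0 \<le> a / d" "a / d \<le> 1 / d"
      using assms(1,2) by (auto intro!: divide_right_mono divide_nonneg_pos)
    then show "\<lfloor>a / d\<rfloor> \<in> {0..\<lfloor>1 / d\<rfloor>}" by (simp add: floor_mono)
  qed
  ultimately show ?thesis
    by (meson finite_atLeastAtMost_int finite_imageD finite_subset)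
qed

text \<open>A point of \<open>A\<close> is marked if a point of \<open>B\<close> follows before the
  next point of \<open>A\<close>. Increasing bijections that preserve \<open>A\<close> and
  \<open>B\<close> keep the marks. Between two marked points there is a point of \<open>B\<close>,
  and the compact part of \<open>A\<close> in \<open>{0..1}\<close> has positive distance from
  \<open>B\<close>, so the marked points are separated.\<close>

lemma disjoint_inv_closed_imp_discrete:
  assumes \<Phi>: "lift_group \<Phi>" and A: "inv_closed \<Phi> A" and B: "inv_closed \<Phi> B" and "A \<inter> B = {}"
  shows "\<exists>E. E \<noteq> {} \<and> finite (E \<inter> {0..1}) \<and> (\<forall>f\<in>\<Phi>. \<forall>x\<in>E. f x \<in> E)"
proof -
  define E where "E = {a \<in> A. \<exists>b\<in>B. a < b \<and> {a<..<b} \<inter> A = {}}"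
  have clA: "closed A" "closed B" using A B by (auto simp: inv_closed_def)
  have shiftA: "x + of_int n \<in> A" if "x \<in> A" for x n
    using inv_closed_shift[OF \<Phi> _ that] A by (auto simp: inv_closed_def)
  obtain b where b: "b \<in> B" using B by (auto simp: inv_closed_def)
  obtain a0 where a0: "a0 \<in> A" using A by (auto simp: inv_closed_def)
  have "a0 + of_int (\<lfloor>b - a0\<rfloor>) \<in> A \<inter> {..b}"
    using shiftA[OF a0] by (auto; linarith)
  then have ne: "A \<inter> {..b} \<noteq> {}" by blast
  have "closed (A \<inter> {..b})" using clA by auto
  then have "Sup (A \<inter> {..b}) \<in> A \<inter> {..b}"
    by (intro closed_contains_Sup ne) auto
  moreover have "{Sup (A \<inter> {..b})<..<b} \<inter> A = {}"
  proof -
    have "x \<le> Sup (A \<inter> {..b})" if "x \<in> A" "x < b" for x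
      using that by (intro cSup_upper) auto
    then show ?thesis by force
  qed
  ultimately have "Sup (A \<inter> {..b}) \<in> E"
    using b \<open>A \<inter> B = {}\<close> by (fastforce simp: E_def)
  then have "E \<noteq> {}" by blast
  moreover have "f x \<in> E" if f: "f \<in> \<Phi>" and "x \<in> E" for f x
  proof -
    obtain b where b: "x \<in> A" "b \<in> B" "x < b" "{x<..<b} \<inter> A = {}"
      using \<open>x \<in> E\<close> by (auto simp: E_def)
    obtain g where g: "g \<in> \<Phi>" "\<And>x. g (f x) = x" "\<And>x. f (g x) = x"
      using \<Phi> f unfolding lift_group_def by meson
    have mono: "strict_mono f" "strict_mono g"
      using \<Phi> f g by (auto simp: lift_group_def circle_lift_def)
    have "f x \<in> A" "f b \<in> B"
      using A B f b by (auto simp: inv_closed_def)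
    moreover have "f x < f b" using mono b(3) by (simp add: strict_mono_less)
    moreover have "y \<notin> A" if "f x < y" "y < f b" for y
    proof
      assume "y \<in> A"
      then have "g y \<in> A" using A g by (auto simp: inv_closed_def)
      moreover have "x < g y" "g y < b"
        using that g(2) strict_mono_less[OF mono(2)] by metis+
      ultimately show False using b(4) by auto
    qed
    ultimately show ?thesis by (auto simp: E_def)
  qed
  moreover have "finite (E \<inter> {0..1})"
  proof -
    have "compact (A \<inter> {0..1})" using clA by (simp add: closed_Int_compact)
    then obtain d where d: "0 < d" "\<And>a b. a \<in> A \<inter> {0..1} \<Longrightarrow> b \<in> B \<Longrightarrow> d \<le> dist a b"
      using separate_compact_closed[of "A \<inter> {0..1}" B] clA(2) \<open>A \<inter> B = {}\<close> by (metis Int_assoc Int_commute inf_bot_right)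
    show ?thesis
    proof (rule finite_separated_reals[OF d(1)])
      fix a a' assume aa': "a \<in> E \<inter> {0..1}" "a' \<in> E \<inter> {0..1}" "a < a'"
      then obtain b where b: "b \<in> B" "a < b" "{a<..<b} \<inter> A = {}" by (auto simp: E_def)
      have "b \<le> a'" using b aa' by (force simp: E_def)
      moreover have "d \<le> dist a b" using aa' b d(2)[of a b] by (auto simp: E_def)
      ultimately show "d \<le> a' - a" using b(2) by (auto simp: dist_real_def)
    qed auto
  qed
  ultimately show ?thesis by blast
qed

text \<open>Although the line is not compact, every closed invariant set meets \<open>{0..1}\<close>
  by periodicity, and the finite intersection property is applied there.\<close>

lemma inv_closed_Inter_nonempty:
  assumes \<Phi>: "lift_group \<Phi>"
    and meet: "\<And>A B. inv_closed \<Phi> A \<Longrightarrow> inv_closed \<Phi> B \<Longrightarrow> A \<inter> B \<noteq> {}"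
  shows "inv_closed \<Phi> (\<Inter>{A. inv_closed \<Phi> A})"
proof -
  have fin: "inv_closed \<Phi> (\<Inter>\<A>)" if "finite \<A>" "\<A> \<noteq> {}" "\<A> \<subseteq> {A. inv_closed \<Phi> A}" for \<A>
    using that
  proof (induction \<A> rule: finite_ne_induct)
    case (insert A \<A>)
    then have "inv_closed \<Phi> A" "inv_closed \<Phi> (\<Inter>\<A>)" by auto
    then show ?case
      using meet[of A "\<Inter>\<A>"] by (auto simp: inv_closed_def)
  qed auto
  have "{0..1} \<inter> \<Inter>{A. inv_closed \<Phi> A} \<noteq> {}"
  proof (rule compact_imp_fip)
    fix \<A> assume \<A>: "finite \<A>" "\<A> \<subseteq> {A. inv_closed \<Phi> A}"
    show "{0..1::real} \<inter> \<Inter>\<A> \<noteq> {}"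
    proof (cases "\<A> = {}")
      case False
      then show ?thesis
        using inv_closed_meets_unit[OF \<Phi> fin[OF \<A>(1) False \<A>(2)]] by blast
    qed auto
  qed (auto simp: inv_closed_def)
  then show ?thesis
    unfolding inv_closed_def by (auto intro!: closed_Inter)
qed

text \<open>For \<open>g\<close> in \<open>\<Psi>\<close>, the preimage of \<open>M\<close> and, if
  nonempty, the set of points fixed by \<open>g\<close> are closed and
  \<open>\<Phi>\<close>-invariant, so both contain \<open>M\<close>. Hence \<open>g\<close>
  preserves \<open>M\<close> and either has no fixed point or fixes \<open>M\<close> pointwise, and
  an inequality between two members of \<open>\<Psi>\<close> at \<open>x0\<close> holds on all of
  \<open>M\<close>. Among \<open>n\<close> members that push \<open>n + 1\<close> points of the
  orbit one place up, the least one makes \<open>n\<close> steps within an interval of length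
  one.\<close>

lemma small_positive_lift:
  assumes \<Phi>: "lift_group \<Phi>" and \<Psi>: "lift_group \<Psi>"
    and comm: "\<And>f g x. f \<in> \<Phi> \<Longrightarrow> g \<in> \<Psi> \<Longrightarrow> f (g x) = g (f x)"
    and M: "inv_closed \<Phi> M" and Mmin: "\<And>A. inv_closed \<Phi> A \<Longrightarrow> M \<subseteq> A"
    and x0: "x0 \<in> M" and inf: "infinite ({k x0 |k. k \<in> \<Psi>} \<inter> {0..1})"
  shows "\<exists>g\<in>\<Psi>. \<exists>y\<in>{0..1}. (\<forall>x. x < g x) \<and> (g ^^ n) y \<le> y + 1"
proof (cases "n = 0")
  case True
  have "(\<lambda>x. x + 1) \<in> \<Psi>" using \<Psi> by (simp add: lift_group_def)
  then show ?thesis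
    using True by (intro bexI[of _ "\<lambda>x. x + 1"] bexI[of _ 0]) auto
next
  case False
  have fixM: "M \<subseteq> {x. g x = x}" if "g \<in> \<Psi>" "g z = z" for g z
  proof (rule Mmin)
    have "continuous_on UNIV g" using \<Psi> that by (auto simp: lift_group_def circle_lift_def)
    then have "closed {x. g x = x}"
      by (intro closed_Collect_eq continuous_on_id)
    moreover have "g (f x) = f x" if "f \<in> \<Phi>" "g x = x" for f x
      using comm[OF that(1) \<open>g \<in> \<Psi>\<close>, of x] that(2) by simp
    ultimately show "inv_closed \<Phi> {x. g x = x}"
      using that by (auto simp: inv_closed_def)
  qed
  have pos: "x < g x" if g: "g \<in> \<Psi>" and z: "z \<in> M" "z < g z" for g z x
  proof (rule ccontr)
    assume "\<not> x < g x"
    have "continuous_on UNIV (\<lambda>x. g x - x)"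
      using \<Psi> g by (auto simp: lift_group_def circle_lift_def intro!: continuous_intros)
    then have "connected (range (\<lambda>x. g x - x))"
      using connected_continuous_image connected_UNIV by blast
    then have "0 \<in> range (\<lambda>x. g x - x)"
      using z(2) \<open>\<not> x < g x\<close> connectedD_interval[of "range (\<lambda>x. g x - x)" "g x - x" "g z - z" 0] by auto
    then obtain w where "g w = w" by auto
    then show False using fixM[OF g] z by fastforce
  qed
  have invM: "k z \<in> M" if k: "k \<in> \<Psi>" and z: "z \<in> M" for k z
  proof -
    obtain k' where k': "k' \<in> \<Psi>" "\<And>x. k (k' x) = x"
      using \<Psi> k unfolding lift_group_def by meson
    have "inv_closed \<Phi> (k -` M)"
    proof -
      have "continuous_on UNIV k" using \<Psi> k by (auto simp: lift_group_def circle_lift_def)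
      then have "closed (k -` M)"
        using M closed_vimage by (auto simp: inv_closed_def)
      moreover have "k' z \<in> k -` M" using k' z by simp
      moreover have "f x \<in> k -` M" if "f \<in> \<Phi>" "x \<in> k -` M" for f x
        using comm[OF that(1) k, of x, symmetric] that M by (auto simp: inv_closed_def)
      ultimately show ?thesis by (auto simp: inv_closed_def)
    qed
    then show ?thesis using Mmin z by blast
  qed
  \<comment> \<open>Comparing \<open>g\<close> and \<open>g'\<close> amounts to comparing the
    identity with \<open>h \<circ> g'\<close>, where \<open>h\<close> is the inverse of
    \<open>g\<close>; then \<open>pos\<close> or \<open>fixM\<close> applies.\<close>
  have ord: "g y \<le> g' y" if g: "g \<in> \<Psi>" "g' \<in> \<Psi>" and le: "g x0 \<le> g' x0" and y: "y \<in> M" for g g' y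
  proof -
    obtain h where h: "h \<in> \<Psi>" "\<And>x. h (g x) = x" "\<And>x. g (h x) = x"
      using \<Psi> g(1) unfolding lift_group_def by meson
    have mono: "strict_mono g" "strict_mono h"
      using \<Psi> g h by (auto simp: lift_group_def circle_lift_def)
    have u: "h \<circ> g' \<in> \<Psi>" using \<Psi> g h by (auto simp: lift_group_def)
    have "x0 \<le> (h \<circ> g') x0"
      using le strict_mono_less_eq[OF mono(2), of "g x0" "g' x0"] h(2) by simp
    then have "y \<le> (h \<circ> g') y"
      using pos[OF u x0, of y] fixM[OF u, of x0] y by (cases "x0 = (h \<circ> g') x0") auto
    then show ?thesis
      using strict_mono_less_eq[OF mono(1), of y "(h \<circ> g') y"] h(3) by simp
  qed
  obtain P where P: "finite P" "card P = Suc n" "P \<subseteq> {k x0 |k. k \<in> \<Psi>} \<inter> {0..1}"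
    using infinite_arbitrarily_large[OF inf, of "Suc n"] by blast
  define ys where "ys = sorted_list_of_set P"
  have ys: "sorted_wrt (<) ys" "length ys = Suc n" "set ys = P"
    using P by (auto simp: ys_def)
  have "\<exists>f. f \<in> \<Psi> \<and> ys ! i = f x0" if "i \<le> n" for i
  proof -
    have "ys ! i \<in> P" using ys that by (metis less_Suc_eq_le nth_mem)
    then show ?thesis using P by blast
  qed
  then obtain f where f: "\<And>i. i \<le> n \<Longrightarrow> f i \<in> \<Psi>" "\<And>i. i \<le> n \<Longrightarrow> ys ! i = f i x0"
    by metis
  have ysM: "ys ! i \<in> M" if "i \<le> n" for i
    using invM[OF f(1)[OF that] x0] f(2)[OF that] by simp
  have "\<exists>g\<in>\<Psi>. g (ys ! i) = ys ! Suc i" if i: "i < n" for i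
  proof -
    obtain h where h: "h \<in> \<Psi>" "\<And>x. h (f i x) = x"
      using \<Psi> f(1)[of i] i unfolding lift_group_def by (metis less_imp_le)
    have "f (Suc i) \<circ> h \<in> \<Psi>" using \<Psi> h f(1)[of "Suc i"] i by (auto simp: lift_group_def)
    moreover have "(f (Suc i) \<circ> h) (ys ! i) = ys ! Suc i"
      using h f(2) i by simp
    ultimately show ?thesis by blast
  qed
  then obtain g where g: "\<And>i. i < n \<Longrightarrow> g i \<in> \<Psi>" "\<And>i. i < n \<Longrightarrow> g i (ys ! i) = ys ! Suc i"
    by metis
  \<comment> \<open>The map that is least at \<open>x0\<close> is least on all of \<open>M\<close>,
    so it moves each of the chosen points except the last at most to the next one.\<close>
  have "\<exists>j. is_arg_min (\<lambda>i. g i x0) (\<lambda>i. i \<in> {..<n}) j"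
    by (rule ex_is_arg_min_if_finite) (use False in auto)
  then obtain j where j: "j < n" "\<And>i. i < n \<Longrightarrow> g j x0 \<le> g i x0"
    by (auto simp: is_arg_min_linorder)
  have le: "g j (ys ! i) \<le> ys ! Suc i" if "i < n" for i
    using ord[OF g(1)[OF j(1)] g(1)[OF that] j(2)[OF that] ysM[of i]] g(2)[OF that] that by simp
  have mono: "strict_mono (g j)" using \<Psi> g(1)[OF j(1)] by (auto simp: lift_group_def circle_lift_def)
  have iter: "(g j ^^ i) (ys ! 0) \<le> ys ! i" if "i \<le> n" for i
    using that
  proof (induction i)
    case (Suc i)
    then have "g j ((g j ^^ i) (ys ! 0)) \<le> g j (ys ! i)"
      using strict_mono_less_eq[OF mono] by simp
    also have "\<dots> \<le> ys ! Suc i" using le Suc by simp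
    finally show ?case by simp
  qed auto
  have "ys ! i \<in> {0..1}" if "i \<le> n" for i
  proof -
    have "ys ! i \<in> set ys" using ys(2) that by simp
    then show ?thesis using ys(3) P(3) by blast
  qed
  then have "ys ! 0 \<in> {0..1}" "ys ! n \<le> 1" by auto
  moreover have "(g j ^^ n) (ys ! 0) \<le> ys ! n" using iter by blast
  moreover have "x < g j x" for x
  proof (rule pos[OF g(1)[OF j(1)] ysM[of j]])
    show "ys ! j < g j (ys ! j)"
      using g(2)[OF j(1)] ys(1,2) j(1) by (simp add: sorted_wrt_iff_nth_less)
  qed (use j in simp)
  ultimately show ?thesis
    using g(1)[OF j(1)] by (intro bexI[of _ "g j"] bexI[of _ "ys ! 0"]) auto
qed

section \<open>Renormalised limits of step counts\<close>

text \<open>A cluster point in a product of compact intervals, which exists by Tychonoff's theorem,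
  serves as an ultralimit: the index set may be uncountable, and relations between finitely many
  coordinates can be passed to \<open>L\<close> up to any error.\<close>

lemma bounded_sequence_cluster:
  fixes u :: "nat \<Rightarrow> 'i \<Rightarrow> real"
  assumes "\<And>n i. \<bar>u n i\<bar> \<le> B i"
  shows "\<exists>L. \<forall>I e N. finite I \<longrightarrow> 0 < e \<longrightarrow> (\<exists>n\<ge>N. \<forall>i\<in>I. \<bar>u n i - L i\<bar> < e)"
proof -
  define X where "X = product_topology (\<lambda>i. top_of_set {- B i..B i}) (UNIV :: 'i set)"
  have top: "topspace X = (\<Pi>\<^sub>E i\<in>UNIV. {- B i..B i})"
    by (simp add: X_def)
  have uX: "u n \<in> topspace X" for n
    using assms by (auto simp: top abs_le_iff minus_le_iff)
  have "compact_space X"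
    unfolding X_def compact_space_product_topology
    by (auto simp: compact_space_subtopology compactin_euclidean_iff)
  then have "(\<Inter>n. X closure_of (u ` {n..})) \<noteq> {}"
  proof (rule compact_space_imp_nest)
    show "closedin X (X closure_of u ` {n..})" for n by simp
    show "X closure_of u ` {n..} \<noteq> {}" for n
    proof -
      have "u n \<in> X closure_of u ` {n..}"
        using uX closure_of_subset[of "u ` {n..}" X] by auto
      then show ?thesis by blast
    qed
    show "decseq (\<lambda>n. X closure_of u ` {n..})"
      by (auto simp: decseq_def intro!: closure_of_mono)
  qed
  then obtain L where L: "\<And>n. L \<in> X closure_of (u ` {n..})" by auto
  show ?thesis
  proof (intro exI[of _ L] allI impI)
    fix I :: "'i set" and e :: real and N :: nat assume I: "finite I" "0 < e"
    define V where "V = (\<Pi>\<^sub>E i\<in>UNIV. if i \<in> I then {- B i..B i} \<inter> ball (L i) e else {- B i..B i})"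
    have "openin X V"
      unfolding X_def V_def
      by (rule product_topology_basis)
        (use I(1) in \<open>auto simp: openin_open_Int intro: finite_subset[of _ I]\<close>)
    moreover have "L \<in> V"
      using L[of 0] I(2) in_closure_of[of L X] by (auto simp: V_def top PiE_iff)
    ultimately obtain n where "n \<ge> N" "u n \<in> V"
      using L[of N] by (auto simp: in_closure_of)
    then show "\<exists>n\<ge>N. \<forall>i\<in>I. \<bar>u n i - L i\<bar> < e"
      by (intro exI[of _ n]) (auto simp: V_def PiE_iff dist_real_def abs_minus_commute split: if_splits)
  qed
qed

text \<open>
  The number of steps of \<open>g\<close> that fit into \<open>[a, b]\<close>. It is additive up to an error of 1 and
  invariant under all maps that commute with \<open>g\<close>, so renormalised limits along maps with smaller
  and smaller steps are invariant measures for the commutant.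
\<close>

definition steps :: "(real \<Rightarrow> real) \<Rightarrow> real \<Rightarrow> real \<Rightarrow> nat" where
  "steps g a b = Max {j. (g ^^ j) a \<le> b}"

context
  fixes g :: "real \<Rightarrow> real"
  assumes lift: "circle_lift g" and pos: "\<And>x. x < g x"
begin

text \<open>By periodicity the displacement of \<open>g\<close> has a positive minimum, so the
  iterates grow at least linearly and the maximum in \<open>steps\<close> is taken over a finite
  set. As the iterates increase, this set is an initial segment.\<close>

lemma steps_le_iff:
  assumes "a \<le> b"
  shows "(g ^^ j) a \<le> b \<longleftrightarrow> j \<le> steps g a b"
proof -
  have mono: "strict_mono g" and cont: "continuous_on UNIV g" and per: "\<And>x. g (x + 1) = g x + 1"
    using lift by (auto simp: circle_lift_def)
  have "continuous_on {0..1} (\<lambda>x. g x - x)"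
    using cont by (intro continuous_intros) (auto intro: continuous_on_subset)
  then obtain z where "\<forall>x\<in>{0..1}. g z - z \<le> g x - x"
    using continuous_attains_inf[of "{0..1::real}" "\<lambda>x. g x - x"] by auto
  moreover define d where "d = g z - z"
  ultimately have d: "x + d \<le> g x" if "x \<in> {0..1}" for x using that by fastforce
  have "0 < d" using pos by (simp add: d_def)
  have d': "x + d \<le> g x" for x
  proof -
    have "x - of_int \<lfloor>x\<rfloor> \<in> {0..1}" by (auto; linarith)
    from d[OF this] show ?thesis using circle_lift_shift[OF lift, of x "- \<lfloor>x\<rfloor>"] by simp
  qed
  have grow: "a + real j * d \<le> (g ^^ j) a" for j
  proof (induction j)
    case (Suc j) then show ?case using d'[of "(g ^^ j) a"] by (simp add: algebra_simps)
  qed simp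
  have fin: "finite {j. (g ^^ j) a \<le> b}"
  proof (rule finite_subset)
    show "{j. (g ^^ j) a \<le> b} \<subseteq> {..nat \<lceil>(b - a) / d\<rceil>}"
    proof
      fix j assume "j \<in> {j. (g ^^ j) a \<le> b}"
      then have "real j * d \<le> b - a" using grow[of j] by simp
      then have "real j \<le> (b - a) / d" using \<open>0 < d\<close> by (simp add: field_simps)
      then show "j \<in> {..nat \<lceil>(b - a) / d\<rceil>}" by (simp; linarith)
    qed
  qed simp
  have "incseq (\<lambda>j. (g ^^ j) a)"
    using pos by (auto intro!: incseq_SucI less_imp_le)
  then have down: "(g ^^ i) a \<le> (g ^^ j) a" if "i \<le> j" for i j
    using that by (auto simp: incseq_def)
  have "0 \<in> {j. (g ^^ j) a \<le> b}" using assms by simp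
  then have "steps g a b \<in> {j. (g ^^ j) a \<le> b}"
    unfolding steps_def using fin by (intro Max_in) blast+
  then show ?thesis
    using down[of j "steps g a b"] fin by (auto simp: steps_def)
qed

lemma funpow_le: "x \<le> y \<Longrightarrow> (g ^^ j) x \<le> (g ^^ j) y"
proof (induction j)
  case (Suc j)
  then show ?case using lift by (auto simp: circle_lift_def strict_mono_less_eq)
qed simp

text \<open>Starting at \<open>b\<close> instead of at the last iterate of \<open>a\<close> up to
  \<open>b\<close> shifts the start by less than one step of \<open>g\<close>, and this changes the
  count by at most one.\<close>

lemma steps_add:
  assumes "a \<le> b" "b \<le> c"
  shows "steps g a b + steps g b c \<le> steps g a c" "steps g a c \<le> steps g a b + steps g b c + 1"
proof -
  have ac: "a \<le> c" using assms by simp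
  let ?i = "steps g a b" and ?j = "steps g b c"
  have "(g ^^ (?i + ?j)) a = (g ^^ ?j) ((g ^^ ?i) a)" by (metis add.commute comp_apply funpow_add)
  also have "\<dots> \<le> (g ^^ ?j) b"
    using steps_le_iff[OF assms(1), of ?i] by (intro funpow_le) simp
  also have "\<dots> \<le> c" using steps_le_iff[OF assms(2), of ?j] by simp
  finally show "?i + ?j \<le> steps g a c" using steps_le_iff[OF ac] by blast
  have "c < (g ^^ Suc ?j) b"
    using steps_le_iff[OF assms(2), of "Suc ?j"] by simp
  also have "\<dots> \<le> (g ^^ Suc ?j) ((g ^^ Suc ?i) a)"
    using steps_le_iff[OF assms(1), of "Suc ?i"] by (intro funpow_le) simp
  also have "\<dots> = (g ^^ (Suc ?i + Suc ?j)) a" by (metis add.commute comp_apply funpow_add)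
  finally have "\<not> Suc ?i + Suc ?j \<le> steps g a c" using steps_le_iff[OF ac, of "Suc ?i + Suc ?j"] by simp
  then show "steps g a c \<le> ?i + ?j + 1" by simp
qed

lemma steps_lift:
  assumes "strict_mono f" "\<And>x. f (g x) = g (f x)"
  shows "steps g (f a) (f b) = steps g a b"
proof -
  have "(g ^^ j) (f a) = f ((g ^^ j) a)" for j
    by (induction j) (auto simp: assms(2))
  then show ?thesis using assms(1) by (simp add: steps_def strict_mono_less_eq)
qed

lemma steps_shift: "steps g (a + of_int n) (b + of_int n) = steps g a b"
  by (rule steps_lift) (auto simp: strict_mono_def circle_lift_shift[OF lift])

text \<open>After an integer translation \<open>x\<close> is a point \<open>y\<close> of
  \<open>{0..1}\<close>. The intervals from 0 to 1 and from \<open>y\<close> to \<open>y + 1\<close>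
  share the part from \<open>y\<close> to 1, and the remaining parts are translates of each
  other.\<close>

lemma steps_unit: "steps g x (x + 1) \<le> steps g 0 1 + 1" "steps g 0 1 \<le> steps g x (x + 1) + 1"
proof -
  define y where "y = x - of_int \<lfloor>x\<rfloor>"
  have y: "0 \<le> y" "y \<le> 1" unfolding y_def by linarith+
  have sx: "steps g x (x + 1) = steps g y (y + 1)"
    using steps_shift[of x "- \<lfloor>x\<rfloor>" "x + 1"] by (simp add: y_def algebra_simps)
  have s1: "steps g 1 (y + 1) = steps g 0 y" using steps_shift[of 0 1 y] by simp
  show "steps g x (x + 1) \<le> steps g 0 1 + 1" "steps g 0 1 \<le> steps g x (x + 1) + 1"
    using steps_add[of y 1 "y + 1"] steps_add[of 0 y 1] y s1 sx by auto
qed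

lemma steps_bound: "steps g a (a + real N) \<le> N * (steps g 0 1 + 2)"
proof (induction N)
  case 0
  have "\<not> (g ^^ 1) a \<le> a" using pos[of a] by simp
  then show ?case using steps_le_iff[of a a 1] by simp
next
  case (Suc N)
  have "steps g a (a + real (Suc N)) \<le> steps g a (a + real N) + steps g (a + real N) (a + real N + 1) + 1"
    using steps_add(2)[of a "a + real N" "a + real N + 1"] by (simp add: algebra_simps)
  then show ?case using Suc steps_unit(1)[of "a + real N"] by simp
qed

end

lemma eq_if_abs_diff_le:
  fixes a b :: real
  assumes "\<And>e. 0 < e \<Longrightarrow> \<bar>a - b\<bar> \<le> e"
  shows "a = b"
  using field_le_epsilon[of "\<bar>a - b\<bar>" 0] assms by simp

text \<open>The step counts of \<open>g n\<close> are divided by the count on the unit interval.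
  That count tends to infinity because of the condition on \<open>y\<close>, so the additive error 1
  disappears in the limit and \<open>L\<close> is a finitely additive measure of intervals. Maps
  that commute with all \<open>g n\<close> preserve \<open>L\<close>, and thus change its
  distribution function \<open>F\<close> by a constant only.\<close>

lemma quasi_invariant_height:
  assumes \<Phi>: "\<And>f. f \<in> \<Phi> \<Longrightarrow> strict_mono f"
    and g: "\<And>n. circle_lift (g n)" "\<And>n x. x < g n x" "\<And>n. y n \<in> {0..1}" "\<And>n. (g n ^^ n) (y n) \<le> y n + 1"
    and comm: "\<And>f n x. f \<in> \<Phi> \<Longrightarrow> f (g n x) = g n (f x)"
  shows "\<exists>F. mono F \<and> (\<forall>x. F (x + 1) = F x + 1) \<and> (\<forall>f\<in>\<Phi>. \<exists>c. \<forall>x. F (f x) = F x + (c::real))"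
proof -
  \<comment> \<open>The index shift by 2 pays for the error 1 made in passing from the interval at
    \<open>y\<close> to the one at 0 and leaves a count of at least \<open>n + 1\<close>, which is
    positive.\<close>
  let ?s = "\<lambda>n. steps (g (n + 2))"
  have s01: "n + 1 \<le> ?s n 0 1" for n
  proof -
    have "n + 2 \<le> ?s n (y (n + 2)) (y (n + 2) + 1)"
      using steps_le_iff[OF g(1,2), of "y (n+2)" "y (n+2) + 1" "n + 2" "n + 2"] g(4)[of "n + 2"] by simp
    then show ?thesis using steps_unit(1)[OF g(1,2), of "n + 2" "y (n+2)"] by linarith
  qed
  define u where "u n p = (if fst p \<le> snd p then real (?s n (fst p) (snd p)) / real (?s n 0 1) else 0)" for n p
  \<comment> \<open>The factor 3 absorbs the summand 2 of \<open>steps_bound\<close>, because the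
    count on the unit interval is at least 1.\<close>
  have ub: "\<bar>u n p\<bar> \<le> 3 * real (nat \<lceil>snd p - fst p\<rceil>)" for n p
  proof (cases "fst p \<le> snd p")
    case True
    define N where "N = nat \<lceil>snd p - fst p\<rceil>"
    have N: "snd p \<le> fst p + real N" using True unfolding N_def by linarith
    have "?s n (fst p) (snd p) \<le> ?s n (fst p) (fst p + real N)"
      using steps_add(1)[OF g(1,2) True N, of "n + 2"] by linarith
    also have "\<dots> \<le> N * (?s n 0 1 + 2)" using steps_bound[OF g(1,2)] .
    also have "\<dots> \<le> N * (3 * ?s n 0 1)" using s01[of n] by (intro mult_left_mono) auto
    finally have "real (?s n (fst p) (snd p)) \<le> 3 * real N * real (?s n 0 1)"
      by (subst (asm) of_nat_le_iff[where 'a = real, symmetric]) (simp add: mult_ac)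
    then show ?thesis
      using True s01[of n] by (simp add: u_def N_def field_simps)
  qed (simp add: u_def)
  obtain L where L: "\<And>I e N. finite I \<Longrightarrow> 0 < e \<Longrightarrow> \<exists>n\<ge>N. \<forall>i\<in>I. \<bar>u n i - L i\<bar> < e"
    using bounded_sequence_cluster[of u, OF ub] by blast
  have add: "L (a, c) = L (a, b) + L (b, c)" if "a \<le> b" "b \<le> c" for a b c
  proof -
    have un: "\<bar>u n (a, c) - u n (a, b) - u n (b, c)\<bar> \<le> 1 / real (n + 1)" for n
    proof -
      have "u n (a, c) - u n (a, b) - u n (b, c) = (real (?s n a c) - real (?s n a b) - real (?s n b c)) / real (?s n 0 1)"
        using that by (simp add: u_def diff_divide_distrib)
      moreover have "\<bar>real (?s n a c) - real (?s n a b) - real (?s n b c)\<bar> \<le> 1"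
        using steps_add[OF g(1,2) that, of "n + 2"] by linarith
      moreover have "1 / real (?s n 0 1) \<le> 1 / real (n + 1)"
        using s01[of n] by (intro divide_left_mono) auto
      ultimately show ?thesis
        using s01[of n] by (auto simp: abs_divide intro!: order_trans[OF divide_right_mono[of _ 1]])
    qed
    have "\<bar>L (a, c) - L (a, b) - L (b, c)\<bar> \<le> e" if e: "0 < e" for e
    proof -
      have "0 < e / 4" using e by simp
      then obtain N where N: "1 / real (Suc N) < e / 4"
        by (rule nat_approx_posE)
      obtain n where "n \<ge> N" "\<forall>i\<in>{(a,c),(a,b),(b,c)}. \<bar>u n i - L i\<bar> < e / 4"
        using L[of "{(a,c),(a,b),(b,c)}" "e/4" N] e by auto
      moreover have "1 / real (n + 1) \<le> 1 / real (Suc N)"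
        using \<open>n \<ge> N\<close> by (intro divide_left_mono) auto
      ultimately have "\<bar>u n (a,c) - L (a,c)\<bar> < e / 4" "\<bar>u n (a,b) - L (a,b)\<bar> < e / 4"
        "\<bar>u n (b,c) - L (b,c)\<bar> < e / 4" "1 / real (n + 1) < e / 4"
        using N by auto
      then show ?thesis using un[of n] by linarith
    qed
    then have "\<bar>L (a, c) - (L (a, b) + L (b, c))\<bar> \<le> e" if e: "0 < e" for e
      using that by (simp add: diff_diff_eq)
    then show ?thesis by (rule eq_if_abs_diff_le)
  qed
  have unit: "L (a, a + 1) = 1" for a
  proof -
    have un: "\<bar>u n (a, a + 1) - 1\<bar> \<le> 1 / real (n + 1)" for n
    proof -
      have "u n (a, a + 1) - 1 = (real (?s n a (a + 1)) - real (?s n 0 1)) / real (?s n 0 1)"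
        using s01[of n] by (simp add: u_def diff_divide_distrib)
      moreover have "\<bar>real (?s n a (a + 1)) - real (?s n 0 1)\<bar> \<le> 1"
        using steps_unit[OF g(1,2), of "n + 2" a] by linarith
      moreover have "1 / real (?s n 0 1) \<le> 1 / real (n + 1)"
        using s01[of n] by (intro divide_left_mono) auto
      ultimately show ?thesis
        using s01[of n] by (auto simp: abs_divide intro!: order_trans[OF divide_right_mono[of _ 1]])
    qed
    have "\<bar>L (a, a + 1) - 1\<bar> \<le> e" if e: "0 < e" for e
    proof -
      have "0 < e / 2" using e by simp
      then obtain N where N: "1 / real (Suc N) < e / 2"
        by (rule nat_approx_posE)
      obtain n where "n \<ge> N" "\<forall>i\<in>{(a,a+1)}. \<bar>u n i - L i\<bar> < e / 2"
        using L[of "{(a,a+1)}" "e/2" N] e by auto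
      moreover have "1 / real (n + 1) \<le> 1 / real (Suc N)"
        using \<open>n \<ge> N\<close> by (intro divide_left_mono) auto
      ultimately have "\<bar>u n (a,a+1) - L (a,a+1)\<bar> < e / 2" "1 / real (n + 1) < e / 2"
        using N by auto
      then show ?thesis using un[of n] by linarith
    qed
    then show ?thesis by (rule eq_if_abs_diff_le)
  qed
  have nonneg: "0 \<le> L p" for p
  proof (rule ccontr)
    assume "\<not> 0 \<le> L p"
    then obtain n where "\<bar>u n p - L p\<bar> < - L p" using L[of "{p}" "- L p" 0] by auto
    moreover have "0 \<le> u n p" by (simp add: u_def)
    ultimately show False by simp
  qed
  have inv: "L (f a, f b) = L (a, b)" if f: "f \<in> \<Phi>" and "a \<le> b" for f a b
  proof -
    have un: "u n (f a, f b) = u n (a, b)" for n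
      using steps_lift[OF g(1,2) \<Phi>[OF f], of "n + 2"] comm[OF f] that \<Phi>[OF f]
      by (simp add: u_def strict_mono_less_eq)
    have "\<bar>L (f a, f b) - L (a, b)\<bar> \<le> e" if e: "0 < e" for e
    proof -
      obtain n where "\<forall>i\<in>{(a,b),(f a, f b)}. \<bar>u n i - L i\<bar> < e / 2"
        using L[of "{(a,b),(f a, f b)}" "e/2" 0] e by auto
      then have "\<bar>u n (a,b) - L (a,b)\<bar> < e / 2" "\<bar>u n (f a, f b) - L (f a, f b)\<bar> < e / 2"
        by auto
      then show ?thesis using un[of n] by linarith
    qed
    then show ?thesis by (rule eq_if_abs_diff_le)
  qed
  define F where "F x = (if 0 \<le> x then L (0, x) else - L (x, 0))" for x
  have FL: "F b - F a = L (a, b)" if "a \<le> b" for a b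
    using that add[of 0 a b] add[of a 0 b] add[of a b 0] by (auto simp: F_def)
  have "mono F" using FL nonneg by (intro monoI) (metis diff_ge_0_iff_ge)
  moreover have "F (x + 1) = F x + 1" for x using FL[of x "x + 1"] unit[of x] by simp
  moreover have "\<exists>c. \<forall>x. F (f x) = F x + c" if f: "f \<in> \<Phi>" for f
  proof -
    have "F (f y) - F (f x) = F y - F x" if "x \<le> y" for x y
      using FL[of x y] FL[of "f x" "f y"] inv[OF f that] that \<Phi>[OF f] by (simp add: strict_mono_less_eq)
    then have "F (f x) - F x = F (f 0) - F 0" for x
      by (smt (verit))
    then show ?thesis by (intro exI[of _ "F (f 0) - F 0"]) (metis add.commute diff_add_cancel)
  qed
  ultimately show ?thesis by blast
qed

theorem commuting_lift_groups:
  assumes \<Phi>: "lift_group \<Phi>" and \<Psi>: "lift_group \<Psi>"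
    and comm: "\<And>f g x. f \<in> \<Phi> \<Longrightarrow> g \<in> \<Psi> \<Longrightarrow> f (g x) = g (f x)"
  obtains E where "E \<noteq> {}" "finite (E \<inter> {0..1})" "\<And>f x. f \<in> \<Phi> \<Longrightarrow> x \<in> E \<Longrightarrow> f x \<in> E"
  | E where "E \<noteq> {}" "finite (E \<inter> {0..1})" "\<And>f x. f \<in> \<Psi> \<Longrightarrow> x \<in> E \<Longrightarrow> f x \<in> E"
  | F :: "real \<Rightarrow> real" where "mono F" "\<And>x. F (x + 1) = F x + 1" "\<And>f. f \<in> \<Phi> \<Longrightarrow> \<exists>c. \<forall>x. F (f x) = F x + c"
proof (cases "\<exists>A B. inv_closed \<Phi> A \<and> inv_closed \<Phi> B \<and> A \<inter> B = {}")
  case True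
  then show thesis
    using disjoint_inv_closed_imp_discrete[OF \<Phi>] that(1) by metis
next
  case False
  \<comment> \<open>As no two closed invariant sets are disjoint, there is a least one and not
    merely a minimal one. It therefore lies in every nonempty closed invariant set, in particular in
    nonempty fixed point sets of members of \<open>\<Psi>\<close>.\<close>
  define M where "M = \<Inter>{A. inv_closed \<Phi> A}"
  have M: "inv_closed \<Phi> M"
    unfolding M_def using False by (intro inv_closed_Inter_nonempty \<Phi>) auto
  then obtain x0 where x0: "x0 \<in> M" by (auto simp: inv_closed_def)
  define Orb where "Orb = {k x0 |k. k \<in> \<Psi>}"
  show thesis
  proof (cases "finite (Orb \<inter> {0..1})")
    case True
    have "f x \<in> Orb" if "f \<in> \<Psi>" "x \<in> Orb" for f x
    proof -
      obtain k where "k \<in> \<Psi>" "x = k x0" using \<open>x \<in> Orb\<close> by (auto simp: Orb_def)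
      moreover have "f \<circ> k \<in> \<Psi>" using \<Psi> that calculation by (auto simp: lift_group_def)
      ultimately show ?thesis by (auto simp: Orb_def intro!: exI[of _ "f \<circ> k"])
    qed
    moreover have "Orb \<noteq> {}" using \<Psi> by (auto simp: Orb_def lift_group_def)
    ultimately show thesis using that(2) True by blast
  next
    case False
    have "\<exists>g\<in>\<Psi>. \<exists>y\<in>{0..1}. (\<forall>x. x < g x) \<and> (g ^^ n) y \<le> y + 1" for n
    proof (rule small_positive_lift[where \<Phi> = \<Phi> and M = M and ?x0.0 = x0])
      show "M \<subseteq> A" if "inv_closed \<Phi> A" for A using that by (auto simp: M_def)
    qed (use False \<Phi> \<Psi> comm M x0 in \<open>auto simp: Orb_def\<close>)
    then obtain g y where g: "\<And>n. g n \<in> \<Psi>" "\<And>n. y n \<in> {0..1}" "\<And>n x. x < g n x" "\<And>n. (g n ^^ n) (y n) \<le> y n + 1"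
      by metis
    have "\<exists>F. mono F \<and> (\<forall>x. F (x + 1) = F x + 1) \<and> (\<forall>f\<in>\<Phi>. \<exists>c. \<forall>x. F (f x) = F x + (c::real))"
    proof (rule quasi_invariant_height[of \<Phi> g y])
      show "f (g n x) = g n (f x)" if "f \<in> \<Phi>" for f n x
        by (rule comm[OF that g(1)])
    qed (use g \<Phi> \<Psi> in \<open>auto simp: lift_group_def circle_lift_def\<close>)
    then show thesis using that(3) by blast
  qed
qed

section \<open>Invariant charges\<close>

definition borel_sets_of :: "'a topology \<Rightarrow> 'a set set" where
  "borel_sets_of X = sigma_sets (topspace X) {U. openin X U}"

definition charge :: "'a topology \<Rightarrow> ('a set \<Rightarrow> real) \<Rightarrow> bool" where
  "charge X \<nu> \<longleftrightarrow> (\<forall>E\<in>borel_sets_of X. 0 \<le> \<nu> E) \<and> \<nu> (topspace X) = 1 \<and>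
     (\<forall>E\<in>borel_sets_of X. \<forall>F\<in>borel_sets_of X. E \<inter> F = {} \<longrightarrow> \<nu> (E \<union> F) = \<nu> E + \<nu> F)"

text \<open>Images are used because they depend only on the values of the maps on the space, whereas
  preimages under total functions could contain points outside.\<close>

definition inv_charge :: "('a \<Rightarrow> 'a) set \<Rightarrow> 'a topology \<Rightarrow> ('a set \<Rightarrow> real) \<Rightarrow> bool" where
  "inv_charge \<Gamma> X \<nu> \<longleftrightarrow> charge X \<nu> \<and> (\<forall>f\<in>\<Gamma>. \<forall>E\<in>borel_sets_of X. \<nu> (f ` E) = \<nu> E)"

lemma sigma_algebra_borel_sets_of: "sigma_algebra (topspace X) (borel_sets_of X)"
  unfolding borel_sets_of_def by (rule sigma_algebra_sigma_sets) (auto dest: openin_subset)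

lemma borel_sets_of_open: "openin X U \<Longrightarrow> U \<in> borel_sets_of X"
  by (auto simp: borel_sets_of_def)

lemma borel_sets_of_topspace: "topspace X \<in> borel_sets_of X"
  by (simp add: borel_sets_of_open)

lemma borel_sets_of_empty: "{} \<in> borel_sets_of X"
  by (simp add: borel_sets_of_open)

lemma borel_sets_of_Diff:
  assumes "E \<in> borel_sets_of X" "F \<in> borel_sets_of X"
  shows "E - F \<in> borel_sets_of X"
proof -
  interpret sigma_algebra "topspace X" "borel_sets_of X" by (rule sigma_algebra_borel_sets_of)
  show ?thesis using assms by (rule Diff)
qed

lemma borel_sets_of_Un:
  assumes "E \<in> borel_sets_of X" "F \<in> borel_sets_of X"
  shows "E \<union> F \<in> borel_sets_of X"
proof -
  interpret sigma_algebra "topspace X" "borel_sets_of X" by (rule sigma_algebra_borel_sets_of)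
  show ?thesis using assms by (rule Un)
qed

lemma borel_sets_of_subset: "E \<in> borel_sets_of X \<Longrightarrow> E \<subseteq> topspace X"
  using sigma_sets_into_sp[of "{U. openin X U}" "topspace X" E] openin_subset
  by (fastforce simp: borel_sets_of_def)

lemma borel_sets_of_closed: "closedin X C \<Longrightarrow> C \<in> borel_sets_of X"
  using borel_sets_of_Diff[OF borel_sets_of_topspace borel_sets_of_open, of X "topspace X - C"]
  by (auto simp: closedin_def double_diff)

lemma borel_sets_of_image:
  assumes "homeomorphic_map X Y f" "E \<in> borel_sets_of X"
  shows "f ` E \<in> borel_sets_of Y"
proof -
  have inj: "inj_on f (topspace X)" and surj: "f ` topspace X = topspace Y"
    using assms(1) by (auto simp: homeomorphic_eq_everything_map)
  have sub: "E \<subseteq> topspace X" if "E \<in> sigma_sets (topspace X) {U. openin X U}" for E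
    using borel_sets_of_subset that by (auto simp: borel_sets_of_def)
  show ?thesis
    using assms(2) unfolding borel_sets_of_def
  proof (induction E rule: sigma_sets.induct)
    case (Basic U)
    then show ?case
      using homeomorphic_map_openness_eq[OF assms(1)] by blast
  next
    case (Compl E)
    then have "f ` (topspace X - E) = topspace Y - f ` E"
      using inj_on_image_set_diff[OF inj, of "topspace X" E] surj sub[of E] by auto
    then show ?case using Compl by (simp add: sigma_sets.Compl)
  next
    case (Union A)
    then show ?case by (simp add: image_UN sigma_sets.Union)
  qed (simp add: sigma_sets.Empty)
qed

lemma charge_empty: "charge X \<nu> \<Longrightarrow> \<nu> {} = 0"
  unfolding charge_def using borel_sets_of_empty by fastforce

lemma charge_mono:
  assumes "charge X \<nu>" "E \<in> borel_sets_of X" "F \<in> borel_sets_of X" "E \<subseteq> F"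
  shows "\<nu> E \<le> \<nu> F"
proof -
  have "E \<union> (F - E) = F" using assms(4) by blast
  moreover have "\<nu> (E \<union> (F - E)) = \<nu> E + \<nu> (F - E)" "0 \<le> \<nu> (F - E)"
    using assms borel_sets_of_Diff[OF assms(3,2)] unfolding charge_def by blast+
  ultimately show ?thesis by simp
qed

lemma charge_le_1: "charge X \<nu> \<Longrightarrow> E \<in> borel_sets_of X \<Longrightarrow> \<nu> E \<le> 1"
  using charge_mono[of X \<nu> E "topspace X"] borel_sets_of_topspace[of X] borel_sets_of_subset[of E X]
  by (simp add: charge_def)

lemma charge_Un_le:
  assumes "charge X \<nu>" "E \<in> borel_sets_of X" "F \<in> borel_sets_of X"
  shows "\<nu> (E \<union> F) \<le> \<nu> E + \<nu> F"
proof -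
  have "E \<union> F = E \<union> (F - E)" by blast
  moreover have "\<nu> (E \<union> (F - E)) = \<nu> E + \<nu> (F - E)"
    using assms borel_sets_of_Diff[OF assms(3,2)] unfolding charge_def by blast
  moreover have "\<nu> (F - E) \<le> \<nu> F"
    using assms borel_sets_of_Diff[OF assms(3,2)] by (intro charge_mono[OF assms(1)]) auto
  ultimately show ?thesis by simp
qed

section \<open>Averaging a charge over a coset space\<close>

text \<open>All multiples of a difference that vanishes on \<open>S\<close>, also the negative ones,
  are nonnegative on \<open>S\<close>. Positivity thus forces the mean of the difference to be
  zero.\<close>

lemma is_mean_on_cong:
  assumes m: "is_mean_on S m" and f: "bounded_fun_on S f" and fg: "\<And>s. s \<in> S \<Longrightarrow> f s = g s"
  shows "m f = m g"
proof -
  have g: "bounded_fun_on S g"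
    using f fg by (simp add: bounded_fun_on_def cong: image_cong)
  have z: "bounded_fun_on S (\<lambda>s. c * (f s - g s))" for c
    using fg by (auto simp: bounded_fun_on_def bounded_iff)
  have z1: "bounded_fun_on S (\<lambda>s. f s - g s)"
    using z[of 1] by simp
  have "0 \<le> m (\<lambda>s. c * (f s - g s))" for c
    using m z[of c] fg by (auto simp: is_mean_on_def)
  moreover have "m (\<lambda>s. c * (f s - g s)) = c * m (\<lambda>s. f s - g s)" for c
    using m z[of 1] by (simp add: is_mean_on_def)
  ultimately have "0 \<le> c * m (\<lambda>s. f s - g s)" for c
    by metis
  from this[of 1] this[of "-1"] have "m (\<lambda>s. f s - g s) = 0"
    by simp
  moreover have "m (\<lambda>s. g s + (f s - g s)) = m g + m (\<lambda>s. f s - g s)"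
    using m g z1 unfolding is_mean_on_def by blast
  ultimately show ?thesis by simp
qed

text \<open>The value of \<open>\<nu>\<close> at the translate of \<open>E\<close> by the inverse of
  \<open>a\<close> depends only on the left coset of \<open>a\<close>, because \<open>\<nu>\<close>
  is invariant under \<open>H\<close>. Its mean over the cosets is the new charge. Translating
  \<open>E\<close> by \<open>g\<close> amounts to translating the coset by the inverse of
  \<open>g\<close>, which does not affect the mean.\<close>

theorem inv_charge_coamenable:
  fixes G :: "('g, 'm) monoid_scheme"
  assumes "group G" and co: "coamenable H G" and act: "action_by_homeomorphisms G X \<phi>"
    and \<nu>: "inv_charge (\<phi> ` H) X \<nu>"
  shows "\<exists>\<nu>'. inv_charge (\<phi> ` carrier G) X \<nu>'"
proof -
  interpret group G by fact
  interpret group_action G "topspace X" \<phi>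
    using act by (simp add: action_by_homeomorphisms_def)
  obtain m where H: "subgroup H G" and m: "is_mean_on (lcosets\<^bsub>G\<^esub> H) m" and
    minv: "\<And>g f. g \<in> carrier G \<Longrightarrow> bounded_fun_on (lcosets\<^bsub>G\<^esub> H) f \<Longrightarrow> m (\<lambda>C. f (g <#\<^bsub>G\<^esub> C)) = m f"
    using co unfolding coamenable_def by blast
  have ch: "charge X \<nu>" and inv: "\<And>h E. h \<in> H \<Longrightarrow> E \<in> borel_sets_of X \<Longrightarrow> \<nu> (\<phi> h ` E) = \<nu> E"
    using \<nu> by (auto simp: inv_charge_def)
  have homeo: "homeomorphic_map X X (\<phi> g)" if "g \<in> carrier G" for g
    using act that by (simp add: action_by_homeomorphisms_def)
  have bim: "\<phi> g ` E \<in> borel_sets_of X" if "g \<in> carrier G" "E \<in> borel_sets_of X" for g E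
    using borel_sets_of_image[OF homeo] that by blast
  have comp: "\<phi> (g \<otimes>\<^bsub>G\<^esub> h) ` E = \<phi> g ` (\<phi> h ` E)" if "g \<in> carrier G" "h \<in> carrier G" "E \<in> borel_sets_of X" for g h E
    using borel_sets_of_subset[OF that(3)] composition_rule that by (force simp: image_image)
  let ?C = "lcosets\<^bsub>G\<^esub> H"
  \<comment> \<open>A representative of the coset is chosen arbitrarily; the next fact shows that
    the choice has no effect on Borel sets.\<close>
  define f where "f E C = \<nu> (\<phi> (inv\<^bsub>G\<^esub> (SOME a. a \<in> C)) ` E)" for E C
  have f: "f E (a <#\<^bsub>G\<^esub> H) = \<nu> (\<phi> (inv\<^bsub>G\<^esub> a) ` E)" if a: "a \<in> carrier G" and E: "E \<in> borel_sets_of X" for a E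
  proof -
    have "a \<in> a <#\<^bsub>G\<^esub> H" by (rule lcos_self[OF a H])
    then have "(SOME b. b \<in> a <#\<^bsub>G\<^esub> H) \<in> a <#\<^bsub>G\<^esub> H" by (rule someI)
    then obtain h where h: "h \<in> H" "(SOME b. b \<in> a <#\<^bsub>G\<^esub> H) = a \<otimes>\<^bsub>G\<^esub> h"
      by (auto simp: l_coset_def)
    have hc: "h \<in> carrier G" "inv\<^bsub>G\<^esub> h \<in> H"
      using subgroup.mem_carrier[OF H h(1)] subgroup.m_inv_closed[OF H h(1)] by auto
    have "\<phi> (inv\<^bsub>G\<^esub> (a \<otimes>\<^bsub>G\<^esub> h)) ` E = \<phi> (inv\<^bsub>G\<^esub> h) ` (\<phi> (inv\<^bsub>G\<^esub> a) ` E)"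
      using comp[of "inv\<^bsub>G\<^esub> h" "inv\<^bsub>G\<^esub> a" E] a hc E by (simp add: inv_mult_group)
    then show ?thesis
      using inv[OF hc(2) bim[of "inv\<^bsub>G\<^esub> a" E]] a E h(2) by (simp add: f_def)
  qed
  have coset: "\<exists>a\<in>carrier G. C = a <#\<^bsub>G\<^esub> H" if "C \<in> ?C" for C
    using that by (auto simp: LCOSETS_def)
  have f01: "0 \<le> f E C \<and> f E C \<le> 1" if C: "C \<in> ?C" and E: "E \<in> borel_sets_of X" for C E
  proof -
    obtain a where a: "a \<in> carrier G" "C = a <#\<^bsub>G\<^esub> H" using coset[OF C] by blast
    then have "\<phi> (inv\<^bsub>G\<^esub> a) ` E \<in> borel_sets_of X" using bim E by simp
    then show ?thesis
      using f[OF a(1) E] a(2) ch charge_le_1[OF ch] by (auto simp: charge_def)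
  qed
  have bd: "bounded_fun_on ?C (f E)" if "E \<in> borel_sets_of X" for E
    unfolding bounded_fun_on_def bounded_iff using f01[OF _ that] by (intro exI[of _ 1]) auto
  have "inv_charge (\<phi> ` carrier G) X (\<lambda>E. m (f E))"
    unfolding inv_charge_def charge_def
  proof (intro conjI ballI impI)
    fix E assume E: "E \<in> borel_sets_of X"
    show "0 \<le> m (f E)" using m bd[OF E] f01[OF _ E] by (auto simp: is_mean_on_def)
    fix F assume F: "F \<in> borel_sets_of X" and EF: "E \<inter> F = {}"
    have "f (E \<union> F) C = f E C + f F C" if C: "C \<in> ?C" for C
    proof -
      obtain a where a: "a \<in> carrier G" "C = a <#\<^bsub>G\<^esub> H" using coset[OF C] by blast
      have inj: "inj_on (\<phi> (inv\<^bsub>G\<^esub> a)) (topspace X)"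
        using homeo[of "inv\<^bsub>G\<^esub> a"] a(1) by (auto simp: homeomorphic_eq_everything_map)
      have "\<phi> (inv\<^bsub>G\<^esub> a) ` E \<inter> \<phi> (inv\<^bsub>G\<^esub> a) ` F = {}"
        by (subst inj_on_image_Int[OF inj borel_sets_of_subset[OF E] borel_sets_of_subset[OF F], symmetric])
          (simp add: EF)
      moreover have "\<phi> (inv\<^bsub>G\<^esub> a) ` E \<in> borel_sets_of X" "\<phi> (inv\<^bsub>G\<^esub> a) ` F \<in> borel_sets_of X"
        using a bim E F by auto
      ultimately show ?thesis
        using f[OF a(1)] a(2) E F borel_sets_of_Un[OF E F] ch by (simp add: image_Un charge_def)
    qed
    then have "m (f (E \<union> F)) = m (\<lambda>C. f E C + f F C)"
      by (intro is_mean_on_cong[OF m bd[OF borel_sets_of_Un[OF E F]]])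
    then show "m (f (E \<union> F)) = m (f E) + m (f F)"
      using m bd[OF E] bd[OF F] by (auto simp: is_mean_on_def)
  next
    have "f (topspace X) C = 1" if C: "C \<in> ?C" for C
    proof -
      obtain a where a: "a \<in> carrier G" "C = a <#\<^bsub>G\<^esub> H" using coset[OF C] by blast
      then show ?thesis
        using f[OF a(1) borel_sets_of_topspace] surj_prop[of "inv\<^bsub>G\<^esub> a"] ch by (simp add: charge_def)
    qed
    then have "m (f (topspace X)) = m (\<lambda>C. 1)"
      by (intro is_mean_on_cong[OF m bd[OF borel_sets_of_topspace]])
    then show "m (f (topspace X)) = 1" using m by (simp add: is_mean_on_def)
  next
    fix g' E assume "g' \<in> \<phi> ` carrier G" and E: "E \<in> borel_sets_of X"
    then obtain g where g: "g \<in> carrier G" "g' = \<phi> g" by blast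
    have "f (\<phi> g ` E) C = f E (inv\<^bsub>G\<^esub> g <#\<^bsub>G\<^esub> C)" if C: "C \<in> ?C" for C
    proof -
      obtain a where a: "a \<in> carrier G" "C = a <#\<^bsub>G\<^esub> H" using coset[OF C] by blast
      have "inv\<^bsub>G\<^esub> g <#\<^bsub>G\<^esub> C = (inv\<^bsub>G\<^esub> g \<otimes>\<^bsub>G\<^esub> a) <#\<^bsub>G\<^esub> H"
        using a g H by (simp add: lcos_m_assoc subgroup.subset)
      moreover have "inv\<^bsub>G\<^esub> (inv\<^bsub>G\<^esub> g \<otimes>\<^bsub>G\<^esub> a) = inv\<^bsub>G\<^esub> a \<otimes>\<^bsub>G\<^esub> g"
        using a g by (simp add: inv_mult_group)
      ultimately show ?thesis
        using f[OF a(1) bim[OF g(1) E]] f[of "inv\<^bsub>G\<^esub> g \<otimes>\<^bsub>G\<^esub> a" E] a g E comp[of "inv\<^bsub>G\<^esub> a" g E] by simp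
    qed
    then have "m (f (\<phi> g ` E)) = m (\<lambda>C. f E (inv\<^bsub>G\<^esub> g <#\<^bsub>G\<^esub> C))"
      by (intro is_mean_on_cong[OF m bd[OF bim[OF g(1) E]]])
    then show "m (f (g' ` E)) = m (f E)"
      using minv[of "inv\<^bsub>G\<^esub> g" "f E"] g bd[OF E] by simp
  qed
  then show ?thesis by blast
qed

section \<open>Regularisation of a charge to a measure\<close>

text \<open>
  A finitely additive charge is made countably additive by regularisation from closed to open sets
  and from open sets to arbitrary ones. This is canonical, hence preserves invariance.
\<close>

definition inner_open :: "'a topology \<Rightarrow> ('a set \<Rightarrow> real) \<Rightarrow> 'a set \<Rightarrow> ennreal" where
  "inner_open X \<nu> V = (SUP C\<in>{C. closedin X C \<and> C \<subseteq> V}. ennreal (\<nu> C))"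

definition regular_outer :: "'a topology \<Rightarrow> ('a set \<Rightarrow> real) \<Rightarrow> 'a set \<Rightarrow> ennreal" where
  "regular_outer X \<nu> E = (INF V\<in>{V. openin X V \<and> E \<subseteq> V}. inner_open X \<nu> V)"

context
  fixes X :: "'a topology" and \<nu> :: "'a set \<Rightarrow> real"
  assumes ch: "charge X \<nu>" and compact: "compact_space X" and normal: "normal_space X"
begin

lemma inner_open_upper: "closedin X C \<Longrightarrow> C \<subseteq> V \<Longrightarrow> ennreal (\<nu> C) \<le> inner_open X \<nu> V"
  unfolding inner_open_def by (rule SUP_upper) auto

lemma inner_open_topspace: "inner_open X \<nu> (topspace X) = 1"
proof (rule antisym)
  show "inner_open X \<nu> (topspace X) \<le> 1"
    unfolding inner_open_def using charge_le_1[OF ch borel_sets_of_closed] by (auto intro!: SUP_least)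
  show "1 \<le> inner_open X \<nu> (topspace X)"
    using inner_open_upper[of "topspace X" "topspace X"] ch by (simp add: charge_def)
qed

lemma inner_open_empty: "inner_open X \<nu> {} = 0"
proof -
  have "{C. closedin X C \<and> C \<subseteq> {}} = {{}}" by auto
  then show ?thesis using charge_empty[OF ch] by (simp add: inner_open_def)
qed

text \<open>Normality divides a closed subset of \<open>V \<union> W\<close> into two closed sets,
  one in \<open>V\<close> and one in \<open>W\<close>, to which finite subadditivity of the charge
  applies.\<close>

lemma inner_open_Un_le:
  assumes "openin X V" "openin X W"
  shows "inner_open X \<nu> (V \<union> W) \<le> inner_open X \<nu> V + inner_open X \<nu> W"
  unfolding inner_open_def[of X \<nu> "V \<union> W"]
proof (rule SUP_least)
  fix C assume "C \<in> {C. closedin X C \<and> C \<subseteq> V \<union> W}"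
  then have C: "closedin X C" "C \<subseteq> V \<union> W" by auto
  have "closedin X (C - V)" "closedin X (C - W)" "disjnt (C - V) (C - W)"
    using C assms by (auto simp: closedin_diff disjnt_def)
  then obtain P Q where PQ: "openin X P" "openin X Q" "C - V \<subseteq> P" "C - W \<subseteq> Q" "disjnt P Q"
    using normal unfolding normal_space_def by meson
  have cl: "closedin X (C - P)" "closedin X (C - Q)"
    using C PQ by (auto simp: closedin_diff)
  have "C = (C - P) \<union> (C - Q)" using PQ by (auto simp: disjnt_def)
  then have "\<nu> C \<le> \<nu> (C - P) + \<nu> (C - Q)"
    using charge_Un_le[OF ch cl[THEN borel_sets_of_closed]] by simp
  moreover have "0 \<le> \<nu> (C - P)" "0 \<le> \<nu> (C - Q)"
    using cl[THEN borel_sets_of_closed] ch by (auto simp: charge_def)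
  ultimately have "ennreal (\<nu> C) \<le> ennreal (\<nu> (C - P)) + ennreal (\<nu> (C - Q))"
    by (simp add: ennreal_leI flip: ennreal_plus)
  also have "\<dots> \<le> inner_open X \<nu> V + inner_open X \<nu> W"
    using cl PQ C by (intro add_mono inner_open_upper) auto
  finally show "ennreal (\<nu> C) \<le> inner_open X \<nu> V + inner_open X \<nu> W" .
qed

text \<open>Compactness creates the countable subadditivity that the charge itself may lack: a
  closed subset of the union lies in a finite subunion.\<close>

lemma inner_open_UN_le:
  fixes V :: "nat \<Rightarrow> 'a set"
  assumes "\<And>n. openin X (V n)"
  shows "inner_open X \<nu> (\<Union>n. V n) \<le> (\<Sum>n. inner_open X \<nu> (V n))"
  unfolding inner_open_def[of X \<nu> "\<Union>n. V n"]
proof (rule SUP_least)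
  have fin: "inner_open X \<nu> (\<Union>n<N. V n) \<le> (\<Sum>n<N. inner_open X \<nu> (V n))" for N
  proof (induction N)
    case (Suc N)
    have "openin X (\<Union>n<N. V n)" using assms by blast
    then have "inner_open X \<nu> (\<Union>n<Suc N. V n) \<le> inner_open X \<nu> (\<Union>n<N. V n) + inner_open X \<nu> (V N)"
      using inner_open_Un_le[of "\<Union>n<N. V n" "V N"] assms by (simp add: lessThan_Suc Un_commute)
    also have "\<dots> \<le> (\<Sum>n<Suc N. inner_open X \<nu> (V n))"
      using Suc by (simp add: add_mono)
    finally show ?case .
  qed (simp add: inner_open_empty)
  fix C assume "C \<in> {C. closedin X C \<and> C \<subseteq> (\<Union>n. V n)}"
  then have C: "closedin X C" "C \<subseteq> (\<Union>n. V n)" by auto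
  then have "compactin X C" using closedin_compact_space compact by blast
  then obtain \<F> where \<F>: "finite \<F>" "\<F> \<subseteq> range V" "C \<subseteq> \<Union>\<F>"
    using C(2) assms unfolding compactin_def by (smt (verit) UNIV_I imageE)
  then obtain I where I: "finite I" "\<F> = V ` I" by (metis finite_subset_image)
  then obtain N where "I \<subseteq> {..<N}" using finite_nat_iff_bounded by auto
  then have "C \<subseteq> (\<Union>n<N. V n)" using \<F> I by blast
  then have "ennreal (\<nu> C) \<le> inner_open X \<nu> (\<Union>n<N. V n)"
    using inner_open_upper[OF C(1)] by blast
  also have "\<dots> \<le> (\<Sum>n<N. inner_open X \<nu> (V n))" by (rule fin)
  also have "\<dots> \<le> (\<Sum>n. inner_open X \<nu> (V n))" by (rule sum_le_suminf) auto
  finally show "ennreal (\<nu> C) \<le> (\<Sum>n. inner_open X \<nu> (V n))" .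
qed

lemma regular_outer_le: "openin X V \<Longrightarrow> E \<subseteq> V \<Longrightarrow> regular_outer X \<nu> E \<le> inner_open X \<nu> V"
  unfolding regular_outer_def by (rule INF_lower) auto

lemma regular_outer_mono: "E \<subseteq> F \<Longrightarrow> regular_outer X \<nu> E \<le> regular_outer X \<nu> F"
  unfolding regular_outer_def by (rule INF_superset_mono) auto

lemma outer_measure_space_regular_outer: "outer_measure_space (Pow (topspace X)) (regular_outer X \<nu>)"
  unfolding outer_measure_space_def
proof (intro conjI)
  have "regular_outer X \<nu> {} \<le> 0"
    using regular_outer_le[of "{}" "{}"] inner_open_empty by simp
  then show "positive (Pow (topspace X)) (regular_outer X \<nu>)" by (simp add: positive_def)
  show "increasing (Pow (topspace X)) (regular_outer X \<nu>)"
    by (simp add: increasing_def regular_outer_mono)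
  show "countably_subadditive (Pow (topspace X)) (regular_outer X \<nu>)"
    unfolding countably_subadditive_def
  proof (intro allI impI)
    fix A :: "nat \<Rightarrow> 'a set"
    assume A: "range A \<subseteq> Pow (topspace X)"
    show "regular_outer X \<nu> (\<Union>i. A i) \<le> (\<Sum>i. regular_outer X \<nu> (A i))"
    proof (rule ennreal_le_epsilon)
      fix e :: real assume e: "0 < e" "(\<Sum>i. regular_outer X \<nu> (A i)) < Orderings.top"
      have "\<exists>V. openin X V \<and> A n \<subseteq> V \<and> inner_open X \<nu> V \<le> regular_outer X \<nu> (A n) + e * (1/2)^Suc n" for n
      proof -
        have "regular_outer X \<nu> (A n) < regular_outer X \<nu> (A n) + e * (1/2)^Suc n"
          using e by (auto simp: less_top dest!: ennreal_suminf_lessD)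
        then show ?thesis
          unfolding regular_outer_def[of X \<nu> "A n"] INF_less_iff by (auto intro: less_imp_le)
      qed
      then obtain V where V: "\<And>n. openin X (V n)" "\<And>n. A n \<subseteq> V n"
        "\<And>n. inner_open X \<nu> (V n) \<le> regular_outer X \<nu> (A n) + e * (1/2)^Suc n" by metis
      have "regular_outer X \<nu> (\<Union>i. A i) \<le> inner_open X \<nu> (\<Union>i. V i)"
        using V by (intro regular_outer_le) auto
      also have "\<dots> \<le> (\<Sum>n. inner_open X \<nu> (V n))" by (rule inner_open_UN_le[OF V(1)])
      also have "\<dots> \<le> (\<Sum>n. regular_outer X \<nu> (A n) + e * (1/2)^Suc n)"
        by (intro suminf_le V(3)) auto
      also have "\<dots> = (\<Sum>n. regular_outer X \<nu> (A n)) + (\<Sum>n. ennreal e * ennreal ((1/2) ^ Suc n))"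
        using e(1) by (subst suminf_add[symmetric])
          (auto simp del: ennreal_suminf_cmult simp add: ennreal_mult[symmetric])
      also have "\<dots> = (\<Sum>n. regular_outer X \<nu> (A n)) + e"
        unfolding ennreal_suminf_cmult
        by (subst suminf_ennreal_eq[OF zero_le_power power_half_series]) auto
      finally show "regular_outer X \<nu> (\<Union>i. A i) \<le> (\<Sum>i. regular_outer X \<nu> (A i)) + e" .
    qed
  qed
qed

text \<open>This is Caratheodory's condition. Given an open set \<open>V\<close> around
  \<open>E\<close>, exhaust \<open>V \<inter> U\<close> by closed sets \<open>C\<close>. As
  \<open>C\<close> lies in \<open>U\<close>, the set \<open>V - C\<close> is an open neighbourhood
  of \<open>E - U\<close>, and its closed subsets are disjoint from \<open>C\<close>, so that
  additivity of the charge can be used.\<close>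

lemma open_in_lambda_system:
  assumes U: "openin X U"
  shows "U \<in> lambda_system (topspace X) (Pow (topspace X)) (regular_outer X \<nu>)"
proof -
  interpret sigma_algebra "topspace X" "Pow (topspace X)" by (rule sigma_algebra_Pow)
  let ?\<mu> = "regular_outer X \<nu>"
  have "?\<mu> (E \<inter> U) + ?\<mu> (E - U) = ?\<mu> E" if E: "E \<subseteq> topspace X" for E
  proof (rule antisym)
    show "?\<mu> (E \<inter> U) + ?\<mu> (E - U) \<le> ?\<mu> E"
      unfolding regular_outer_def[of X \<nu> E]
    proof (rule INF_greatest)
      fix V assume "V \<in> {V. openin X V \<and> E \<subseteq> V}"
      then have V: "openin X V" "E \<subseteq> V" by auto
      have 1: "ennreal (\<nu> C) + ?\<mu> (E - U) \<le> inner_open X \<nu> V" if C: "closedin X C" "C \<subseteq> V \<inter> U" for C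
      proof -
        have VC: "openin X (V - C)" using V C openin_diff by blast
        have "?\<mu> (E - U) \<le> inner_open X \<nu> (V - C)"
          using V C by (intro regular_outer_le VC) auto
        then have "ennreal (\<nu> C) + ?\<mu> (E - U) \<le> ennreal (\<nu> C) + inner_open X \<nu> (V - C)"
          by (rule add_left_mono)
        also have "\<dots> = (SUP D\<in>{D. closedin X D \<and> D \<subseteq> V - C}. ennreal (\<nu> C) + ennreal (\<nu> D))"
          unfolding inner_open_def by (rule ennreal_SUP_add_right) auto
        also have "\<dots> \<le> inner_open X \<nu> V"
        proof (rule SUP_least)
          fix D assume "D \<in> {D. closedin X D \<and> D \<subseteq> V - C}"
          then have D: "closedin X D" "D \<subseteq> V - C" by auto
          have CD: "C \<in> borel_sets_of X" "D \<in> borel_sets_of X"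
            using C D borel_sets_of_closed by auto
          have "C \<inter> D = {}" using D by blast
          then have "ennreal (\<nu> C) + ennreal (\<nu> D) = ennreal (\<nu> (C \<union> D))"
            using ch CD by (simp add: charge_def flip: ennreal_plus)
          also have "\<dots> \<le> inner_open X \<nu> V"
            using C D by (intro inner_open_upper) auto
          finally show "ennreal (\<nu> C) + ennreal (\<nu> D) \<le> inner_open X \<nu> V" .
        qed
        finally show ?thesis .
      qed
      have "?\<mu> (E \<inter> U) + ?\<mu> (E - U) \<le> inner_open X \<nu> (V \<inter> U) + ?\<mu> (E - U)"
        using V U by (intro add_right_mono regular_outer_le) auto
      also have "\<dots> = (SUP C\<in>{C. closedin X C \<and> C \<subseteq> V \<inter> U}. ennreal (\<nu> C) + ?\<mu> (E - U))"
        unfolding inner_open_def by (rule ennreal_SUP_add_left[symmetric]) auto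
      also have "\<dots> \<le> inner_open X \<nu> V" by (rule SUP_least) (use 1 in auto)
      finally show "?\<mu> (E \<inter> U) + ?\<mu> (E - U) \<le> inner_open X \<nu> V" .
    qed
    have "subadditive (Pow (topspace X)) ?\<mu>"
      using outer_measure_space_regular_outer countably_subadditive_subadditive
      by (auto simp: outer_measure_space_def)
    then have "?\<mu> ((E \<inter> U) \<union> (E - U)) \<le> ?\<mu> (E \<inter> U) + ?\<mu> (E - U)"
      using E by (intro subadditiveD) auto
    moreover have "(E \<inter> U) \<union> (E - U) = E" by blast
    ultimately show "?\<mu> E \<le> ?\<mu> (E \<inter> U) + ?\<mu> (E - U)" by simp
  qed
  then show ?thesis
    using openin_subset[OF U] by (auto simp: lambda_system_eq)
qed

lemma measure_space_regular_outer: "measure_space (topspace X) (borel_sets_of X) (regular_outer X \<nu>)"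
proof -
  interpret P: sigma_algebra "topspace X" "Pow (topspace X)" by (rule sigma_algebra_Pow)
  let ?L = "lambda_system (topspace X) (Pow (topspace X)) (regular_outer X \<nu>)"
  have L: "measure_space (topspace X) ?L (regular_outer X \<nu>)"
    by (rule P.caratheodory_lemma[OF outer_measure_space_regular_outer])
  then have "sigma_algebra (topspace X) ?L" by (simp add: measure_space_def)
  then have "borel_sets_of X \<subseteq> ?L"
    unfolding borel_sets_of_def using open_in_lambda_system by (intro sigma_algebra.sigma_sets_subset) auto
  then show ?thesis
    using measure_down[OF L sigma_algebra_borel_sets_of] by blast
qed

lemma regular_outer_topspace: "regular_outer X \<nu> (topspace X) = 1"
proof -
  have "{V. openin X V \<and> topspace X \<subseteq> V} = {topspace X}"
    using openin_subset by fastforce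
  then show ?thesis by (simp add: regular_outer_def inner_open_topspace)
qed

text \<open>A homeomorphism permutes the closed sets and the open sets, so it only reindexes the
  supremum and the infimum.\<close>

lemma regular_outer_image:
  assumes f: "homeomorphic_map X X f" and inv: "\<And>E. E \<in> borel_sets_of X \<Longrightarrow> \<nu> (f ` E) = \<nu> E"
    and E: "E \<subseteq> topspace X"
  shows "regular_outer X \<nu> (f ` E) = regular_outer X \<nu> E"
proof -
  have io: "inner_open X \<nu> (f ` V) = inner_open X \<nu> V" if V: "V \<subseteq> topspace X" for V
  proof -
    have "{C. closedin X C \<and> C \<subseteq> f ` V} = (`) f ` {C. closedin X C \<and> C \<subseteq> V}"
    proof (intro equalityI subsetI)
      fix C assume C: "C \<in> {C. closedin X C \<and> C \<subseteq> f ` V}"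
      then obtain D where D: "D \<subseteq> V" "C = f ` D" by (auto simp: subset_image_iff)
      then have "closedin X D" using homeomorphic_map_closedness[OF f, of D] C V by auto
      then show "C \<in> (`) f ` {C. closedin X C \<and> C \<subseteq> V}" using D by blast
    next
      fix C assume "C \<in> (`) f ` {C. closedin X C \<and> C \<subseteq> V}"
      then obtain D where D: "closedin X D" "D \<subseteq> V" "C = f ` D" by auto
      then show "C \<in> {C. closedin X C \<and> C \<subseteq> f ` V}"
        using homeomorphic_map_closedness[OF f closedin_subset[OF D(1)]] by auto
    qed
    then have "inner_open X \<nu> (f ` V) = (SUP C\<in>{C. closedin X C \<and> C \<subseteq> V}. ennreal (\<nu> (f ` C)))"
      by (simp add: inner_open_def image_image)
    also have "\<dots> = inner_open X \<nu> V"
      unfolding inner_open_def by (rule SUP_cong) (auto simp: inv borel_sets_of_closed)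
    finally show ?thesis .
  qed
  have "{V. openin X V \<and> f ` E \<subseteq> V} = (`) f ` {V. openin X V \<and> E \<subseteq> V}"
  proof (intro equalityI subsetI)
    fix V assume V: "V \<in> {V. openin X V \<and> f ` E \<subseteq> V}"
    then have "V \<subseteq> f ` topspace X"
      using openin_subset f by (auto simp: homeomorphic_imp_surjective_map)
    then obtain W where W: "W \<subseteq> topspace X" "V = f ` W" by (auto simp: subset_image_iff)
    have "openin X W" using homeomorphic_map_openness[OF f W(1)] W V by auto
    moreover have "E \<subseteq> W"
      using V W E homeomorphic_imp_injective_map[OF f] by (auto simp: inj_on_image_subset_iff)
    ultimately show "V \<in> (`) f ` {V. openin X V \<and> E \<subseteq> V}" using W by blast
  next
    fix V assume "V \<in> (`) f ` {V. openin X V \<and> E \<subseteq> V}"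
    then obtain W where W: "openin X W" "E \<subseteq> W" "V = f ` W" by auto
    then show "V \<in> {V. openin X V \<and> f ` E \<subseteq> V}"
      using homeomorphic_map_openness[OF f openin_subset[OF W(1)]] by auto
  qed
  then have "regular_outer X \<nu> (f ` E) = (INF V\<in>{V. openin X V \<and> E \<subseteq> V}. inner_open X \<nu> (f ` V))"
    by (simp add: regular_outer_def image_image)
  also have "\<dots> = regular_outer X \<nu> E"
    unfolding regular_outer_def by (rule INF_cong) (auto simp: io openin_subset)
  finally show ?thesis .
qed

end

theorem invariant_measure_of_inv_charge:
  assumes \<nu>: "inv_charge (\<phi> ` carrier G) X \<nu>" and X: "compact_space X" "normal_space X"
    and homeo: "\<And>g. g \<in> carrier G \<Longrightarrow> homeomorphic_map X X (\<phi> g)"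
  shows "\<exists>M. borel_probability_on X M \<and> invariant_measure G \<phi> M"
proof -
  have ch: "charge X \<nu>" using \<nu> by (simp add: inv_charge_def)
  have sub: "{U. openin X U} \<subseteq> Pow (topspace X)" by (auto dest: openin_subset)
  define M where "M = measure_of (topspace X) (borel_sets_of X) (regular_outer X \<nu>)"
  have space: "space M = topspace X" and sets: "sets M = borel_sets_of X"
    using sigma_algebra.sets_measure_of_eq[OF sigma_algebra_borel_sets_of, of X]
      sigma_algebra.space_measure_of_eq[OF sigma_algebra_borel_sets_of, of X] by (simp_all add: M_def)
  have em: "emeasure M A = regular_outer X \<nu> A" if "A \<in> borel_sets_of X" for A
    using measure_space_regular_outer[OF ch X] that unfolding M_def
    by (intro emeasure_measure_of_sigma) (auto simp: measure_space_def)
  have "prob_space M"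
    by (rule prob_spaceI) (simp add: space em borel_sets_of_topspace regular_outer_topspace[OF ch X])
  then have "borel_probability_on X M"
    by (simp add: borel_probability_on_def space sets borel_sets_of_def)
  moreover have "\<phi> g \<in> measurable M M \<and> distr M M (\<phi> g) = M" if g: "g \<in> carrier G" for g
  proof -
    have f: "homeomorphic_map X X (\<phi> g)" by (rule homeo[OF g])
    then have cont: "continuous_map X X (\<phi> g)" by (rule homeomorphic_imp_continuous_map)
    have meas: "\<phi> g \<in> measurable M M"
    proof (rule measurable_sigma_sets[OF _ sub])
      show "sets M = sigma_sets (topspace X) {U. openin X U}"
        by (simp add: sets borel_sets_of_def)
      show "\<phi> g \<in> space M \<rightarrow> topspace X"
        using cont by (auto simp: continuous_map_def space)
      fix U assume "U \<in> {U. openin X U}"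
      then have "openin X {x \<in> topspace X. \<phi> g x \<in> U}"
        using openin_continuous_map_preimage[OF cont] by blast
      moreover have "\<phi> g -` U \<inter> space M = {x \<in> topspace X. \<phi> g x \<in> U}"
        by (auto simp: space)
      ultimately show "\<phi> g -` U \<inter> space M \<in> sets M"
        by (simp add: sets borel_sets_of_open)
    qed
    moreover have "distr M M (\<phi> g) = M"
    proof (rule measure_eqI)
      fix A assume "A \<in> sets (distr M M (\<phi> g))"
      then have A: "A \<in> borel_sets_of X" by (simp add: sets)
      let ?B = "\<phi> g -` A \<inter> space M"
      have B: "?B \<in> borel_sets_of X" using measurable_sets[OF meas, of A] A by (simp add: sets)
      have "A \<subseteq> \<phi> g ` topspace X"
        using borel_sets_of_subset[OF A] homeomorphic_imp_surjective_map[OF f] by simp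
      then have AB: "\<phi> g ` ?B = A" by (auto simp: space)
      have "regular_outer X \<nu> (\<phi> g ` ?B) = regular_outer X \<nu> ?B"
        using \<nu> g by (intro regular_outer_image[OF ch X f]) (auto simp: inv_charge_def space)
      then show "emeasure (distr M M (\<phi> g)) A = emeasure M A"
        using A B AB by (simp add: emeasure_distr[OF meas] sets em)
    qed simp
    ultimately show ?thesis by blast
  qed
  then have "invariant_measure G \<phi> M" by (simp add: invariant_measure_def)
  ultimately show ?thesis by blast
qed

section \<open>Group actions on the circle\<close>

lemma continuous_int_valued_constant:
  fixes h :: "real \<Rightarrow> real"
  assumes h: "continuous_on UNIV h" and int: "\<And>t. h t \<in> \<int>"
  obtains d :: int where "\<And>t. h t = of_int d"
proof -
  have "h constant_on UNIV"
  proof (rule continuous_discrete_range_constant)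
    have "1 \<le> norm (h y - h x)" if "h y \<noteq> h x" for x y
      using Ints_nonzero_abs_ge1[OF Ints_diff[OF int int], of y x] that by simp
    then show "\<exists>e>0. \<forall>y. y \<in> UNIV \<and> h y \<noteq> h x \<longrightarrow> e \<le> norm (h y - h x)" for x
      by (intro exI[of _ 1]) auto
  qed (use h in auto)
  then obtain d' where "\<And>t. h t = d'" by (auto simp: constant_on_def)
  then show thesis using int[of 0] that by (auto elim!: Ints_cases)
qed

lemma circle_lift_near: "circle_lift f \<Longrightarrow> \<bar>f x - x - f 0\<bar> \<le> 1"
proof -
  assume f: "circle_lift f"
  define y where "y = x - of_int \<lfloor>x\<rfloor>"
  have y: "0 \<le> y" "y \<le> 1" unfolding y_def by linarith+
  have "f x - x = f y - y"
    using circle_lift_shift[OF f, of y "\<lfloor>x\<rfloor>"] by (simp add: y_def)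
  moreover have "f 0 \<le> f y" "f y \<le> f 0 + 1"
    using f y circle_lift_shift[OF f, of 0 1] by (auto simp: circle_lift_def strict_mono_less_eq dest: strict_mono_less_eq[of f y 1])
  ultimately show ?thesis using y by linarith
qed

lemma circle_lift_comp: "circle_lift f \<Longrightarrow> circle_lift g \<Longrightarrow> circle_lift (f \<circ> g)"
  unfolding circle_lift_def
  by (auto intro!: continuous_on_compose2[of UNIV f UNIV g] strict_monoI simp: strict_mono_less)

lemma circle_lift_inverse:
  assumes f: "circle_lift f"
  obtains g where "circle_lift g" "\<And>x. g (f x) = x" "\<And>x. f (g x) = x"
proof -
  have c: "continuous_on UNIV f" and m: "strict_mono f" and p: "\<And>x. f (x + 1) = f x + 1"
    using f by (auto simp: circle_lift_def)
  have "\<exists>x. f x = y" for y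
  proof -
    define n where "n = \<lfloor>y - f 0\<rfloor>"
    have "f (of_int n) = f 0 + of_int n" using circle_lift_shift[OF f, of 0 n] by simp
    moreover have "f (of_int n + 1) = f (of_int n) + 1" by (rule p)
    moreover have "of_int n \<le> y - f 0" "y - f 0 < of_int n + 1" unfolding n_def by linarith+
    ultimately have "f (of_int n) \<le> y" "y \<le> f (of_int n + 1)" by linarith+
    then show ?thesis
      using IVT'[of f "of_int n" y "of_int n + 1"] continuous_on_subset[OF c] by auto
  qed
  then obtain g where fg: "\<And>y. f (g y) = y" by metis
  have gf: "g (f x) = x" for x using fg[of "f x"] strict_mono_eq[OF m] by metis
  have gm: "strict_mono g"
    by (rule strict_monoI) (metis fg strict_mono_less[OF m])
  have "surj g" using gf by (metis surjI)
  then have "continuous_on UNIV g"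
    using gm by (intro continuous_onI_mono) (auto simp: strict_mono_less_eq)
  moreover have "g (y + 1) = g y + 1" for y
    using gf[of "g y + 1"] p[of "g y"] fg[of y] by simp
  ultimately have "circle_lift g" using gm by (simp add: circle_lift_def)
  then show thesis using that gf fg by blast
qed

section \<open>Stieltjes measures of quasi-invariant heights\<close>

text \<open>The right limit of \<open>F\<close>. The interval measure of a monotone function
  requires right continuity, and a limit of step counts may have jumps.\<close>

definition right_height :: "(real \<Rightarrow> real) \<Rightarrow> real \<Rightarrow> real" where
  "right_height F x = Inf (F ` {x<..})"

context
  fixes F :: "real \<Rightarrow> real"
  assumes mono: "mono F" and unit: "\<And>x. F (x + 1) = F x + 1"
begin

lemma right_height_lower: "x < y \<Longrightarrow> right_height F x \<le> F y"
  unfolding right_height_def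
  by (rule cInf_lower) (auto intro!: bdd_belowI[of _ "F x"] monoD[OF mono])

lemma right_height_greatest: "(\<And>y. x < y \<Longrightarrow> a \<le> F y) \<Longrightarrow> a \<le> right_height F x"
  unfolding right_height_def by (rule cInf_greatest) (auto simp: gt_ex)

lemma right_height_mono: "x \<le> y \<Longrightarrow> right_height F x \<le> right_height F y"
  by (rule right_height_greatest) (auto intro: right_height_lower)

lemma right_height_right_continuous: "continuous (at_right a) (right_height F)"
proof (rule continuous_at_right_real_increasing[THEN iffD2])
  show "\<And>x y. x \<le> y \<Longrightarrow> right_height F x \<le> right_height F y" by (rule right_height_mono)
  show "\<forall>e>0. \<exists>d>0. right_height F (a + d) - right_height F a < e"
  proof (intro allI impI)
    fix e :: real assume "0 < e"
    have "\<exists>y>a. F y < right_height F a + e"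
    proof (rule ccontr)
      assume "\<not> ?thesis"
      then have "right_height F a + e \<le> right_height F a"
        by (intro right_height_greatest) (force simp: not_less)
      then show False using \<open>0 < e\<close> by simp
    qed
    then obtain y where y: "a < y" "F y < right_height F a + e" by blast
    then have "right_height F (a + (y - a) / 2) \<le> F y"
      by (intro right_height_lower) (simp add: field_simps)
    then show "\<exists>d>0. right_height F (a + d) - right_height F a < e"
      using y by (intro exI[of _ "(y - a) / 2"]) auto
  qed
qed

lemma right_height_shift:
  assumes f: "circle_lift f" and c: "\<And>x. F (f x) = F x + c"
  shows "right_height F (f x) = right_height F x + c"
proof -
  obtain g where g: "circle_lift g" "\<And>x. g (f x) = x" "\<And>x. f (g x) = x"
    using circle_lift_inverse[OF f] by blast
  have mf: "strict_mono f" "strict_mono g" using f g by (auto simp: circle_lift_def)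
  show ?thesis
  proof (rule antisym)
    have "right_height F (f x) - c \<le> right_height F x"
    proof (rule right_height_greatest)
      fix y assume "x < y"
      then have "right_height F (f x) \<le> F (f y)" using mf by (intro right_height_lower) (simp add: strict_mono_less)
      then show "right_height F (f x) - c \<le> F y" using c by simp
    qed
    then show "right_height F (f x) \<le> right_height F x + c" by simp
    show "right_height F x + c \<le> right_height F (f x)"
    proof (rule right_height_greatest)
      fix y assume "f x < y"
      then have "x < g y" using strict_mono_less[OF mf(1), of x "g y"] g(3) by simp
      then have "right_height F x \<le> F (g y)" by (rule right_height_lower)
      then show "right_height F x + c \<le> F y" using c[of "g y"] g(3) by simp
    qed
  qed
qed

lemma emeasure_height_Ioc:
  "emeasure (interval_measure (right_height F)) {a<..b} = (if a \<le> b then ennreal (right_height F b - right_height F a) else 0)"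
  using emeasure_interval_measure_Ioc_eq[of "right_height F" a b, OF right_height_mono right_height_right_continuous]
  by simp

text \<open>Under \<open>f\<close> the interval from \<open>a\<close> to \<open>b\<close> becomes
  the one from \<open>f a\<close> to \<open>f b\<close>, and the constant \<open>c\<close> cancels
  in the difference of heights. Half-open intervals are stable under intersection and generate the
  Borel sets, so equality on them suffices.\<close>

lemma height_measure_image:
  assumes f: "circle_lift f" and c: "\<And>x. F (f x) = F x + c" and A: "A \<in> sets borel"
  shows "f ` A \<in> sets borel" "emeasure (interval_measure (right_height F)) (f ` A) = emeasure (interval_measure (right_height F)) A"
proof -
  let ?\<mu> = "interval_measure (right_height F)"
  obtain g where g: "circle_lift g" "\<And>x. g (f x) = x" "\<And>x. f (g x) = x"
    using circle_lift_inverse[OF f] by blast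
  have mf: "strict_mono f" "strict_mono g" using f g by (auto simp: circle_lift_def)
  have gm: "g \<in> borel_measurable borel"
    using g(1) by (auto simp: circle_lift_def intro: borel_measurable_continuous_onI)
  have vim: "f ` B = g -` B" for B
  proof (intro equalityI subsetI)
    fix x assume "x \<in> g -` B"
    then show "x \<in> f ` B" using g(3)[of x] by (intro image_eqI[of _ _ "g x"]) auto
  qed (use g(2) in auto)
  show fA: "f ` A \<in> sets borel" unfolding vim using measurable_sets_borel[OF gm A] .
  have "distr ?\<mu> borel g = ?\<mu>"
  proof (rule measure_eqI_generator_eq[where E = "range (\<lambda>(a, b). {a<..b::real})" and \<Omega> = UNIV and A = "\<lambda>i. {- real i<..real i}"])
    show "Int_stable (range (\<lambda>(a, b). {a<..b::real}))"
    proof (rule Int_stableI)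
      fix A B assume "A \<in> range (\<lambda>(a, b). {a<..b::real})" "B \<in> range (\<lambda>(a, b). {a<..b::real})"
      then obtain a b a' b' where "A = {a<..b}" "B = {a'<..b'}" by auto
      then have "A \<inter> B = {max a a'<..min b b'}" by auto
      then show "A \<inter> B \<in> range (\<lambda>(a, b). {a<..b::real})" by auto
    qed
    fix X assume "X \<in> range (\<lambda>(a, b). {a<..b::real})"
    then obtain a b where X: "X = {a<..b}" by auto
    have "g -` {a<..b} = {f a<..f b}"
      using strict_mono_less[OF mf(2)] strict_mono_less_eq[OF mf(2)] g by (auto; metis)
    then show "emeasure (distr ?\<mu> borel g) X = emeasure ?\<mu> X"
      using gm X mf(1) right_height_shift[OF f c]
      by (simp add: emeasure_distr emeasure_height_Ioc strict_mono_less_eq)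
  next
    show "(\<Union>i. {- real i<..real i}) = UNIV"
    proof (intro equalityI subsetI UNIV_I)
      fix x :: real
      obtain n :: nat where "\<bar>x\<bar> < real n" using reals_Archimedean2 by blast
      then show "x \<in> (\<Union>i. {- real i<..real i})" by (intro UN_I[of n]) auto
    qed
    show "emeasure (distr ?\<mu> borel g) {- real i<..real i} \<noteq> \<infinity>" for i
    proof -
      have "g -` {- real i<..real i} = {f (- real i)<..f (real i)}"
        using strict_mono_less[OF mf(2)] strict_mono_less_eq[OF mf(2)] g by (auto; metis)
      then show ?thesis using gm by (simp add: emeasure_distr emeasure_height_Ioc)
    qed
  qed (auto simp: borel_sigma_sets_Ioc)
  then have "emeasure ?\<mu> A = emeasure (distr ?\<mu> borel g) A" by simp
  also have "\<dots> = emeasure ?\<mu> (f ` A)"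
    using gm A by (simp add: emeasure_distr vim)
  finally show "emeasure ?\<mu> (f ` A) = emeasure ?\<mu> A" by simp
qed

lemma height_measure_translate:
  assumes "A \<in> sets borel"
  shows "emeasure (interval_measure (right_height F)) ((\<lambda>x. x + of_int n) ` A) = emeasure (interval_measure (right_height F)) A"
proof (rule height_measure_image(2)[OF _ _ assms])
  show "circle_lift (\<lambda>x. x + of_int n)"
    by (auto simp: circle_lift_def strict_mono_def intro!: continuous_intros)
  show "F (x + of_int n) = F x + of_int n" for x
    using shift_of_int[of F 1 x n] unit by simp
qed

text \<open>The window is cut at the integer that it contains, and its right part is moved back by
  one; the result is the standard window up to an integer translation. A periodic set is compatible
  with these moves.\<close>

lemma height_measure_window:
  assumes A: "A \<in> sets borel" and per: "\<And>x. x + 1 \<in> A \<longleftrightarrow> x \<in> A"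
  shows "emeasure (interval_measure (right_height F)) ({a<..a + 1} \<inter> A) = emeasure (interval_measure (right_height F)) ({0<..1} \<inter> A)"
proof -
  let ?\<mu> = "interval_measure (right_height F)"
  have per_int: "x + of_int n \<in> A \<longleftrightarrow> x \<in> A" for x n
  proof (induction n rule: int_induct[where k = 0])
    case (step1 i) then show ?case using per[of "x + of_int i"] by (simp add: algebra_simps)
  next
    case (step2 i) then show ?case using per[of "x + of_int i - 1"] by (simp add: algebra_simps)
  qed simp
  define n where "n = \<lfloor>a\<rfloor>"
  have n: "of_int n \<le> a" "a < of_int n + 1" unfolding n_def by linarith+
  have tr: "(\<lambda>x. x + of_int k) ` ({b<..b'} \<inter> A) = {b + of_int k<..b' + of_int k} \<inter> A" for b b' k
  proof (intro equalityI subsetI)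
    fix y assume "y \<in> {b + of_int k<..b' + of_int k} \<inter> A"
    then show "y \<in> (\<lambda>x. x + of_int k) ` ({b<..b'} \<inter> A)"
      using per_int[of "y - of_int k" k] by (intro image_eqI[of _ _ "y - of_int k"]) auto
  qed (use per_int in auto)
  have shift: "emeasure ?\<mu> ({b + of_int k<..b' + of_int k} \<inter> A) = emeasure ?\<mu> ({b<..b'} \<inter> A)" for b b' k
    using height_measure_translate[of "{b<..b'} \<inter> A" k] A tr[of k b b'] by simp
  have "emeasure ?\<mu> ({a<..a + 1} \<inter> A) = emeasure ?\<mu> (({a<..of_int n + 1} \<inter> A) \<union> ({of_int n + 1<..a + 1} \<inter> A))"
    using n by (intro arg_cong[where f = "emeasure ?\<mu>"]) auto
  also have "\<dots> = emeasure ?\<mu> ({a<..of_int n + 1} \<inter> A) + emeasure ?\<mu> ({of_int n + 1<..a + 1} \<inter> A)"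
    using A by (intro plus_emeasure[symmetric]) auto
  also have "emeasure ?\<mu> ({of_int n + 1<..a + 1} \<inter> A) = emeasure ?\<mu> ({of_int n<..a} \<inter> A)"
    using shift[of "of_int n" 1 a] by simp
  also have "emeasure ?\<mu> ({a<..of_int n + 1} \<inter> A) + emeasure ?\<mu> ({of_int n<..a} \<inter> A)
      = emeasure ?\<mu> (({a<..of_int n + 1} \<inter> A) \<union> ({of_int n<..a} \<inter> A))"
    using A by (intro plus_emeasure) auto
  also have "\<dots> = emeasure ?\<mu> ({0 + of_int n<..1 + of_int n} \<inter> A)"
    using n by (intro arg_cong[where f = "emeasure ?\<mu>"]) auto
  also have "\<dots> = emeasure ?\<mu> ({0<..1} \<inter> A)" by (rule shift)
  finally show ?thesis .
qed

end

lemma inv_charge_of_finite: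
  assumes F: "finite F" "F \<noteq> {}" "F \<subseteq> topspace X"
    and f: "\<And>f. f \<in> \<Gamma> \<Longrightarrow> inj_on f (topspace X)" "\<And>f. f \<in> \<Gamma> \<Longrightarrow> f ` F \<subseteq> F"
  shows "inv_charge \<Gamma> X (\<lambda>E. card (E \<inter> F) / card F)"
proof -
  have nz: "card F \<noteq> 0" and top: "topspace X \<inter> F = F" using F by auto
  have add: "card ((E \<union> E') \<inter> F) = card (E \<inter> F) + card (E' \<inter> F)" if "E \<inter> E' = {}" for E E'
    by (subst Int_Un_distrib2, rule card_Un_disjoint) (use that F(1) in auto)
  have inv: "card (f' ` E \<inter> F) = card (E \<inter> F)" if f': "f' \<in> \<Gamma>" and E: "E \<in> borel_sets_of X" for f' E
  proof -
    have inj: "inj_on f' (topspace X)" by (rule f(1)[OF f'])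
    have "inj_on f' F" by (rule inj_on_subset[OF inj F(3)])
    then have "f' ` F = F" using endo_inj_surj[OF F(1) f(2)[OF f']] by blast
    moreover have "f' ` (E \<inter> F) = f' ` E \<inter> f' ` F"
      using inj_on_image_Int[OF inj borel_sets_of_subset[OF E] F(3)] .
    moreover have "inj_on f' (E \<inter> F)" by (rule inj_on_subset[OF inj]) (use F(3) in blast)
    then have "card (f' ` (E \<inter> F)) = card (E \<inter> F)" by (rule card_image)
    ultimately show ?thesis by simp
  qed
  show ?thesis
    unfolding inv_charge_def charge_def
  proof (intro conjI ballI impI)
    show "real (card (topspace X \<inter> F)) / real (card F) = 1" using nz top by simp
    show "real (card ((E \<union> E') \<inter> F)) / real (card F) = real (card (E \<inter> F)) / real (card F) + real (card (E' \<inter> F)) / real (card F)"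
      if "E \<inter> E' = {}" for E E'
      by (simp add: add[OF that] add_divide_distrib)
    show "real (card (f' ` E \<inter> F)) / real (card F) = real (card (E \<inter> F)) / real (card F)"
      if "f' \<in> \<Gamma>" "E \<in> borel_sets_of X" for f' E
      by (simp add: inv[OF that])
  qed simp
qed

section \<open>The line as a cover of a circle\<close>

text \<open>The model is the map from \<open>t\<close> to \<open>exp (2 * pi * \<i> * t)\<close>,
  carried over to any homeomorphic copy \<open>C\<close> of the unit circle.\<close>

locale circle_cover =
  fixes C :: "'a::metric_space set" and c :: "real \<Rightarrow> 'a"
  assumes c_cont: "continuous_on UNIV c" and c_range: "range c = C"
    and c_eq: "c s = c t \<longleftrightarrow> (\<exists>n::int. s - t = of_int n)"
    and lift_exists: "\<And>g. continuous_on C g \<Longrightarrow> g ` C \<subseteq> C \<Longrightarrow> \<exists>f. continuous_on UNIV f \<and> (\<forall>t. c (f t) = g (c t))"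
begin

lemma c_shift: "c (t + of_int n) = c t"
  using c_eq by force

text \<open>The difference between \<open>f (t + 1)\<close> and \<open>f t\<close> is a constant
  integer \<open>d\<close>. If it were 0, then \<open>f (t + 1/2) - f t\<close> would change sign
  and vanish somewhere; if its modulus were at least 2, then \<open>f\<close> would take the value
  \<open>f 0 + 1\<close> or \<open>f 0 - 1\<close> strictly between 0 and 1. Both contradict
  injectivity of \<open>g\<close>. As \<open>d\<close> is not 0, \<open>f\<close> is injective,
  hence monotone.\<close>

lemma lift_monotone:
  assumes "continuous_on C g" "g ` C \<subseteq> C" "inj_on g C"
  obtains f where "\<And>t. c (f t) = g (c t)" "circle_lift f \<or> circle_lift (\<lambda>t. - f t)"
proof -
  obtain f where fc: "continuous_on UNIV f" and f: "\<And>t. c (f t) = g (c t)"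
    using lift_exists[OF assms(1,2)] by blast
  have f_eq: "\<exists>n::int. s - t = of_int n" if "\<exists>n::int. f s - f t = of_int n" for s t
  proof -
    have "g (c s) = g (c t)" using that f c_eq by metis
    then have "c s = c t" using inj_onD[OF assms(3)] c_range by blast
    then show ?thesis using c_eq by blast
  qed
  have "\<exists>n::int. f (t + 1) - f t = of_int n" for t
    using f c_eq c_shift[of t 1] by (metis of_int_1)
  then have int: "f (t + 1) - f t \<in> \<int>" for t by (metis Ints_of_int)
  have fc1: "continuous_on UNIV (\<lambda>t. f (t + 1))"
    by (rule continuous_on_compose2[OF fc]) (auto intro!: continuous_intros)
  have "continuous_on UNIV (\<lambda>t. f (t + 1) - f t)" using fc fc1 by (intro continuous_intros)
  then obtain d :: int where "\<And>t. f (t + 1) - f t = of_int d"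
    using continuous_int_valued_constant int by blast
  then have d: "f (t + 1) = f t + of_int d" for t by (metis diff_add_cancel add.commute)
  have dn: "f (t + of_int n) = f t + of_int n * of_int d" for t n
    by (rule shift_of_int) (rule d)
  have no_half: "\<not> (\<exists>n::int. x = of_int n)" if "0 < x" "x < 1" for x :: real
    using that by (metis floor_of_int floor_unique less_irrefl of_int_0 of_int_less_iff less_le_not_le linorder_not_le zless_add1_eq of_int_1 add_0 int_one_le_iff_zero_less not_less)
  have "d \<noteq> 0"
  proof
    assume "d = 0"
    define h where "h t = f (t + 1/2) - f t" for t
    have "continuous_on UNIV (\<lambda>t. f (t + 1/2))"
      by (rule continuous_on_compose2[OF fc]) (auto intro!: continuous_intros)
    then have "continuous_on UNIV h" unfolding h_def using fc by (intro continuous_intros)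
    then have "connected (range h)" using connected_continuous_image connected_UNIV by blast
    moreover have "h (1/2) = - h 0" using d[of 0] \<open>d = 0\<close> by (simp add: h_def)
    ultimately have "0 \<in> range h"
      using connectedD_interval[of "range h" "h 0" "h (1/2)" 0] connectedD_interval[of "range h" "h (1/2)" "h 0" 0]
      by (metis linorder_linear neg_0_le_iff_le neg_le_0_iff_le rangeI)
    then obtain t where "f (t + 1/2) - f t = of_int 0" by (auto simp: h_def)
    then obtain n :: int where "(t + 1/2) - t = of_int n" using f_eq by metis
    then show False using no_half[of "1/2"] by auto
  qed
  have inj: "inj f"
  proof (rule injI)
    fix s t assume "f s = f t"
    then obtain n :: int where n: "s - t = of_int n" using f_eq[of s t] by (metis diff_self of_int_0)
    then have "f s = f t + of_int n * of_int d" using dn[of t n] by (metis add.commute diff_add_cancel)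
    then show "s = t" using \<open>f s = f t\<close> \<open>d \<noteq> 0\<close> n by simp
  qed
  have between: False if "0 < t" "t < 1" "f t = f 0 + of_int k" for t :: real and k :: int
    using f_eq[of t 0] that no_half[of t] by auto
  have c01: "continuous_on {0..1} f" using fc continuous_on_subset by blast
  have "\<not> 2 \<le> d"
  proof
    assume "2 \<le> d"
    then have "f 0 \<le> f 0 + 1" "f 0 + 1 \<le> f 1" using d[of 0] by auto
    then obtain t where t: "0 \<le> t" "t \<le> 1" "f t = f 0 + 1" using IVT'[of f 0 "f 0 + 1" 1] c01 by auto
    then have "t \<noteq> 0" "t \<noteq> 1" using d[of 0] \<open>2 \<le> d\<close> by auto
    then show False using between[of t 1] t by auto
  qed
  moreover have "\<not> d \<le> - 2"
  proof
    assume "d \<le> - 2"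
    then have "f 1 \<le> f 0 - 1" "f 0 - 1 \<le> f 0" using d[of 0] by auto
    then obtain t where t: "0 \<le> t" "t \<le> 1" "f t = f 0 - 1" using IVT2'[of f 1 "f 0 - 1" 0] c01 by auto
    then have "t \<noteq> 0" "t \<noteq> 1" using d[of 0] \<open>d \<le> - 2\<close> by auto
    then show False using between[of t "-1"] t by auto
  qed
  ultimately consider "d = 1" | "d = -1" using \<open>d \<noteq> 0\<close> by linarith
  then show thesis
  proof cases
    case 1
    have "strict_mono f \<or> strict_antimono_on UNIV f" using injective_eq_monotone_map[of UNIV f] fc inj by simp
    moreover have "f 0 < f 1" using d[of 0] 1 by simp
    ultimately have "strict_mono f" using monotone_onD[of UNIV "(<)" "(>)" f 0 1] by auto
    then show thesis using that[of f] f fc d 1 by (simp add: circle_lift_def)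
  next
    case 2
    have "strict_mono f \<or> strict_antimono_on UNIV f" using injective_eq_monotone_map[of UNIV f] fc inj by simp
    moreover have "f 1 < f 0" using d[of 0] 2 by simp
    ultimately have "strict_antimono_on UNIV f" using monotone_onD[of UNIV "(<)" "(<)" f 0 1] by auto
    then have "strict_mono (\<lambda>t. - f t)" by (auto simp: monotone_on_def)
    moreover have "continuous_on UNIV (\<lambda>t. - f t)" using fc by (intro continuous_intros)
    ultimately show thesis using that[of f] f d 2 by (simp add: circle_lift_def)
  qed
qed

definition orientation_preserving :: "('a \<Rightarrow> 'a) \<Rightarrow> bool" where
  "orientation_preserving g \<longleftrightarrow> (\<exists>f. circle_lift f \<and> (\<forall>t. c (f t) = g (c t)))"

text \<open>Only increasing lifts are collected, so members of \<open>\<Gamma>\<close> that reverse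
  the orientation leave no trace here.\<close>

definition lifts :: "('a \<Rightarrow> 'a) set \<Rightarrow> (real \<Rightarrow> real) set" where
  "lifts \<Gamma> = {f. circle_lift f \<and> (\<exists>g\<in>\<Gamma>. \<forall>t. c (f t) = g (c t))}"

lemma lift_group_lifts:
  assumes \<Gamma>: "homeo_group C \<Gamma>"
  shows "lift_group (lifts \<Gamma>)"
  unfolding lift_group_def
proof (intro conjI ballI)
  have cC: "c t \<in> C" for t using c_range by blast
  show "circle_lift f" if "f \<in> lifts \<Gamma>" for f using that by (simp add: lifts_def)
  \<comment> \<open>The unit translation lifts the identity, which is represented in
    \<open>\<Gamma>\<close> by some \<open>k\<close> that agrees on \<open>C\<close> with a member
    followed by its inverse.\<close>
  obtain g0 where g0: "g0 \<in> \<Gamma>" using \<Gamma> by (auto simp: homeo_group_def)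
  obtain g1 where g1: "g1 \<in> \<Gamma>" "homeomorphism C C g0 g1" using homeo_groupD[OF \<Gamma> g0] by blast
  obtain k where k: "k \<in> \<Gamma>" "\<forall>x\<in>C. k x = g1 (g0 x)" using \<Gamma> g0 g1(1) unfolding homeo_group_def by blast
  have "k (c t) = c t" for t using k(2) g1(2) cC by (simp add: homeomorphism_def)
  then have "\<forall>t. c (t + 1) = k (c t)" using c_shift[of _ 1] by simp
  moreover have "circle_lift (\<lambda>t. t + 1)"
    by (auto simp: circle_lift_def strict_mono_def intro!: continuous_intros)
  ultimately show "(\<lambda>t. t + 1) \<in> lifts \<Gamma>" using k(1) unfolding lifts_def by blast
  fix f assume "f \<in> lifts \<Gamma>"
  then obtain g where fg: "circle_lift f" "g \<in> \<Gamma>" "\<And>t. c (f t) = g (c t)" by (auto simp: lifts_def)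
  show "f \<circ> f' \<in> lifts \<Gamma>" if "f' \<in> lifts \<Gamma>" for f'
  proof -
    obtain g' where fg': "circle_lift f'" "g' \<in> \<Gamma>" "\<And>t. c (f' t) = g' (c t)" using \<open>f' \<in> lifts \<Gamma>\<close> by (auto simp: lifts_def)
    obtain k where "k \<in> \<Gamma>" "\<forall>x\<in>C. k x = g (g' x)" using \<Gamma> fg(2) fg'(2) unfolding homeo_group_def by blast
    moreover from this have "\<forall>t. c ((f \<circ> f') t) = k (c t)" using fg(3) fg'(3) cC by simp
    ultimately show ?thesis using circle_lift_comp[OF fg(1) fg'(1)] unfolding lifts_def by blast
  qed
  obtain f' where f': "circle_lift f'" "\<And>x. f' (f x) = x" "\<And>x. f (f' x) = x" using circle_lift_inverse[OF fg(1)] by blast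
  obtain g' where g': "g' \<in> \<Gamma>" "homeomorphism C C g g'" using homeo_groupD[OF \<Gamma> fg(2)] by blast
  have "c (f' t) = g' (c t)" for t
  proof -
    have "g (c (f' t)) = c t" using fg(3)[of "f' t"] f'(3) by simp
    then show ?thesis using g'(2) cC[of "f' t"] by (auto simp: homeomorphism_def)
  qed
  then have "f' \<in> lifts \<Gamma>" using f'(1) g'(1) unfolding lifts_def by blast
  then show "\<exists>f'\<in>lifts \<Gamma>. (\<forall>x. f' (f x) = x) \<and> (\<forall>x. f (f' x) = x)" using f' by blast
qed

text \<open>Lifts of commuting maps commute up to a constant integer \<open>d\<close>. Passing from
  \<open>k\<close> to its iterate of order \<open>j\<close> multiplies this defect by
  \<open>j\<close>, while the defect is bounded in terms of the displacement of \<open>f\<close>,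
  independently of \<open>j\<close>. Hence \<open>d\<close> is 0.\<close>

lemma lifts_commute:
  assumes \<Gamma>: "homeo_group C \<Gamma>" and \<Delta>: "homeo_group C \<Delta>"
    and comm: "\<And>f g x. f \<in> \<Gamma> \<Longrightarrow> g \<in> \<Delta> \<Longrightarrow> x \<in> C \<Longrightarrow> f (g x) = g (f x)"
    and f: "f \<in> lifts \<Gamma>" and k: "k \<in> lifts \<Delta>"
  shows "f (k x) = k (f x)"
proof -
  obtain g where g: "circle_lift f" "g \<in> \<Gamma>" "\<And>t. c (f t) = g (c t)" using f by (auto simp: lifts_def)
  obtain h where h: "circle_lift k" "h \<in> \<Delta>" "\<And>t. c (k t) = h (c t)" using k by (auto simp: lifts_def)
  have mk: "strict_mono k" and ck: "continuous_on UNIV k" "continuous_on UNIV f"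
    using g h by (auto simp: circle_lift_def)
  have "c (f (k t)) = c (k (f t))" for t
    using g h comm c_range by simp blast
  then have int: "f (k t) - k (f t) \<in> \<int>" for t using c_eq by (metis Ints_of_int)
  have "continuous_on UNIV (\<lambda>t. f (k t))" "continuous_on UNIV (\<lambda>t. k (f t))"
    using ck by (auto intro: continuous_on_compose2)
  then have "continuous_on UNIV (\<lambda>t. f (k t) - k (f t))" by (intro continuous_intros)
  then obtain d :: int where "\<And>t. f (k t) - k (f t) = of_int d"
    using continuous_int_valued_constant int by blast
  then have d: "f (k t) = k (f t) + of_int d" for t by (metis diff_add_cancel add.commute)
  have pow: "f ((k ^^ j) t) = (k ^^ j) (f t) + of_int (int j * d)" for j t
  proof (induction j)
    case (Suc j)
    have "f ((k ^^ Suc j) t) = k (f ((k ^^ j) t)) + of_int d" by (simp add: d)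
    also have "\<dots> = k ((k ^^ j) (f t) + of_int (int j * d)) + of_int d" by (simp only: Suc)
    also have "\<dots> = (k ^^ Suc j) (f t) + of_int (int (Suc j) * d)"
      using circle_lift_shift[OF h(1), of "(k ^^ j) (f t)" "int j * d"] by (simp add: algebra_simps)
    finally show ?case .
  qed simp
  \<comment> \<open>\<open>M\<close> bounds the displacement of \<open>f\<close>. It is an integer,
    so that the iterates of \<open>k\<close> commute with the translation by \<open>M\<close>; at
    \<open>j = 2 * M + 1\<close> the bound on the defect fails unless \<open>d\<close> is 0.\<close>
  define M where "M = nat \<lceil>\<bar>f 0\<bar> + 1\<rceil>"
  have near: "\<bar>f y - y\<bar> \<le> real M" for y
    using circle_lift_near[OF g(1), of y] unfolding M_def by linarith
  have powshift: "(k ^^ j) (t + of_int n) = (k ^^ j) t + of_int n" for j t n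
    by (induction j) (auto simp: circle_lift_shift[OF h(1)])
  have powmono: "s \<le> t \<Longrightarrow> (k ^^ j) s \<le> (k ^^ j) t" for j s t
    by (induction j) (auto simp: strict_mono_less_eq[OF mk])
  have bound: "\<bar>real_of_int (int j * d)\<bar> \<le> 2 * real M" for j
  proof -
    have "(k ^^ j) (f 0) \<le> (k ^^ j) 0 + real M" "(k ^^ j) 0 - real M \<le> (k ^^ j) (f 0)"
      using powmono[of "f 0" "0 + of_int (int M)" j] powmono[of "0 + of_int (- int M)" "f 0" j] near[of 0]
        powshift[of j 0 "int M"] powshift[of j 0 "- int M"] by auto
    then show ?thesis using near[of "(k ^^ j) 0"] pow[of j 0] by linarith
  qed
  have "d = 0"
  proof (rule ccontr)
    assume "d \<noteq> 0"
    then have "1 \<le> \<bar>real_of_int d\<bar>" by linarith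
    then have "real (2 * M + 1) * 1 \<le> real (2 * M + 1) * \<bar>real_of_int d\<bar>"
      by (intro mult_left_mono) auto
    also have "\<dots> = \<bar>real_of_int (int (2 * M + 1) * d)\<bar>" by (simp add: abs_mult)
    also have "\<dots> \<le> 2 * real M" by (rule bound)
    finally show False by simp
  qed
  then show ?thesis using d by simp
qed

end

lemma homeomorphic_map_of_homeomorphism:
  assumes "homeomorphism S T g h"
  shows "homeomorphic_map (top_of_set S) (top_of_set T) g"
proof (rule homeomorphic_maps_imp_map)
  show "homeomorphic_maps (top_of_set S) (top_of_set T) g h"
    using assms by (auto simp: homeomorphic_maps_def homeomorphism_def)
qed

context circle_cover
begin

lemma orientation_preserving_comp:
  assumes "orientation_preserving g" "orientation_preserving h" "\<And>x. x \<in> C \<Longrightarrow> k x = g (h x)"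
  shows "orientation_preserving k"
proof -
  obtain f1 f2 where f: "circle_lift f1" "\<And>t. c (f1 t) = g (c t)" "circle_lift f2" "\<And>t. c (f2 t) = h (c t)"
    using assms(1,2) unfolding orientation_preserving_def by blast
  have "c ((f1 \<circ> f2) t) = k (c t)" for t using f assms(3)[of "c t"] c_range by auto
  then show ?thesis using circle_lift_comp[OF f(1,3)] unfolding orientation_preserving_def by blast
qed

lemma orientation_preserving_inverse:
  assumes "orientation_preserving g" "homeomorphism C C g h"
  shows "orientation_preserving h"
proof -
  obtain f where f: "circle_lift f" "\<And>t. c (f t) = g (c t)"
    using assms(1) unfolding orientation_preserving_def by blast
  obtain f' where f': "circle_lift f'" "\<And>x. f' (f x) = x" "\<And>x. f (f' x) = x"
    using circle_lift_inverse[OF f(1)] by blast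
  have "c (f' t) = h (c t)" for t
  proof -
    have "g (c (f' t)) = c t" using f(2)[of "f' t"] f'(3) by simp
    moreover have "c (f' t) \<in> C" using c_range by blast
    ultimately show ?thesis using assms(2) by (auto simp: homeomorphism_def)
  qed
  then show ?thesis using f'(1) unfolding orientation_preserving_def by blast
qed

text \<open>Without an increasing lift a homeomorphism has a decreasing one, and two decreasing
  lifts compose to an increasing one.\<close>

lemma reversing_comp:
  assumes g: "homeomorphism C C g g'" "\<not> orientation_preserving g" and h: "homeomorphism C C h h'" "\<not> orientation_preserving h"
    and k: "\<And>x. x \<in> C \<Longrightarrow> k x = g (h x)"
  shows "orientation_preserving k"
proof -
  have lift: "\<exists>f. (\<forall>t. c (f t) = g (c t)) \<and> circle_lift (\<lambda>t. - f t)"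
    if g: "homeomorphism C C g g'" "\<not> orientation_preserving g" for g g'
  proof -
    have "inj_on g C" using g(1) inj_on_inverseI[of C g' g] by (auto simp: homeomorphism_def)
    moreover have "continuous_on C g" "g ` C \<subseteq> C" using g(1) by (auto simp: homeomorphism_def)
    ultimately obtain f where "\<And>t. c (f t) = g (c t)" "circle_lift f \<or> circle_lift (\<lambda>t. - f t)"
      using lift_monotone by blast
    then show ?thesis using g(2) unfolding orientation_preserving_def by blast
  qed
  obtain f1 where f1: "\<And>t. c (f1 t) = g (c t)" "circle_lift (\<lambda>t. - f1 t)" using lift[OF g] by blast
  obtain f2 where f2: "\<And>t. c (f2 t) = h (c t)" "circle_lift (\<lambda>t. - f2 t)" using lift[OF h] by blast
  have d: "f1 (t + 1) = f1 t - 1" "f2 (t + 1) = f2 t - 1" for t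
    using f1(2) f2(2) unfolding circle_lift_def by (smt (verit))+
  have "circle_lift (f1 \<circ> f2)"
    unfolding circle_lift_def
  proof (intro conjI allI)
    have "continuous_on UNIV (\<lambda>t. - f1 t)" "continuous_on UNIV (\<lambda>t. - f2 t)"
      using f1(2) f2(2) by (simp_all add: circle_lift_def)
    from this[THEN continuous_on_minus] have "continuous_on UNIV f1" "continuous_on UNIV f2"
      by simp_all
    then show "continuous_on UNIV (f1 \<circ> f2)"
      unfolding comp_def by (rule continuous_on_compose2) simp
    have "f1 t < f1 s" "f2 t < f2 s" if "s < t" for s t
      using f1(2) f2(2) that by (auto simp: circle_lift_def strict_mono_def)
    then show "strict_mono (f1 \<circ> f2)" by (auto intro!: strict_monoI)
    show "(f1 \<circ> f2) (t + 1) = (f1 \<circ> f2) t + 1" for t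
      using d(2)[of t] d(1)[of "f2 t - 1"] by simp
  qed
  moreover have "c ((f1 \<circ> f2) t) = k (c t)" for t using f1(1) f2(1) k[of "c t"] c_range by auto
  ultimately show ?thesis unfolding orientation_preserving_def by blast
qed

text \<open>The orientation preserving members have index at most two in \<open>\<Gamma>\<close>. If
  some \<open>g0\<close> reverses the orientation, the mean of \<open>\<nu>\<close> and its
  translate by \<open>g0\<close> is invariant under all of \<open>\<Gamma>\<close>.\<close>

lemma inv_charge_of_preserving:
  assumes \<Gamma>: "homeo_group C \<Gamma>" and \<nu>: "inv_charge {g \<in> \<Gamma>. orientation_preserving g} (top_of_set C) \<nu>"
  shows "\<exists>\<nu>'. inv_charge \<Gamma> (top_of_set C) \<nu>'"
proof (cases "\<forall>g\<in>\<Gamma>. orientation_preserving g")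
  case True
  then have "{g \<in> \<Gamma>. orientation_preserving g} = \<Gamma>" by blast
  then show ?thesis using \<nu> by auto
next
  case False
  let ?X = "top_of_set C"
  obtain g0 where g0: "g0 \<in> \<Gamma>" "\<not> orientation_preserving g0" using False by blast
  obtain g0' where g0': "g0' \<in> \<Gamma>" "homeomorphism C C g0 g0'" using homeo_groupD[OF \<Gamma> g0(1)] by blast
  have rev': "\<not> orientation_preserving g0'" using orientation_preserving_inverse[OF _ homeomorphism_symD[OF g0'(2)]] g0(2) by blast
  have ch: "charge ?X \<nu>" and inv: "\<And>g E. g \<in> \<Gamma> \<Longrightarrow> orientation_preserving g \<Longrightarrow> E \<in> borel_sets_of ?X \<Longrightarrow> \<nu> (g ` E) = \<nu> E"
    using \<nu> by (auto simp: inv_charge_def)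
  have sub: "E \<subseteq> C" if "E \<in> borel_sets_of ?X" for E using borel_sets_of_subset[OF that] by simp
  have bim: "g ` E \<in> borel_sets_of ?X" if "g \<in> \<Gamma>" "E \<in> borel_sets_of ?X" for g E
    using homeo_groupD[OF \<Gamma> that(1)] borel_sets_of_image[OF homeomorphic_map_of_homeomorphism that(2)] by blast
  have comp: "\<exists>k\<in>\<Gamma>. \<forall>x\<in>C. k x = f (g x)" if "f \<in> \<Gamma>" "g \<in> \<Gamma>" for f g
    using \<Gamma> that unfolding homeo_group_def by blast
  \<comment> \<open>Any two reversing members differ by a preserving one, so they all translate
    \<open>\<nu>\<close> to the same charge.\<close>
  have rev: "\<nu> (k ` E) = \<nu> (g0 ` E)" if k: "k \<in> \<Gamma>" "\<not> orientation_preserving k" and E: "E \<in> borel_sets_of ?X" for k E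
  proof -
    obtain k' where k': "homeomorphism C C k k'" using homeo_groupD[OF \<Gamma> k(1)] by blast
    obtain m where m: "m \<in> \<Gamma>" "\<forall>x\<in>C. m x = k (g0' x)" using comp[OF k(1) g0'(1)] by blast
    have "orientation_preserving m"
      using reversing_comp[OF k' k(2) homeomorphism_symD[OF g0'(2)] rev'] m(2) by blast
    moreover have "m (g0 x) = k x" if "x \<in> E" for x
    proof -
      have "x \<in> C" using sub[OF E] that by blast
      then have "g0 x \<in> C" "g0' (g0 x) = x" using g0'(2) by (auto simp: homeomorphism_def)
      then show ?thesis using m(2) by simp
    qed
    then have "m ` (g0 ` E) = k ` E" by (simp add: image_image)
    ultimately show ?thesis using inv[OF m(1) _ bim[OF g0(1) E]] by simp
  qed
  have "inv_charge \<Gamma> ?X (\<lambda>E. (\<nu> E + \<nu> (g0 ` E)) / 2)"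
    unfolding inv_charge_def charge_def
  proof (intro conjI ballI impI)
    fix E assume E: "E \<in> borel_sets_of ?X"
    show "0 \<le> (\<nu> E + \<nu> (g0 ` E)) / 2" using ch E bim[OF g0(1) E] by (simp add: charge_def)
    fix F assume F: "F \<in> borel_sets_of ?X" and EF: "E \<inter> F = {}"
    have "inj_on g0 C" using g0'(2) inj_on_inverseI[of C g0' g0] by (auto simp: homeomorphism_def)
    then have "g0 ` E \<inter> g0 ` F = {}"
      using inj_on_image_Int[OF _ sub[OF E] sub[OF F]] EF by fastforce
    then have "\<nu> (g0 ` (E \<union> F)) = \<nu> (g0 ` E) + \<nu> (g0 ` F)"
      using ch bim[OF g0(1) E] bim[OF g0(1) F] by (simp add: charge_def image_Un)
    moreover have "\<nu> (E \<union> F) = \<nu> E + \<nu> F" using ch E F EF by (simp add: charge_def)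
    ultimately show "(\<nu> (E \<union> F) + \<nu> (g0 ` (E \<union> F))) / 2 = (\<nu> E + \<nu> (g0 ` E)) / 2 + (\<nu> F + \<nu> (g0 ` F)) / 2"
      by (simp add: field_simps)
  next
    have "g0 ` C = C" using g0'(2) by (simp add: homeomorphism_def)
    then show "(\<nu> (topspace ?X) + \<nu> (g0 ` topspace ?X)) / 2 = 1" using ch by (simp add: charge_def)
  next
    fix g E assume g: "g \<in> \<Gamma>" and E: "E \<in> borel_sets_of ?X"
    obtain g' where g': "homeomorphism C C g g'" using homeo_groupD[OF \<Gamma> g] by blast
    obtain n where n: "n \<in> \<Gamma>" "\<forall>x\<in>C. n x = g0 (g x)" using comp[OF g0(1) g] by blast
    have nE: "n ` E = g0 ` (g ` E)" using n(2) sub[OF E] by (auto simp: image_image intro!: image_cong)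
    show "(\<nu> (g ` E) + \<nu> (g0 ` g ` E)) / 2 = (\<nu> E + \<nu> (g0 ` E)) / 2"
    proof (cases "orientation_preserving g")
      case True
      have "\<not> orientation_preserving n"
      proof
        assume "orientation_preserving n"
        moreover have "g0 x = n (g' x)" if "x \<in> C" for x
        proof -
          have "g' x \<in> C" "g (g' x) = x" using g' that by (auto simp: homeomorphism_def)
          then show ?thesis using n(2) by simp
        qed
        ultimately have "orientation_preserving g0" using orientation_preserving_comp[OF _ orientation_preserving_inverse[OF True g']] by blast
        then show False using g0(2) by blast
      qed
      then show ?thesis using rev[OF n(1) _ E] inv[OF g True E] nE by simp
    next
      case False
      have "orientation_preserving n" using reversing_comp[OF g0'(2) g0(2) g' False] n(2) by blast
      then show ?thesis using rev[OF g False E] inv[OF n(1) _ E] nE by simp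
    qed
  qed
  then show ?thesis by blast
qed

text \<open>\<open>E\<close> is periodic, so its image on the circle is already the image of the
  finite set \<open>E \<inter> {0..1}\<close>, and the uniform distribution on this image can be
  taken.\<close>

lemma inv_charge_of_discrete:
  assumes \<Gamma>: "homeo_group C \<Gamma>" and E: "E \<noteq> {}" "finite (E \<inter> {0..1})"
    and inv: "\<And>f x. f \<in> lifts \<Gamma> \<Longrightarrow> x \<in> E \<Longrightarrow> f x \<in> E"
  shows "\<exists>\<nu>. inv_charge {g \<in> \<Gamma>. orientation_preserving g} (top_of_set C) \<nu>"
proof (rule exI, rule inv_charge_of_finite[where F = "c ` E"])
  have "c ` E \<subseteq> c ` (E \<inter> {0..1})"
  proof
    fix x assume "x \<in> c ` E"
    then obtain t where t: "t \<in> E" "x = c t" by blast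
    have "t + of_int (- \<lfloor>t\<rfloor>) \<in> E" 
      by (rule inv_closed_shift[where \<Phi> = "lifts \<Gamma>"]) (use lift_group_lifts[OF \<Gamma>] inv t(1) in auto)
    moreover have "t + of_int (- \<lfloor>t\<rfloor>) \<in> {0..1}" by (auto; linarith)
    moreover have "c (t + of_int (- \<lfloor>t\<rfloor>)) = x" using c_shift t(2) by metis
    ultimately show "x \<in> c ` (E \<inter> {0..1})" by (metis IntI imageI)
  qed
  then show "finite (c ` E)" using E(2) finite_subset by blast
  show "c ` E \<noteq> {}" using E by simp
  show "c ` E \<subseteq> topspace (top_of_set C)" using c_range by auto
  fix g assume "g \<in> {g \<in> \<Gamma>. orientation_preserving g}"
  then have g: "g \<in> \<Gamma>" "orientation_preserving g" by auto
  obtain g' where g': "homeomorphism C C g g'" using homeo_groupD[OF \<Gamma> g(1)] by blast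
  then show "inj_on g (topspace (top_of_set C))"
    using inj_on_inverseI[of C g' g] by (auto simp: homeomorphism_def)
  obtain f where f: "circle_lift f" "\<And>t. c (f t) = g (c t)" using g(2) unfolding orientation_preserving_def by blast
  then have "f \<in> lifts \<Gamma>" using g(1) unfolding lifts_def by blast
  show "g ` c ` E \<subseteq> c ` E"
  proof
    fix x assume "x \<in> g ` c ` E"
    then obtain t where "t \<in> E" "x = c (f t)" using f(2) by auto
    then show "x \<in> c ` E" using inv[OF \<open>f \<in> lifts \<Gamma>\<close>] by blast
  qed
qed

lemma borel_vimage_cover:
  assumes "E \<in> borel_sets_of (top_of_set C)"
  shows "c -` E \<in> sets borel"
proof -
  have "E \<in> sigma_sets C {U. openin (top_of_set C) U}" using assms by (simp add: borel_sets_of_def)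
  then show ?thesis
  proof (induction E rule: sigma_sets.induct)
    case (Basic U)
    then obtain T where T: "open T" "U = C \<inter> T" by (auto simp: openin_open)
    have "c -` U = c -` T" using T(2) c_range by auto
    then show ?case using open_vimage[OF T(1) c_cont] by simp
  next
    case (Compl E)
    have "c -` (C - E) = - (c -` E)" using c_range by auto
    then show ?case using Compl by simp
  next
    case (Union A)
    then show ?case by (auto simp: vimage_UN)
  qed simp
qed

text \<open>The charge is the image of the height measure on a window of length one. A lift
  \<open>f\<close> carries another window onto it, which is harmless for periodic sets by
  \<open>height_measure_window\<close>.\<close>

lemma inv_charge_of_height:
  assumes \<Gamma>: "homeo_group C \<Gamma>" and F: "mono F" "\<And>x. F (x + 1) = F x + (1::real)"
    and inv: "\<And>f. f \<in> lifts \<Gamma> \<Longrightarrow> \<exists>a. \<forall>x. F (f x) = F x + a"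
  shows "\<exists>\<nu>. inv_charge {g \<in> \<Gamma>. orientation_preserving g} (top_of_set C) \<nu>"
proof -
  let ?\<mu> = "interval_measure (right_height F)"
  let ?X = "top_of_set C"
  define \<nu> where "\<nu> E = measure ?\<mu> ({0<..1} \<inter> c -` E)" for E
  have "circle_lift (\<lambda>x. x + 1)"
    by (auto simp: circle_lift_def strict_mono_def intro!: continuous_intros)
  then have "right_height F 1 = right_height F 0 + 1"
    using right_height_shift[OF F, of "\<lambda>x. x + 1" 1 0] F(2) by simp
  then have unit: "emeasure ?\<mu> {0<..1} = 1"
    using emeasure_height_Ioc[OF F, of 0 1] by simp
  have fin: "emeasure ?\<mu> ({0<..1} \<inter> A) \<noteq> \<infinity>" for A
  proof -
    have "emeasure ?\<mu> ({0<..1} \<inter> A) \<le> 1"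
      using emeasure_mono[of "{0<..1} \<inter> A" "{0<..1}" ?\<mu>] unit by simp
    then show ?thesis by (metis ennreal_one_neq_top infinity_ennreal_def neq_top_trans)
  qed
  have "inv_charge {g \<in> \<Gamma>. orientation_preserving g} ?X \<nu>"
    unfolding inv_charge_def charge_def
  proof (intro conjI ballI impI)
    show "0 \<le> \<nu> E" for E by (simp add: \<nu>_def)
    have "c -` C = UNIV" using c_range by auto
    then show "\<nu> (topspace ?X) = 1" using unit by (simp add: \<nu>_def measure_def)
    fix E E' assume E: "E \<in> borel_sets_of ?X" "E' \<in> borel_sets_of ?X" and EE: "E \<inter> E' = {}"
    have "measure ?\<mu> (({0<..1} \<inter> c -` E) \<union> ({0<..1} \<inter> c -` E')) = measure ?\<mu> ({0<..1} \<inter> c -` E) + measure ?\<mu> ({0<..1} \<inter> c -` E')"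
      using borel_vimage_cover[OF E(1)] borel_vimage_cover[OF E(2)] EE fin by (intro measure_Union) auto
    then show "\<nu> (E \<union> E') = \<nu> E + \<nu> E'" by (simp add: \<nu>_def Int_Un_distrib)
  next
    fix g E assume "g \<in> {g \<in> \<Gamma>. orientation_preserving g}" and E: "E \<in> borel_sets_of ?X"
    then have g: "g \<in> \<Gamma>" "orientation_preserving g" by auto
    obtain g' where g': "homeomorphism C C g g'" using homeo_groupD[OF \<Gamma> g(1)] by blast
    obtain f where f: "circle_lift f" "\<And>t. c (f t) = g (c t)" using g(2) unfolding orientation_preserving_def by blast
    then have "f \<in> lifts \<Gamma>" using g(1) unfolding lifts_def by blast
    then obtain a where a: "\<And>x. F (f x) = F x + a" using inv by blast
    obtain f' where f': "circle_lift f'" "\<And>x. f' (f x) = x" "\<And>x. f (f' x) = x"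
      using circle_lift_inverse[OF f(1)] by blast
    have mf: "strict_mono f" using f by (simp add: circle_lift_def)
    have EC: "E \<subseteq> C" using borel_sets_of_subset[OF E] by simp
    let ?A = "c -` E"
    have A: "?A \<in> sets borel" by (rule borel_vimage_cover[OF E])
    have per: "x + 1 \<in> ?A \<longleftrightarrow> x \<in> ?A" for x using c_shift[of x 1] by simp
    have "c -` (g ` E) = f ` ?A"
    proof (intro equalityI subsetI)
      fix x assume "x \<in> c -` (g ` E)"
      then obtain e where e: "e \<in> E" "c x = g e" by auto
      have "g (c (f' x)) = g e" using f(2)[of "f' x"] f'(3) e by simp
      moreover have "inj_on g C" using g' inj_on_inverseI[of C g' g] by (auto simp: homeomorphism_def)
      moreover have "c (f' x) \<in> C" "e \<in> C" using c_range e EC by auto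
      ultimately have "c (f' x) = e" by (meson inj_onD)
      then show "x \<in> f ` ?A" using f'(3)[of x] e(1) by (intro image_eqI[of _ _ "f' x"]) auto
    next
      fix x assume "x \<in> f ` ?A"
      then show "x \<in> c -` (g ` E)" using f(2) by auto
    qed
    moreover have "{0<..1} \<inter> f ` ?A = f ` ({f' 0<..f' 0 + 1} \<inter> ?A)"
    proof -
      have 1: "f t \<in> {0<..1} \<longleftrightarrow> t \<in> {f' 0<..f' 0 + 1}" for t
        using strict_mono_less[OF mf, of "f' 0" t] strict_mono_less_eq[OF mf, of t "f' 0 + 1"] f'(3)[of 0] f(1)
        by (simp add: circle_lift_def)
      then show ?thesis by blast
    qed
    ultimately have "emeasure ?\<mu> ({0<..1} \<inter> c -` (g ` E)) = emeasure ?\<mu> ({f' 0<..f' 0 + 1} \<inter> ?A)"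
      using height_measure_image(2)[OF F f(1) a, of "{f' 0<..f' 0 + 1} \<inter> ?A"] A by simp
    also have "\<dots> = emeasure ?\<mu> ({0<..1} \<inter> ?A)" by (rule height_measure_window[OF F A per])
    finally show "\<nu> (g ` E) = \<nu> E" by (simp add: \<nu>_def measure_def)
  qed
  then show ?thesis by blast
qed

theorem commuting_inv_charge_circle:
  assumes \<Gamma>: "homeo_group C \<Gamma>" and \<Delta>: "homeo_group C \<Delta>"
    and comm: "\<And>f g x. f \<in> \<Gamma> \<Longrightarrow> g \<in> \<Delta> \<Longrightarrow> x \<in> C \<Longrightarrow> f (g x) = g (f x)"
  shows "\<exists>\<nu>. inv_charge \<Gamma> (top_of_set C) \<nu> \<or> inv_charge \<Delta> (top_of_set C) \<nu>"
proof -
  show ?thesis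
  proof (rule commuting_lift_groups[OF lift_group_lifts[OF \<Gamma>] lift_group_lifts[OF \<Delta>]])
    show "f (k x) = k (f x)" if "f \<in> lifts \<Gamma>" "k \<in> lifts \<Delta>" for f k x
      by (rule lifts_commute[where \<Gamma> = \<Gamma> and \<Delta> = \<Delta>]) (use \<Gamma> \<Delta> comm that in auto)
  next
    fix E assume "E \<noteq> {}" "finite (E \<inter> {0..1})" "\<And>f x. f \<in> lifts \<Gamma> \<Longrightarrow> x \<in> E \<Longrightarrow> f x \<in> E"
    then have "\<exists>\<nu>. inv_charge {g \<in> \<Gamma>. orientation_preserving g} (top_of_set C) \<nu>"
      by (rule inv_charge_of_discrete[OF \<Gamma>])
    then show ?thesis using inv_charge_of_preserving[OF \<Gamma>] by blast
  next
    fix E assume "E \<noteq> {}" "finite (E \<inter> {0..1})" "\<And>f x. f \<in> lifts \<Delta> \<Longrightarrow> x \<in> E \<Longrightarrow> f x \<in> E"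
    then have "\<exists>\<nu>. inv_charge {g \<in> \<Delta>. orientation_preserving g} (top_of_set C) \<nu>"
      by (rule inv_charge_of_discrete[OF \<Delta>])
    then show ?thesis using inv_charge_of_preserving[OF \<Delta>] by blast
  next
    fix F :: "real \<Rightarrow> real"
    assume "mono F" "\<And>x. F (x + 1) = F x + 1" "\<And>f. f \<in> lifts \<Gamma> \<Longrightarrow> \<exists>c. \<forall>x. F (f x) = F x + c"
    then have "\<exists>\<nu>. inv_charge {g \<in> \<Gamma>. orientation_preserving g} (top_of_set C) \<nu>"
      by (rule inv_charge_of_height[OF \<Gamma>])
    then show ?thesis using inv_charge_of_preserving[OF \<Gamma>] by blast
  qed
qed

end

section \<open>From the circle to loops in a continuum\<close>

text \<open>A homeomorphism with the unit circle transports the exponential covering. Lifts exist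
  because a nonvanishing continuous function on the contractible line has a continuous
  logarithm.\<close>

lemma circle_cover_loop:
  fixes l :: "real \<Rightarrow> 'a::metric_space"
  assumes "loop_in S l"
  shows "\<exists>c. circle_cover (path_image l) c"
proof -
  let ?C = "path_image l"
  have "?C homeomorphic sphere (0::complex) 1"
    using assms by (intro homeomorphic_simple_path_image_circle) (auto simp: loop_in_def)
  then obtain \<eta> \<theta> where h: "homeomorphism ?C (sphere (0::complex) 1) \<eta> \<theta>"
    by (auto simp: homeomorphic_def)
  have \<theta>: "continuous_on (sphere 0 1) \<theta>" "\<theta> ` sphere 0 1 = ?C" "\<And>z. z \<in> sphere 0 1 \<Longrightarrow> \<eta> (\<theta> z) = z"
    and \<eta>: "continuous_on ?C \<eta>" "\<eta> ` ?C = sphere 0 1" "\<And>x. x \<in> ?C \<Longrightarrow> \<theta> (\<eta> x) = x"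
    using h by (auto simp: homeomorphism_def)
  define w where "w t = exp (\<i> * complex_of_real (2 * pi * t))" for t
  have w_sphere: "w t \<in> sphere 0 1" for t by (simp add: w_def)
  have w_cont: "continuous_on UNIV w" unfolding w_def by (intro continuous_intros)
  have w_eq: "w s = w t \<longleftrightarrow> (\<exists>n::int. s - t = of_int n)" for s t
  proof -
    have "w s = w t \<longleftrightarrow> (\<exists>n::int. \<i> * complex_of_real (2 * pi * s) = \<i> * complex_of_real (2 * pi * t) + (of_int (2 * n) * pi) * \<i>)"
      unfolding w_def by (rule exp_eq)
    also have "\<dots> \<longleftrightarrow> (\<exists>n::int. s - t = of_int n)"
    proof (intro ex_cong1)
      fix n :: int
      have "\<i> * complex_of_real (2 * pi * s) = \<i> * complex_of_real (2 * pi * t) + (of_int (2 * n) * pi) * \<i>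
          \<longleftrightarrow> 2 * pi * s = 2 * pi * t + 2 * of_int n * pi"
        by (auto simp: complex_eq_iff)
      also have "\<dots> \<longleftrightarrow> 2 * pi * (s - t) = 2 * pi * of_int n"
        by (auto simp: algebra_simps)
      also have "\<dots> \<longleftrightarrow> s - t = of_int n" by simp
      finally show "\<i> * complex_of_real (2 * pi * s) = \<i> * complex_of_real (2 * pi * t) + (of_int (2 * n) * pi) * \<i>
          \<longleftrightarrow> s - t = of_int n" .
    qed
    finally show ?thesis .
  qed
  have w_surj: "\<exists>t. z = w t" if "z \<in> sphere 0 1" for z
  proof -
    have "norm z = 1" using that by simp
    then obtain x where "z = exp (\<i> * complex_of_real x)" using complex_norm_eq_1_exp[of z] by metis
    then have "z = w (x / (2 * pi))" by (simp add: w_def)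
    then show ?thesis by blast
  qed
  have "circle_cover ?C (\<theta> \<circ> w)"
  proof
    show "continuous_on UNIV (\<theta> \<circ> w)"
      using w_sphere by (intro continuous_on_compose w_cont continuous_on_subset[OF \<theta>(1)]) auto
    have "range w = sphere 0 1" using w_sphere w_surj by blast
    then show "range (\<theta> \<circ> w) = ?C" using \<theta>(2) by (simp add: image_comp flip: image_image)
    show "(\<theta> \<circ> w) s = (\<theta> \<circ> w) t \<longleftrightarrow> (\<exists>n::int. s - t = of_int n)" for s t
      using \<theta>(3)[OF w_sphere[of s]] \<theta>(3)[OF w_sphere[of t]] w_eq[of s t] by (metis comp_apply)
    fix g assume g: "continuous_on ?C g" "g ` ?C \<subseteq> ?C"
    define u where "u t = \<eta> (g (\<theta> (w t)))" for t
    have \<theta>C: "\<theta> (w t) \<in> ?C" for t using \<theta>(2) w_sphere by blast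
    then have gC: "g (\<theta> (w t)) \<in> ?C" for t using g(2) by blast
    have us: "u t \<in> sphere 0 1" for t using gC \<eta>(2) unfolding u_def by blast
    have "continuous_on UNIV (\<lambda>t. \<theta> (w t))"
      using w_sphere by (intro continuous_on_compose2[OF \<theta>(1) w_cont]) auto
    then have "continuous_on UNIV (\<lambda>t. g (\<theta> (w t)))"
      using \<theta>C by (intro continuous_on_compose2[OF g(1)]) auto
    then have uc: "continuous_on UNIV u"
      unfolding u_def using gC by (intro continuous_on_compose2[OF \<eta>(1)]) auto
    obtain v where vc: "continuous_on UNIV v" and vu: "\<And>t. t \<in> UNIV \<Longrightarrow> u t = exp (v t)"
    proof (rule continuous_logarithm_on_contractible[OF uc])
      show "contractible (UNIV :: real set)" by (simp add: convex_imp_contractible)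
      show "u t \<noteq> 0" for t using us[of t] by auto
    qed blast
    note v = vc vu[OF UNIV_I]
    \<comment> \<open>The values of \<open>u\<close> have modulus 1, so its logarithm
      \<open>v\<close> is purely imaginary, and the imaginary part in units of \<open>2 * pi\<close>
      is a lift.\<close>
    define f where "f t = Im (v t) / (2 * pi)" for t
    have "continuous_on UNIV f" unfolding f_def using v(1) by (intro continuous_intros) auto
    moreover have "(\<theta> \<circ> w) (f t) = g ((\<theta> \<circ> w) t)" for t
    proof -
      have "norm (exp (v t)) = 1" using us[of t] v(2)[of t] by simp
      then have "Re (v t) = 0" by (simp add: norm_exp_eq_Re)
      then have "\<i> * complex_of_real (Im (v t)) = v t" by (simp add: complex_eq_iff)
      moreover have "w (f t) = exp (\<i> * complex_of_real (Im (v t)))" by (simp add: w_def f_def)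
      ultimately have "w (f t) = u t" using v(2) by metis
      then show ?thesis using \<eta>(3)[OF gC[of t]] by (simp add: u_def)
    qed
    ultimately show "\<exists>f. continuous_on UNIV f \<and> (\<forall>t. (\<theta> \<circ> w) (f t) = g ((\<theta> \<circ> w) t))" by blast
  qed
  then show ?thesis by blast
qed

lemma inv_charge_extend:
  fixes S C :: "'a::metric_space set"
  assumes CS: "C \<subseteq> S" and \<nu>: "inv_charge \<Gamma> (top_of_set C) \<nu>"
    and \<Gamma>: "\<And>f. f \<in> \<Gamma> \<Longrightarrow> inj_on f S" "\<And>f. f \<in> \<Gamma> \<Longrightarrow> f ` C = C"
  shows "inv_charge \<Gamma> (top_of_set S) (\<lambda>E. \<nu> (E \<inter> C))"
proof -
  have b: "E \<inter> C \<in> borel_sets_of (top_of_set C)" if "E \<in> borel_sets_of (top_of_set S)" for E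
  proof -
    have "E \<in> sigma_sets S {U. openin (top_of_set S) U}" using that by (simp add: borel_sets_of_def)
    then show ?thesis
    proof (induction E rule: sigma_sets.induct)
      case (Basic U)
      then obtain T where "open T" "U = S \<inter> T" by (auto simp: openin_open)
      then have "openin (top_of_set C) (U \<inter> C)" using CS by (auto simp: openin_open)
      then show ?case by (rule borel_sets_of_open)
    next
      case (Compl E)
      have "(S - E) \<inter> C = topspace (top_of_set C) - E \<inter> C" using CS by auto
      then show ?case using borel_sets_of_Diff[OF borel_sets_of_topspace Compl.IH] by simp
    next
      case (Union A)
      have "(\<Union>i. A i \<inter> C) \<in> borel_sets_of (top_of_set C)"
        unfolding borel_sets_of_def
        by (rule sigma_sets.Union) (use Union.IH in \<open>simp add: borel_sets_of_def\<close>)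
      moreover have "\<Union> (range A) \<inter> C = (\<Union>i. A i \<inter> C)" by blast
      ultimately show ?case by (simp only:)
    qed (simp add: borel_sets_of_empty)
  qed
  have ch: "charge (top_of_set C) \<nu>" and inv: "\<And>f E. f \<in> \<Gamma> \<Longrightarrow> E \<in> borel_sets_of (top_of_set C) \<Longrightarrow> \<nu> (f ` E) = \<nu> E"
    using \<nu> by (auto simp: inv_charge_def)
  show ?thesis
    unfolding inv_charge_def charge_def
  proof (intro conjI ballI impI)
    show "0 \<le> \<nu> (E \<inter> C)" if "E \<in> borel_sets_of (top_of_set S)" for E
      using ch b[OF that] by (simp add: charge_def)
    have "topspace (top_of_set S) \<inter> C = topspace (top_of_set C)" using CS by auto
    then show "\<nu> (topspace (top_of_set S) \<inter> C) = 1" using ch by (simp add: charge_def)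
    show "\<nu> ((E \<union> E') \<inter> C) = \<nu> (E \<inter> C) + \<nu> (E' \<inter> C)"
      if "E \<in> borel_sets_of (top_of_set S)" "E' \<in> borel_sets_of (top_of_set S)" "E \<inter> E' = {}" for E E'
      using ch b[OF that(1)] b[OF that(2)] that(3) by (simp add: charge_def Int_Un_distrib2 disjoint_iff)
    show "\<nu> (f ` E \<inter> C) = \<nu> (E \<inter> C)" if f: "f \<in> \<Gamma>" and E: "E \<in> borel_sets_of (top_of_set S)" for f E
    proof -
      have "E \<subseteq> S" using borel_sets_of_subset[OF E] by simp
      then have "f ` (E \<inter> C) = f ` E \<inter> C" using inj_on_image_Int[OF \<Gamma>(1)[OF f], of E C] CS \<Gamma>(2)[OF f] by simp
      then show ?thesis using inv[OF f b[OF E]] by simp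
    qed
  qed
qed

lemma homeo_group_inj_on: "homeo_group S \<Gamma> \<Longrightarrow> f \<in> \<Gamma> \<Longrightarrow> inj_on f S"
  using homeo_groupD[of S \<Gamma> f] by (auto simp: homeomorphism_def intro: inj_on_inverseI)

theorem (in continuum_without_small_loops) commuting_inv_charge:
  assumes \<Gamma>: "homeo_group S \<Gamma>" and \<Delta>: "homeo_group S \<Delta>" and "S \<noteq> {}"
    and comm: "\<And>f g x. f \<in> \<Gamma> \<Longrightarrow> g \<in> \<Delta> \<Longrightarrow> x \<in> S \<Longrightarrow> f (g x) = g (f x)"
  shows "\<exists>\<nu>. inv_charge \<Gamma> (top_of_set S) \<nu> \<or> inv_charge \<Delta> (top_of_set S) \<nu>"
proof -
  have fin: ?thesis if F: "finite F" "F \<noteq> {}" "F \<subseteq> S" "(\<forall>f\<in>\<Gamma>. f ` F \<subseteq> F) \<or> (\<forall>g\<in>\<Delta>. g ` F \<subseteq> F)" for F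
  proof -
    have Ft: "F \<subseteq> topspace (top_of_set S)" using F(3) by simp
    from F(4) show ?thesis
    proof
      assume "\<forall>f\<in>\<Gamma>. f ` F \<subseteq> F"
      then have "inv_charge \<Gamma> (top_of_set S) (\<lambda>E. card (E \<inter> F) / card F)"
        using homeo_group_inj_on[OF \<Gamma>] by (intro inv_charge_of_finite F(1,2) Ft) auto
      then show ?thesis by blast
    next
      assume "\<forall>f\<in>\<Delta>. f ` F \<subseteq> F"
      then have "inv_charge \<Delta> (top_of_set S) (\<lambda>E. card (E \<inter> F) / card F)"
        using homeo_group_inj_on[OF \<Delta>] by (intro inv_charge_of_finite F(1,2) Ft) auto
      then show ?thesis by blast
    qed
  qed
  show ?thesis
  proof (cases rule: loops_trichotomy)
    case 1
    interpret loop_free_continuum S using compact lpc pc 1 by unfold_locales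
    have "\<exists>F. finite F \<and> F \<noteq> {} \<and> F \<subseteq> S \<and> ((\<forall>f\<in>\<Gamma>. f ` F \<subseteq> F) \<or> (\<forall>g\<in>\<Delta>. g ` F \<subseteq> F))"
      by (rule commuting_finite_invariant_set[OF \<Gamma> \<Delta> \<open>S \<noteq> {}\<close>]) (rule comm)
    then show ?thesis using fin by blast
  next
    case (2 l)
    let ?C = "path_image l"
    have CS: "?C \<subseteq> S" using 2(1) by (simp add: loop_in_def)
    \<comment> \<open>The image of the only loop is a loop again, so both groups act on it.\<close>
    have im: "f ` ?C = ?C" if "homeomorphism S S f g" for f g
      using 2(2)[OF loop_in_homeomorphism[OF that 2(1)]] by (simp add: path_image_compose)
    have hg: "homeo_group ?C G" if G: "homeo_group S G" for G
      unfolding homeo_group_def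
    proof (intro conjI ballI)
      show "\<exists>g\<in>G. homeomorphism ?C ?C f g" if f: "f \<in> G" for f
      proof -
        obtain g where g: "g \<in> G" "homeomorphism S S f g" using homeo_groupD[OF G f] by blast
        then show ?thesis using homeomorphism_of_subsets[OF g(2) CS CS im[OF g(2)]] by blast
      qed
      show "G \<noteq> {}" using G by (simp add: homeo_group_def)
      show "\<exists>k\<in>G. \<forall>x\<in>?C. k x = f (g x)" if "f \<in> G" "g \<in> G" for f g
        using G that CS unfolding homeo_group_def by blast
    qed
    obtain c where "circle_cover ?C c" using circle_cover_loop[OF 2(1)] by blast
    then interpret circle_cover ?C c .
    obtain \<nu> where \<nu>: "inv_charge \<Gamma> (top_of_set ?C) \<nu> \<or> inv_charge \<Delta> (top_of_set ?C) \<nu>"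
      using commuting_inv_charge_circle[OF hg[OF \<Gamma>] hg[OF \<Delta>]] comm CS by blast
    have imG: "f ` ?C = ?C" if "homeo_group S G" "f \<in> G" for f G
      using homeo_groupD[OF that] im by blast
    show ?thesis
      using \<nu> inv_charge_extend[OF CS _ homeo_group_inj_on[OF \<Gamma>] imG[OF \<Gamma>]]
        inv_charge_extend[OF CS _ homeo_group_inj_on[OF \<Delta>] imG[OF \<Delta>]] by blast
  next
    case (3 F)
    then show ?thesis using fin[of F] homeo_groupD[OF \<Gamma>] by blast
  qed
qed

section \<open>Local dendrites\<close>

text \<open>
  The Kuratowski embedding \<open>x \<mapsto> d x\<close>, which makes the path calculus of normed spaces available. The
  type of discrete points makes every bounded function continuous.
\<close>

lemma compact_metrizable_embedding:
  fixes X :: "'a topology"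
  assumes "compact_space X" "metrizable_space X"
  shows "\<exists>e :: 'a \<Rightarrow> 'a discrete \<Rightarrow>\<^sub>C real. homeomorphic_map X (top_of_set (e ` topspace X)) e"
proof -
  obtain M d where "Metric_space M d" and X: "X = Metric_space.mtopology M d"
    using assms(2) unfolding metrizable_space_def by blast
  interpret Metric_space M d by fact
  have top: "topspace X = M" using X by simp
  have "compactin mtopology M" using assms(1) X by (simp add: compact_space_def)
  then have "mbounded M" by (rule compactin_imp_mbounded)
  then obtain B where "\<forall>x\<in>M. \<forall>y\<in>M. d x y \<le> B"
    unfolding mbounded_alt by blast
  then have B: "d x y \<le> B" if "x \<in> M" "y \<in> M" for x y
    using that by blast
  define e0 where "e0 x = (\<lambda>y. if of_discrete y \<in> M then d x (of_discrete y) else 0)" for x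
  define e :: "'a \<Rightarrow> 'a discrete \<Rightarrow>\<^sub>C real" where "e x = Bcontfun (e0 x)" for x
  have app: "apply_bcontfun (e x) = e0 x" if x: "x \<in> M" for x
    unfolding e_def
  proof (rule Bcontfun_inverse)
    have "continuous_on UNIV (e0 x)"
      by (auto simp: continuous_on_open_vimage open_discrete)
    moreover have "0 \<le> B" using B[OF x x] x by simp
    then have "bounded (range (e0 x))"
      unfolding bounded_iff using B[OF x] by (intro exI[of _ B]) (auto simp: e0_def)
    ultimately show "e0 x \<in> bcontfun" by (simp add: bcontfun_def)
  qed
  have dist: "dist (e x) (e y) = d x y" if xy: "x \<in> M" "y \<in> M" for x y
  proof (rule antisym)
    show "dist (e x) (e y) \<le> d x y"
    proof (rule dist_bound)
      fix z
      show "dist (apply_bcontfun (e x) z) (apply_bcontfun (e y) z) \<le> d x y"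
      proof (cases "of_discrete z \<in> M")
        case True
        then show ?thesis
          using triangle[of x y "of_discrete z"] triangle[of y x "of_discrete z"] xy
          by (simp add: app e0_def dist_real_def commute abs_le_iff)
      qed (use xy in \<open>simp add: app e0_def\<close>)
    qed
    \<comment> \<open>Evaluation at the point \<open>y\<close> itself shows that no distance
      shrinks.\<close>
    have "dist (apply_bcontfun (e x) (discrete y)) (apply_bcontfun (e y) (discrete y)) \<le> dist (e x) (e y)"
      by (rule dist_bounded)
    then show "d x y \<le> dist (e x) (e y)"
      using xy by (simp add: app e0_def discrete_inverse dist_real_def)
  qed
  have "continuous_map X euclidean e"
    unfolding X
    using metric_continuous_map[OF Met_TC.Metric_space_axioms, of e] dist by auto
  then have "continuous_map X (top_of_set (e ` topspace X)) e"
    by (simp add: continuous_map_in_subtopology)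
  moreover have "inj_on e (topspace X)"
  proof (rule inj_onI)
    fix x y assume "x \<in> topspace X" "y \<in> topspace X" "e x = e y"
    then show "x = y" using dist[of x y] by (simp add: top)
  qed
  moreover have "Hausdorff_space (top_of_set (e ` topspace X))"
    by (simp add: Hausdorff_space_subtopology)
  ultimately have "homeomorphic_map X (top_of_set (e ` topspace X)) e"
    using assms(1) by (intro continuous_imp_homeomorphic_map) auto
  then show ?thesis by blast
qed

lemma local_dendrite_locally_connected:
  assumes "local_dendrite X"
  shows "locally_connected_space X"
  unfolding locally_connected_space
proof (intro allI impI)
  fix W x assume "openin X W \<and> x \<in> W"
  then have W: "openin X W" "x \<in> W" by auto
  then have "x \<in> topspace X" using openin_subset by blast
  then obtain U N where UN: "openin X U" "x \<in> U" "U \<subseteq> N" "N \<subseteq> topspace X" "dendrite (subtopology X N)"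
    using assms unfolding local_dendrite_def by blast
  have "openin (subtopology X N) (U \<inter> W)"
    using openin_Int[OF UN(1) W(1)] UN(3) by (auto simp: openin_subtopology)
  then obtain V where V: "openin (subtopology X N) V" "connectedin (subtopology X N) V" "x \<in> V" "V \<subseteq> U \<inter> W"
    using UN(2,5) W(2) unfolding dendrite_def locally_connected_space by (meson IntI)
  obtain T where T: "openin X T" "V = T \<inter> N" using V(1) by (auto simp: openin_subtopology)
  \<comment> \<open>So far \<open>V\<close> is open only relative to \<open>N\<close>, which need
    not be open. As \<open>V\<close> lies in the open set \<open>U\<close>, it is open in
    \<open>X\<close>.\<close>
  have "V = T \<inter> U" using T(2) V(4) UN(3) by blast
  then have "openin X V" using T(1) UN(1) by auto
  moreover have "connectedin X V" using V(2) by (simp add: connectedin_subtopology)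
  ultimately show "\<exists>V. openin X V \<and> connectedin X V \<and> x \<in> V \<and> V \<subseteq> W" using V by blast
qed

text \<open>Every point has a neighbourhood inside a dendrite and hence free of loops; compactness
  gives one radius for all points.\<close>

lemma local_dendrite_image:
  fixes e :: "'a \<Rightarrow> 'b::{complete_space,real_normed_vector}"
  assumes X: "local_dendrite X" and e: "homeomorphic_map X (top_of_set S) e"
  shows "\<exists>\<epsilon>. continuum_without_small_loops S \<epsilon>"
proof -
  have cont: "compact_space X" "connected_space X"
    using X by (auto simp: local_dendrite_def continuum_def)
  have hs: "X homeomorphic_space top_of_set S"
    using e homeomorphic_map_imp_homeomorphic_space by blast
  have surj: "e ` topspace X = S" using homeomorphic_imp_surjective_map[OF e] by simp
  have inj: "inj_on e (topspace X)" by (rule homeomorphic_imp_injective_map[OF e])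
  have "compact_space (top_of_set S)" using homeomorphic_compact_space[OF hs] cont(1) by simp
  then have compact: "compact S" by (simp add: compact_space_def compactin_subtopology)
  have "connected_space (top_of_set S)" using homeomorphic_connected_space[OF hs] cont(2) by simp
  then have conn: "connected S"
    using connectedin_topspace[of "top_of_set S"] by (simp add: connectedin_subtopology)
  have "locally_connected_space (top_of_set S)"
    using homeomorphic_locally_connected_space[OF hs] local_dendrite_locally_connected[OF X] by simp
  then have lc: "\<exists>U. openin (top_of_set S) U \<and> connectedin (top_of_set S) U \<and> x \<in> U \<and> U \<subseteq> V"
    if "openin (top_of_set S) V" "x \<in> V" for V x
    using that unfolding locally_connected_space by blast
  have "locally connected S"
    unfolding locally_connected
  proof (intro allI impI)
    fix V x assume "openin (top_of_set S) V \<and> x \<in> V"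
    then obtain U where U: "openin (top_of_set S) U" "connectedin (top_of_set S) U" "x \<in> U" "U \<subseteq> V"
      using lc by blast
    then have "connected U" by (simp add: connectedin_subtopology)
    then show "\<exists>U. openin (top_of_set S) U \<and> connected U \<and> x \<in> U \<and> U \<subseteq> V" using U by blast
  qed
  then have lpc: "locally path_connected S"
    by (rule locally_connected_imp_locally_path_connected[OF compact])
  then have pc: "path_connected S" 
    using conn path_component_eq_connected_component[OF lpc]
    by (simp add: path_connected_component connected_iff_connected_component)
  have "\<exists>T. open T \<and> z \<in> T \<and> (\<forall>l. \<not> loop_in (S \<inter> T) l)" if z: "z \<in> S" for z
  proof -
    obtain x where x: "x \<in> topspace X" "z = e x" using z surj by blast
    then obtain U N where UN: "openin X U" "x \<in> U" "U \<subseteq> N" "N \<subseteq> topspace X" "dendrite (subtopology X N)"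
      using X unfolding local_dendrite_def by blast
    have "openin (top_of_set S) (e ` U)"
      using homeomorphic_map_openness[OF e openin_subset[OF UN(1)]] UN(1) by blast
    then obtain T where T: "open T" "e ` U = S \<inter> T" by (auto simp: openin_open)
    have "\<not> loop_in (S \<inter> T) l" for l
    proof
      assume l: "loop_in (S \<inter> T) l"
      let ?P = "path_image l"
      have P: "?P \<subseteq> e ` U" using l T(2) by (simp add: loop_in_def)
      define C where "C = {y \<in> U. e y \<in> ?P}"
      have CP: "e ` C = ?P" using P by (auto simp: C_def)
      have CN: "C \<subseteq> N" using UN(3) by (auto simp: C_def)
      have "homeomorphic_map (subtopology X C) (subtopology (top_of_set S) ?P) e"
      proof (rule homeomorphic_map_subtopologies[OF e])
        have "topspace X \<inter> C = C" "S \<inter> ?P = ?P" using CN UN(4) P T(2) by blast+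
        then show "e ` (topspace X \<inter> C) = topspace (top_of_set S) \<inter> ?P" using CP by simp
      qed
      moreover have "subtopology (top_of_set S) ?P = top_of_set ?P"
        using P T(2) by (simp add: subtopology_subtopology Int_absorb1)
      ultimately have "subtopology X C homeomorphic_space top_of_set ?P"
        using homeomorphic_map_imp_homeomorphic_space by metis
      moreover have "?P homeomorphic sphere (0::complex) 1"
        using l by (intro homeomorphic_simple_path_image_circle) (auto simp: loop_in_def)
      then have "top_of_set ?P homeomorphic_space top_of_set (sphere (0::complex) 1)"
        using homeomorphic_map_of_homeomorphism homeomorphic_map_imp_homeomorphic_space
        unfolding homeomorphic_def by metis
      ultimately have "subtopology X C homeomorphic_space top_of_set (sphere (0::complex) 1)"
        by (rule homeomorphic_space_trans)
      moreover have "subtopology (subtopology X N) C = subtopology X C"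
        using CN by (simp add: subtopology_subtopology Int_absorb1)
      ultimately have "simple_closed_curve_in (subtopology X N) C"
        using CN UN(4) by (auto simp: simple_closed_curve_in_def)
      then show False using UN(5) by (auto simp: dendrite_def)
    qed
    moreover have "z \<in> T" using T(2) UN(2) x by blast
    ultimately show ?thesis using T(1) by blast
  qed
  then obtain T where T: "\<And>z. z \<in> S \<Longrightarrow> open (T z)" "\<And>z. z \<in> S \<Longrightarrow> z \<in> T z" "\<And>z l. z \<in> S \<Longrightarrow> \<not> loop_in (S \<inter> T z) l"
    by metis
  have "S \<subseteq> \<Union> (T ` S)" using T(2) by blast
  then obtain \<epsilon> where \<epsilon>: "0 < \<epsilon>" "\<And>x. x \<in> S \<Longrightarrow> \<exists>G\<in>T ` S. ball x \<epsilon> \<subseteq> G"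
    using Heine_Borel_lemma[OF compact, of "T ` S"] T(1) by blast
  \<comment> \<open>Centres may be arbitrary points of the ambient space, while the Lebesgue number
    is valid for centres in \<open>S\<close>. Moving the centre to a point of the loop costs half
    the radius.\<close>
  have "\<not> loop_in (S \<inter> ball x (\<epsilon>/2)) l" for x l
  proof
    assume l: "loop_in (S \<inter> ball x (\<epsilon>/2)) l"
    define y where "y = pathstart l"
    have y: "y \<in> S \<inter> ball x (\<epsilon>/2)" using l pathstart_in_path_image[of l] by (auto simp: loop_in_def y_def)
    then obtain z where z: "z \<in> S" "ball y \<epsilon> \<subseteq> T z" using \<epsilon>(2) by blast
    have "ball x (\<epsilon>/2) \<subseteq> ball y \<epsilon>"
    proof
      fix w assume "w \<in> ball x (\<epsilon>/2)"
      then show "w \<in> ball y \<epsilon>" using y dist_triangle_half_r[of x y \<epsilon> w] by auto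
    qed
    then have "loop_in (S \<inter> T z) l" using l z(2) by (auto simp: loop_in_def)
    then show False using T(3)[OF z(1)] by blast
  qed
  then have "continuum_without_small_loops S (\<epsilon>/2)"
    using compact lpc pc \<epsilon>(1) by unfold_locales auto
  then show ?thesis by blast
qed

theorem theorem11p3:
  fixes G :: "('g, 'm) monoid_scheme"
    and H K :: "'g set"
    and X :: "'a topology"
    and \<phi> :: "'g \<Rightarrow> 'a \<Rightarrow> 'a"
  assumes "group G"
    and "coamenable H G" and "coamenable K G"
    and "\<forall>h\<in>H. \<forall>k\<in>K. h \<otimes>\<^bsub>G\<^esub> k = k \<otimes>\<^bsub>G\<^esub> h"
    and "local_dendrite X"
    and "action_by_homeomorphisms G X \<phi>"
  shows "\<exists>M. borel_probability_on X M \<and> invariant_measure G \<phi> M"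
proof -
  interpret group G by fact
  interpret group_action G "topspace X" \<phi>
    using assms(6) by (simp add: action_by_homeomorphisms_def)
  have homeo: "homeomorphic_map X X (\<phi> g)" if "g \<in> carrier G" for g
    using assms(6) that by (simp add: action_by_homeomorphisms_def)
  have X: "compact_space X" "metrizable_space X" "topspace X \<noteq> {}"
    using assms(5) by (auto simp: local_dendrite_def continuum_def)
  obtain e :: "'a \<Rightarrow> 'a discrete \<Rightarrow>\<^sub>C real" where e: "homeomorphic_map X (top_of_set (e ` topspace X)) e"
    using compact_metrizable_embedding[OF X(1,2)] by blast
  define S where "S = e ` topspace X"
  obtain e' where ee': "homeomorphic_maps X (top_of_set S) e e'"
    using e unfolding S_def homeomorphic_map_maps by blast
  then have e_cont: "continuous_map X (top_of_set S) e" "continuous_map (top_of_set S) X e'"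
    and e'e: "\<And>x. x \<in> topspace X \<Longrightarrow> e' (e x) = x" and e'S: "\<And>y. y \<in> S \<Longrightarrow> e (e' y) = y"
    by (auto simp: homeomorphic_maps_def)
  have e'top: "e' y \<in> topspace X" if "y \<in> S" for y using that e'e by (auto simp: S_def)
  have eS: "e x \<in> S" if "x \<in> topspace X" for x using that by (simp add: S_def)
  have act_top: "\<phi> g x \<in> topspace X" if "g \<in> carrier G" "x \<in> topspace X" for g x
    using element_image[OF that] by blast
  \<comment> \<open>The action is transported along the embedding, to where the path calculus of
    normed spaces applies. Its values off \<open>S\<close> are arbitrary, in accordance with
    \<open>homeo_group\<close>.\<close>
  define c where "c g y = e (\<phi> g (e' y))" for g y
  have c_mult: "c (g \<otimes>\<^bsub>G\<^esub> h) y = c g (c h y)" if "g \<in> carrier G" "h \<in> carrier G" "y \<in> S" for g h y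
    using composition_rule[OF e'top[OF that(3)] that(1,2)] e'e act_top e'top that by (simp add: c_def)
  have c_inv: "c (inv\<^bsub>G\<^esub> g) (c g y) = y" if g: "g \<in> carrier G" and y: "y \<in> S" for g y
    using orbit_sym_aux[OF g e'top[OF y] refl] e'e[OF act_top[OF g e'top[OF y]]] e'S[OF y] by (simp add: c_def)
  have c_S: "c g y \<in> S" if "g \<in> carrier G" "y \<in> S" for g y
    unfolding c_def by (intro eS act_top e'top that)
  have c_cont: "continuous_on S (c g)" if g: "g \<in> carrier G" for g
  proof -
    have "continuous_map (top_of_set S) (top_of_set S) (e \<circ> (\<phi> g \<circ> e'))"
      using e_cont homeomorphic_imp_continuous_map[OF homeo[OF g]] by (meson continuous_map_compose)
    then show ?thesis by (simp add: c_def comp_def continuous_map_in_subtopology)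
  qed
  have c_homeo: "homeomorphism S S (c g) (c (inv\<^bsub>G\<^esub> g))" if g: "g \<in> carrier G" for g
  proof -
    have g': "inv\<^bsub>G\<^esub> g \<in> carrier G" using g by simp
    have "c h ` S = S" if h: "h \<in> carrier G" for h
    proof (intro equalityI subsetI)
      fix y assume "y \<in> S"
      then show "y \<in> c h ` S"
        using c_inv[of "inv\<^bsub>G\<^esub> h" y] c_S[of "inv\<^bsub>G\<^esub> h" y] h by (intro image_eqI[of _ _ "c (inv\<^bsub>G\<^esub> h) y"]) auto
    qed (use c_S h in blast)
    then show ?thesis
      unfolding homeomorphism_def using c_inv[OF g] c_inv[OF g'] c_cont g g' by simp
  qed
  have grp: "homeo_group S (c ` L)" if L: "subgroup L G" for L
    unfolding homeo_group_def
  proof (intro conjI ballI)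
    note LG = subgroup.mem_carrier[OF L]
    show "\<exists>f'\<in>c ` L. homeomorphism S S f f'" if "f \<in> c ` L" for f
      using that c_homeo LG subgroup.m_inv_closed[OF L] by blast
    show "c ` L \<noteq> {}" using subgroup.one_closed[OF L] by blast
    show "\<exists>k\<in>c ` L. \<forall>x\<in>S. k x = f (g x)" if fg: "f \<in> c ` L" "g \<in> c ` L" for f g
    proof -
      obtain a b where "a \<in> L" "f = c a" "b \<in> L" "g = c b" using fg by blast
      then show ?thesis
        using c_mult LG subgroup.m_closed[OF L] by (intro bexI[of _ "c (a \<otimes>\<^bsub>G\<^esub> b)"]) auto
    qed
  qed
  have HK: "subgroup H G" "subgroup K G" using assms(2,3) by (auto simp: coamenable_def)
  obtain \<epsilon> where "continuum_without_small_loops S \<epsilon>"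
    using local_dendrite_image[OF assms(5), of S e] e by (auto simp: S_def)
  then interpret continuum_without_small_loops S \<epsilon> .
  have "f (g y) = g (f y)" if fg: "f \<in> c ` H" "g \<in> c ` K" "y \<in> S" for f g y
  proof -
    obtain h k where hk: "h \<in> H" "f = c h" "k \<in> K" "g = c k" using fg by blast
    then have "h \<in> carrier G" "k \<in> carrier G" using HK subgroup.mem_carrier by metis+
    moreover have "h \<otimes>\<^bsub>G\<^esub> k = k \<otimes>\<^bsub>G\<^esub> h" using assms(4) hk by blast
    ultimately show ?thesis
      using c_mult[of h k y] c_mult[of k h y] fg(3) hk(2,4) by simp
  qed
  then have "\<exists>\<nu>. inv_charge (c ` H) (top_of_set S) \<nu> \<or> inv_charge (c ` K) (top_of_set S) \<nu>"
    using X(3) by (intro commuting_inv_charge grp HK) (auto simp: S_def)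
  \<comment> \<open>The charge on \<open>S\<close> is pulled back along \<open>e\<close>; averaging
    over the cosets of \<open>L\<close> and regularisation then take place on \<open>X\<close>
    itself.\<close>
  moreover have "\<exists>M. borel_probability_on X M \<and> invariant_measure G \<phi> M"
    if co: "coamenable L G" and \<nu>: "inv_charge (c ` L) (top_of_set S) \<nu>" for L \<nu>
  proof -
    have L: "subgroup L G" using co by (simp add: coamenable_def)
    have eb: "e ` E \<in> borel_sets_of (top_of_set S)" if "E \<in> borel_sets_of X" for E
      using borel_sets_of_image[OF e that] by (simp add: S_def)
    have "inv_charge (\<phi> ` L) X (\<lambda>E. \<nu> (e ` E))"
      unfolding inv_charge_def charge_def
    proof (intro conjI ballI impI)
      show "0 \<le> \<nu> (e ` E)" if "E \<in> borel_sets_of X" for E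
        using \<nu> eb[OF that] by (simp add: inv_charge_def charge_def)
      show "\<nu> (e ` topspace X) = 1" using \<nu> by (simp add: inv_charge_def charge_def S_def)
      show "\<nu> (e ` (E \<union> F)) = \<nu> (e ` E) + \<nu> (e ` F)"
        if E: "E \<in> borel_sets_of X" and F: "F \<in> borel_sets_of X" and EF: "E \<inter> F = {}" for E F
      proof -
        have "e ` E \<inter> e ` F = {}"
          by (subst inj_on_image_Int[OF homeomorphic_imp_injective_map[OF e] borel_sets_of_subset[OF E]
                borel_sets_of_subset[OF F], symmetric]) (simp add: EF)
        then show ?thesis using \<nu> eb[OF E] eb[OF F] by (simp add: inv_charge_def charge_def image_Un)
      qed
      show "\<nu> (e ` f ` E) = \<nu> (e ` E)" if f: "f \<in> \<phi> ` L" and E: "E \<in> borel_sets_of X" for f E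
      proof -
        obtain h where h: "h \<in> L" "f = \<phi> h" using f by blast
        have "e ` f ` E = c h ` (e ` E)"
          using borel_sets_of_subset[OF E] e'e h(2) by (auto simp: c_def image_image subset_iff intro!: image_cong)
        moreover have "\<nu> (c h ` (e ` E)) = \<nu> (e ` E)"
          using \<nu> eb[OF E] h(1) unfolding inv_charge_def by blast
        ultimately show ?thesis by simp
      qed
    qed
    then obtain \<nu>' where "inv_charge (\<phi> ` carrier G) X \<nu>'"
      using inv_charge_coamenable[OF assms(1) co assms(6)] by blast
    then show ?thesis
      using X metrizable_imp_normal_space homeo by (intro invariant_measure_of_inv_charge) auto
  qed
  ultimately show ?thesis using assms(2,3) by blast
qed

end
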